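(* Let $\mathbb{K}$ be a field of characteristic zero and let $\mathcal{D}\subset\mathbb{Z}_+^3$ be a three-dimensional Ferrers diagram which satisfies the projection property. Then the Rees algebra $\mathcal{R}(I_{\mathcal{D}})$ is Koszul and the ideal $I_{\mathcal{D}}$ is of fiber type.
   Context: $\mathbb{Z}_+$ denotes the positive integers. A three-dimensional Ferrers diagram is a finite nonempty set $\mathcal{D}\subset\mathbb{Z}_+^3$ such that whenever $(i_0,j_0,k_0)\in\mathcal{D}$ and $i\le i_0$, $j\le j_0$, $k\le k_0$ are positive integers, then $(i,j,k)\in\mathcal{D}$. Let $a_{\mathcal{D}}$ be the number of distinct first coordinates of points of $\mathcal{D}$. $\mathcal{D}$ satisfies the projection property if for every $2\le i\le a_{\mathcal{D}}$ one has $(i-1,b_i,c_i)\in\mathcal{D}$, where $b_i=\max\{j:(i,j,1)\in\mathcal{D}\}$ and $c_i=\max\{k:(i,1,k)\in\mathcal{D}\}$. Let $m,n,p$ be the maximal first, second, third coordinates of points of $\mathcal{D}$, $R=\mathbb{K}[x_1,\dots,x_m,y_1,\dots,y_n,z_1,\dots,z_p]$ and $I_{\mathcal{D}}=(x_iy_jz_k:(i,j,k)\in\mathcal{D})\subset R$. The Rees algebra is $\mathcal{R}(I_{\mathcal{D}})=R[I_{\mathcal{D}}t]\subset R[t]$. Let $\mathbb{K}[\mathbf{T}_{\mathcal{D}}]=\mathbb{K}[T_{i,j,k}:(i,j,k)\in\mathcal{D}]$ and $R[\mathbf{T}_{\mathcal{D}}]=R[T_{i,j,k}:(i,j,k)\in\mathcal{D}]$.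 Let $\varphi:\mathbb{K}[\mathbf{T}_{\mathcal{D}}]\to R$ be the $\mathbb{K}$-algebra map $T_{i,j,k}\mapsto x_iy_jz_k$, let $\psi:R[\mathbf{T}_{\mathcal{D}}]\to R[t]$ be the $R$-algebra map $T_{i,j,k}\mapsto x_iy_jz_kt$ (so its image is $\mathcal{R}(I_{\mathcal{D}})$), and let $\alpha:R[\mathbf{T}_{\mathcal{D}}]\to\mathrm{Sym}(I_{\mathcal{D}})$ be the canonical surjection onto the symmetric algebra of the $R$-module $I_{\mathcal{D}}$, sending $T_{i,j,k}$ to the generator $x_iy_jz_k$. The ideal $I_{\mathcal{D}}$ is of fiber type if $\ker(\psi)=\ker(\alpha)+\ker(\varphi)R[\mathbf{T}_{\mathcal{D}}]$. A standard graded $\mathbb{K}$-algebra $A$ is Koszul if the residue field $\mathbb{K}=A/A_+$ has a linear resolution over $A$; here $\mathcal{R}(I_{\mathcal{D}})\cong R[\mathbf{T}_{\mathcal{D}}]/\ker(\psi)$ is standard graded by giving all variables $x_i,y_j,z_k,T_{i,j,k}$ degree one. *)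

theory Defs
  imports
    "HOL-Library.Poly_Mapping"
    "HOL-Computational_Algebra.Polynomial"
    "HOL-Algebra.QuotRing"
    "HOL-Algebra.Generated_Rings"
    "HOL-Algebra.Module"
begin

section \<open>Polynomial rings in several variables\<close>

text \<open>
  Polynomials with variables of type \<^typ>\<open>'v\<close> and coefficients of type \<^typ>\<open>'c\<close>; exponent vectors
  are finitely supported functions.
\<close>

type_synonym ('v, 'c) mpoly = "('v \<Rightarrow>\<^sub>0 nat) \<Rightarrow>\<^sub>0 'c"

definition pconst :: "'c::zero \<Rightarrow> ('v, 'c) mpoly" where
  "pconst c = Poly_Mapping.single 0 c"

definition pvar :: "'v \<Rightarrow> ('v, 'c::zero_neq_one) mpoly" where
  "pvar v = Poly_Mapping.single (Poly_Mapping.single v 1) 1"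

text \<open>
  \<open>polys V C\<close> is the polynomial ring $C[v : v \in V]$ inside the type of all polynomials, for a
  subring \<open>C\<close> of the type of coefficients.
\<close>

definition polys :: "'v set \<Rightarrow> 'c set \<Rightarrow> ('v, 'c::zero) mpoly set" where
  "polys V C = {p. \<forall>m \<in> Poly_Mapping.keys p.
     Poly_Mapping.keys m \<subseteq> V \<and> Poly_Mapping.lookup p m \<in> C}"

definition peval :: "('c \<Rightarrow> 'b) \<Rightarrow> ('v \<Rightarrow> 'b) \<Rightarrow> ('v, 'c::zero) mpoly \<Rightarrow> 'b::comm_ring_1" where
  "peval h g p = (\<Sum>m \<in> Poly_Mapping.keys p. h (Poly_Mapping.lookup p m) *
     (\<Prod>v \<in> Poly_Mapping.keys m. g v ^ Poly_Mapping.lookup m v))"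

definition mdeg :: "('v \<Rightarrow>\<^sub>0 nat) \<Rightarrow> nat" where
  "mdeg m = (\<Sum>v \<in> Poly_Mapping.keys m. Poly_Mapping.lookup m v)"

text \<open>A subring of a commutative ring type, as a ring in the sense of HOL-Algebra.\<close>

definition ring_on :: "'a::comm_ring_1 set \<Rightarrow> 'a ring" where
  "ring_on S = \<lparr>carrier = S, mult = (*), one = 1, zero = 0, add = (+)\<rparr>"


section \<open>Koszul algebras\<close>

definition standard_graded ::
  "'a set \<Rightarrow> ('a, 'm) ring_scheme \<Rightarrow> (nat \<Rightarrow> 'a set) \<Rightarrow> bool" where
  "standard_graded K A gr \<longleftrightarrow>
     cring A \<and> subfield K A \<and> gr 0 = K \<and>
     (\<forall>n. additive_subgroup (gr n) A) \<and>
     (\<forall>n k. \<forall>x \<in> gr n. \<forall>y \<in> gr k. x \<otimes>\<^bsub>A\<^esub> y \<in> gr (n + k)) \<and>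
     (\<forall>a \<in> carrier A. \<exists>!f. (\<forall>n. f n \<in> gr n) \<and>
        (\<exists>N. (\<forall>n > N. f n = \<zero>\<^bsub>A\<^esub>) \<and> a = (\<Oplus>\<^bsub>A\<^esub> n \<in> {..N}. f n))) \<and>
     (\<exists>S. finite S \<and> S \<subseteq> gr 1 \<and> carrier A = generate_ring A (K \<union> S))"

definition positive_part :: "('a, 'm) ring_scheme \<Rightarrow> (nat \<Rightarrow> 'a set) \<Rightarrow> 'a set" where
  "positive_part A gr =
     {a. \<exists>N f. (\<forall>n. f n \<in> gr n) \<and> a = (\<Oplus>\<^bsub>A\<^esub> n \<in> {1..N}. f n)}"

text \<open>
  A module over a ring is a record that extends the record of rings; its fields \<open>mult\<close> and \<open>one\<close>
  play no role for modules and are left unspecified where there is no natural choice.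
\<close>

definition residue_module ::
  "('a, 'm) ring_scheme \<Rightarrow> (nat \<Rightarrow> 'a set) \<Rightarrow> ('a, 'a set) module" where
  "residue_module A gr = (let P = positive_part A gr; Q = A Quot P in
     \<lparr>carrier = carrier Q, mult = mult Q, one = one Q, zero = zero Q, add = add Q,
      smult = (\<lambda>a X. (P +>\<^bsub>A\<^esub> a) \<otimes>\<^bsub>Q\<^esub> X)\<rparr>)"

definition residue_grading ::
  "('a, 'm) ring_scheme \<Rightarrow> (nat \<Rightarrow> 'a set) \<Rightarrow> nat \<Rightarrow> 'a set set" where
  "residue_grading A gr n =
     (if n = 0 then carrier (residue_module A gr) else {\<zero>\<^bsub>residue_module A gr\<^esub>})"

definition free_module :: "('a, 'm) ring_scheme \<Rightarrow> nat \<Rightarrow> ('a, nat \<Rightarrow> 'a) module" where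
  "free_module A b =
     \<lparr>carrier = {..<b} \<rightarrow>\<^sub>E carrier A, mult = undefined, one = undefined,
      zero = (\<lambda>j\<in>{..<b}. \<zero>\<^bsub>A\<^esub>), add = (\<lambda>v w. \<lambda>j\<in>{..<b}. v j \<oplus>\<^bsub>A\<^esub> w j),
      smult = (\<lambda>a v. \<lambda>j\<in>{..<b}. a \<otimes>\<^bsub>A\<^esub> v j)\<rparr>"

text \<open>The graded components of $A(-s)^b$.\<close>

definition free_grading ::
  "('a, 'm) ring_scheme \<Rightarrow> (nat \<Rightarrow> 'a set) \<Rightarrow> nat \<Rightarrow> nat \<Rightarrow> nat \<Rightarrow> (nat \<Rightarrow> 'a) set" where
  "free_grading A gr s b n = {..<b} \<rightarrow>\<^sub>E (if s \<le> n then gr (n - s) else {\<zero>\<^bsub>A\<^esub>})"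

definition module_homs ::
  "('a, 'm) ring_scheme \<Rightarrow> ('a, 'b) module \<Rightarrow> ('a, 'c) module \<Rightarrow> ('b \<Rightarrow> 'c) set" where
  "module_homs A M N = {h. h \<in> carrier M \<rightarrow> carrier N \<and>
     (\<forall>x \<in> carrier M. \<forall>y \<in> carrier M. h (x \<oplus>\<^bsub>M\<^esub> y) = h x \<oplus>\<^bsub>N\<^esub> h y) \<and>
     (\<forall>a \<in> carrier A. \<forall>x \<in> carrier M. h (a \<odot>\<^bsub>M\<^esub> x) = a \<odot>\<^bsub>N\<^esub> h x)}"

definition graded_homs ::
  "('a, 'm) ring_scheme \<Rightarrow> ('a, 'b) module \<Rightarrow> (nat \<Rightarrow> 'b set) \<Rightarrow>
   ('a, 'c) module \<Rightarrow> (nat \<Rightarrow> 'c set) \<Rightarrow> ('b \<Rightarrow> 'c) set" where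
  "graded_homs A M grM N grN = {h \<in> module_homs A M N. \<forall>n. h ` grM n \<subseteq> grN n}"

text \<open>
  A graded free resolution $\dots \to F_2 \to F_1 \to F_0 \to M \to 0$, with maps homogeneous of
  degree 0, in which $F_i = A(-q-i)^{b_i}$.  Such a resolution is automatically minimal.
\<close>

definition has_linear_resolution ::
  "('a, 'm) ring_scheme \<Rightarrow> (nat \<Rightarrow> 'a set) \<Rightarrow> nat \<Rightarrow> ('a, 'b) module \<Rightarrow> (nat \<Rightarrow> 'b set) \<Rightarrow> bool" where
  "has_linear_resolution A gr q M grM \<longleftrightarrow>
     (\<exists>(b :: nat \<Rightarrow> nat) \<epsilon> d.
        let F = (\<lambda>i. free_module A (b i)); G = (\<lambda>i. free_grading A gr (q + i) (b i)) in
        \<epsilon> \<in> graded_homs A (F 0) (G 0) M grM \<and>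
        (\<forall>i. d i \<in> graded_homs A (F (Suc i)) (G (Suc i)) (F i) (G i)) \<and>
        \<epsilon> ` carrier (F 0) = carrier M \<and>
        d 0 ` carrier (F 1) = a_kernel (F 0) M \<epsilon> \<and>
        (\<forall>i. d (Suc i) ` carrier (F (Suc (Suc i))) = a_kernel (F (Suc i)) (F i) (d i)))"

definition koszul :: "'a set \<Rightarrow> ('a, 'm) ring_scheme \<Rightarrow> (nat \<Rightarrow> 'a set) \<Rightarrow> bool" where
  "koszul K A gr \<longleftrightarrow> standard_graded K A gr \<and>
     has_linear_resolution A gr 0 (residue_module A gr) (residue_grading A gr)"


section \<open>Symmetric algebra of a module\<close>

text \<open>
  For a subring \<open>R\<close> and an \<open>R\<close>-module \<open>M\<close>, $\mathrm{Sym}_R(M)$ is the free commutative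
  \<open>R\<close>-algebra on symbols $e_x$, $x \in M$, modulo the relations that make $x \mapsto e_x$
  an \<open>R\<close>-linear map.
\<close>

definition sym_relations ::
  "'r::comm_ring_1 set \<Rightarrow> ('r, 'x) module \<Rightarrow> ('x, 'r) mpoly set" where
  "sym_relations R M =
     {pvar (x \<oplus>\<^bsub>M\<^esub> y) - pvar x - pvar y | x y. x \<in> carrier M \<and> y \<in> carrier M} \<union>
     {pvar (a \<odot>\<^bsub>M\<^esub> x) - pconst a * pvar x | a x. a \<in> R \<and> x \<in> carrier M}"

definition sym_ideal :: "'r::comm_ring_1 set \<Rightarrow> ('r, 'x) module \<Rightarrow> ('x, 'r) mpoly set" where
  "sym_ideal R M = genideal (ring_on (polys (carrier M) R)) (sym_relations R M)"

definition symmetric_algebra ::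
  "'r::comm_ring_1 set \<Rightarrow> ('r, 'x) module \<Rightarrow> ('x, 'r) mpoly set ring" where
  "symmetric_algebra R M = ring_on (polys (carrier M) R) Quot sym_ideal R M"

definition ideal_module :: "'r::comm_ring_1 set \<Rightarrow> ('r, 'r) module" where
  "ideal_module I = \<lparr>carrier = I, mult = (*), one = 1, zero = 0, add = (+), smult = (*)\<rparr>"


section \<open>Rees algebras and ideals of fiber type\<close>

text \<open>
  Throughout, the base field is the type \<^typ>\<open>'k\<close>, the polynomial ring is $R = k[v : v \in V]$, and
  $f_d \in R$ for $d \in D$ are generators of an ideal.  $R[\mathbf{T}]$ has one variable $T_d$
  for each $d \in D$ and its coefficients are elements of $R$.
\<close>

definition base_ring :: "'v set \<Rightarrow> ('v, 'k::field) mpoly set" where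
  "base_ring V = polys V UNIV"

definition gen_ideal :: "'v set \<Rightarrow> 'd set \<Rightarrow> ('d \<Rightarrow> ('v, 'k::field) mpoly) \<Rightarrow> ('v, 'k) mpoly set" where
  "gen_ideal V D f = genideal (ring_on (base_ring V)) (f ` D)"

definition fiber_map :: "('d \<Rightarrow> ('v, 'k::field) mpoly) \<Rightarrow> ('d, 'k) mpoly \<Rightarrow> ('v, 'k) mpoly" where
  "fiber_map f = peval pconst f"

definition rees_map ::
  "('d \<Rightarrow> ('v, 'k::field) mpoly) \<Rightarrow> ('d, ('v, 'k) mpoly) mpoly \<Rightarrow> ('v, 'k) mpoly poly" where
  "rees_map f = peval (\<lambda>r. [:r:]) (\<lambda>d. Polynomial.monom (f d) 1)"

definition sym_map ::
  "'v set \<Rightarrow> 'd set \<Rightarrow> ('d \<Rightarrow> ('v, 'k::field) mpoly) \<Rightarrow>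
   ('d, ('v, 'k) mpoly) mpoly \<Rightarrow> (('v, 'k) mpoly, ('v, 'k) mpoly) mpoly set" where
  "sym_map V D f p =
     (let R = base_ring V; I = ideal_module (gen_ideal V D f) in
      sym_ideal R I +>\<^bsub>ring_on (polys (carrier I) R)\<^esub> peval pconst (\<lambda>d. pvar (f d)) p)"

definition univ_poly_ring :: "'v set \<Rightarrow> ('v, 'k::field) mpoly poly ring" where
  "univ_poly_ring V = ring_on {p. \<forall>n. Polynomial.coeff p n \<in> base_ring V}"

text \<open>The subring $R[It]$ of $R[t]$.\<close>

definition rees_algebra ::
  "'v set \<Rightarrow> 'd set \<Rightarrow> ('d \<Rightarrow> ('v, 'k::field) mpoly) \<Rightarrow> ('v, 'k) mpoly poly ring" where
  "rees_algebra V D f = ring_on (generate_ring (univ_poly_ring V)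
     ({[:r:] | r. r \<in> base_ring V} \<union> {Polynomial.monom g 1 | g. g \<in> gen_ideal V D f}))"

definition rees_constants :: "('v, 'k::field) mpoly poly set" where
  "rees_constants = {[:pconst c:] | c. True}"

text \<open>
  The image in the Rees algebra of the grading of $R[\mathbf{T}]$ in which the variables of $R$ and
  the $T_d$ all have degree one.
\<close>

definition total_degree_part ::
  "'v set \<Rightarrow> 'd set \<Rightarrow> nat \<Rightarrow> ('d, ('v, 'k::field) mpoly) mpoly set" where
  "total_degree_part V D n = {p \<in> polys D (base_ring V).
     \<forall>m \<in> Poly_Mapping.keys p. \<forall>m' \<in> Poly_Mapping.keys (Poly_Mapping.lookup p m).
       mdeg m + mdeg m' = n}"

definition rees_grading ::
  "'v set \<Rightarrow> 'd set \<Rightarrow> ('d \<Rightarrow> ('v, 'k::field) mpoly) \<Rightarrow> nat \<Rightarrow> ('v, 'k) mpoly poly set" where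
  "rees_grading V D f n = rees_map f ` total_degree_part V D n"

definition fiber_type :: "'v set \<Rightarrow> 'd set \<Rightarrow> ('d \<Rightarrow> ('v, 'k::field) mpoly) \<Rightarrow> bool" where
  "fiber_type V D f \<longleftrightarrow>
     (let R = base_ring V; I = gen_ideal V D f; RT = ring_on (polys D R);
          ker_phi = a_kernel (ring_on (polys D UNIV)) (ring_on R) (fiber_map f);
          ker_psi = a_kernel RT (univ_poly_ring V) (rees_map f);
          ker_alpha = a_kernel RT (symmetric_algebra R (ideal_module I)) (sym_map V D f);
          incl = peval (\<lambda>c. pconst (pconst c)) pvar
      in ker_psi = ker_alpha <+>\<^bsub>RT\<^esub> genideal RT (incl ` ker_phi))"


section \<open>Three-dimensional Ferrers diagrams\<close>

definition ferrers_diagram :: "(nat \<times> nat \<times> nat) set \<Rightarrow> bool" where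
  "ferrers_diagram D \<longleftrightarrow> finite D \<and> D \<noteq> {} \<and>
     (\<forall>(i, j, k) \<in> D. 1 \<le> i \<and> 1 \<le> j \<and> 1 \<le> k) \<and>
     (\<forall>(i\<^sub>0, j\<^sub>0, k\<^sub>0) \<in> D. \<forall>i j k. 1 \<le> i \<and> i \<le> i\<^sub>0 \<and> 1 \<le> j \<and> j \<le> j\<^sub>0 \<and> 1 \<le> k \<and> k \<le> k\<^sub>0
        \<longrightarrow> (i, j, k) \<in> D)"

definition projection_property :: "(nat \<times> nat \<times> nat) set \<Rightarrow> bool" where
  "projection_property D \<longleftrightarrow>
     (\<forall>i. 2 \<le> i \<and> i \<le> card (fst ` D) \<longrightarrow>
        (i - 1, Max {j. (i, j, 1) \<in> D}, Max {k. (i, 1, k) \<in> D}) \<in> D)"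

datatype xyz = Xvar nat | Yvar nat | Zvar nat

definition ferrers_vars :: "(nat \<times> nat \<times> nat) set \<Rightarrow> xyz set" where
  "ferrers_vars D =
     Xvar ` {1..Max {i. \<exists>j k. (i, j, k) \<in> D}} \<union>
     Yvar ` {1..Max {j. \<exists>i k. (i, j, k) \<in> D}} \<union>
     Zvar ` {1..Max {k. \<exists>i j. (i, j, k) \<in> D}}"

definition ferrers_gen :: "nat \<times> nat \<times> nat \<Rightarrow> (xyz, 'k::field) mpoly" where
  "ferrers_gen = (\<lambda>(i, j, k). pvar (Xvar i) * pvar (Yvar j) * pvar (Zvar k))"

end

theory Submission
  imports Defs "HOL-Library.Multiset"
begin

text \<open>
  Both assertions come from one combinatorial fact: the presentation ideal of the Rees algebra has
  a quadratic Groebner basis.  A monomial in the generators \<open>x\<^sub>i, y\<^sub>j, z\<^sub>k, T\<^bsub>i,j,k\<^esub>\<close> of the algebra is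
  a multiset of generators.  The exchange steps \<open>ferrers_step\<close> replace two generators by two others
  with the same product and smaller weight; they move large coordinates to \<open>T\<close>s with small first
  index, and large variables out of the \<open>T\<close>s.  The fact is that a monomial to which no step applies is
  determined by its product (\<open>normal_unique\<close>).  Indeed such a monomial is greedy.  A largest free
  variable of each kind is forced, so everything comes down to multisets of points of the diagram
  with given coordinates.  There the projection property enters: a third coordinate that
  prevents an exchange between the first layer used and a later one is too large to occur in any
  later layer used, so it lies in the first layer for every factorization (\<open>first_layer_second_coordinate\<close>).

  For fiber type, note that every step is a relation of the symmetric algebra or of the special
  fiber.  So modulo these relations every polynomial is a combination of normal monomials, and those
  have linearly independent images in the Rees algebra (\<open>J_eq_ker_psi\<close>).

  The Koszul property holds for every algebra with a basis of normal monomials for quadratic steps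
  (\<open>koszul_AA\<close>).  The resolution is built step by step, without homology, in the style of Schreyer's
  theorem on syzygies.  The kernel at each stage has relations with leading terms \<open>g e\<^sub>s\<close>, where \<open>g\<close> is a
  generator, that allow division with unique remainder.  A syzygy between them arises when a
  second generator \<open>g'\<close> gives a monomial \<open>g' g e\<^sub>s\<close> that also reduces in another way.  Since normality is
  a condition on pairs, it is enough to multiply by a single generator, so the syzygies are again
  linear and have leading terms of the same form (\<open>syzygy_relation\<close>, \<open>syzygies_independent\<close>).
\<close>

section \<open>Quadratic rewriting of monomials\<close>

text \<open>
  A step exchanges a pair of generators for a pair of smaller weight.  The weight makes rewriting
  terminate; that steps act on pairs makes normality a condition on pairs, and this is what
  keeps all syzygies below linear.
\<close>

locale quadratic_rewriting =
  fixes G :: "'g set"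
    and step :: "'g multiset \<Rightarrow> 'g multiset \<Rightarrow> bool"
    and weight :: "'g \<Rightarrow> nat"
  assumes finite_G: "finite G"
    and step_size: "step p q \<Longrightarrow> size p = 2 \<and> size q = 2"
    and step_G: "step p q \<Longrightarrow> set_mset p \<subseteq> G \<and> set_mset q \<subseteq> G"
    and step_weight: "step p q \<Longrightarrow> (\<Sum>g\<in>#q. weight g) < (\<Sum>g\<in>#p. weight g)"
begin

definition wt :: "'g multiset \<Rightarrow> nat" where
  "wt m = (\<Sum>g\<in>#m. weight g)"

definition normal :: "'g multiset \<Rightarrow> bool" where
  "normal m \<longleftrightarrow> set_mset m \<subseteq> G \<and> (\<forall>p q. p \<subseteq># m \<longrightarrow> \<not> step p q)"

definition bad :: "'g \<Rightarrow> 'g \<Rightarrow> bool" where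
  "bad g h \<longleftrightarrow> (\<exists>q. step {#g, h#} q)"

definition rewr :: "'g multiset \<Rightarrow> 'g multiset \<Rightarrow> bool" where
  "rewr m n \<longleftrightarrow> (\<exists>p q r. step p q \<and> m = p + r \<and> n = q + r)"

lemma wt_simps [simp]: "wt {#} = 0" "wt (add_mset g m) = weight g + wt m" "wt (m + n) = wt m + wt n"
  by (simp_all add: wt_def)

lemma rewr_props:
  assumes "rewr m n" "set_mset m \<subseteq> G"
  shows "set_mset n \<subseteq> G" "size n = size m" "wt n < wt m"
proof -
  obtain p q r where s: "step p q" and mn: "m = p + r" "n = q + r"
    using assms(1) by (auto simp: rewr_def)
  show "set_mset n \<subseteq> G" using step_G[OF s] assms(2) mn by auto
  show "size n = size m" using step_size[OF s] mn by auto
  show "wt n < wt m" using step_weight[OF s] mn by (simp add: wt_def)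
qed

lemma rewr_star_props:
  assumes "rewr\<^sup>*\<^sup>* m n" "set_mset m \<subseteq> G"
  shows "set_mset n \<subseteq> G \<and> size n = size m \<and> wt n \<le> wt m \<and> (n = m \<or> wt n < wt m)"
  using assms
proof (induction rule: rtranclp_induct)
  case (step y z)
  then show ?case using rewr_props[of y z] by force
qed simp

lemma normal_form_exists:
  assumes "set_mset m \<subseteq> G"
  shows "\<exists>n. normal n \<and> rewr\<^sup>*\<^sup>* m n"
  using assms
proof (induction "wt m" arbitrary: m rule: less_induct)
  case less
  show ?case
  proof (cases "normal m")
    case False
    then obtain p q where p: "p \<subseteq># m" and s: "step p q"
      using less.prems by (auto simp: normal_def)
    have r: "rewr m (q + (m - p))"
      unfolding rewr_def using s p by (intro exI[of _ p] exI[of _ q] exI[of _ "m - p"]) auto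
    obtain n where "normal n" "rewr\<^sup>*\<^sup>* (q + (m - p)) n"
      using less.hyps rewr_props[OF r less.prems] by blast
    then show ?thesis using r by (meson converse_rtranclp_into_rtranclp)
  qed blast
qed

lemma normal_subset: "normal m \<Longrightarrow> n \<subseteq># m \<Longrightarrow> normal n"
  unfolding normal_def by (meson set_mset_mono subset_mset.trans subset_trans)

lemma normal_empty [simp]: "normal {#}"
  using step_size by (fastforce simp: normal_def)

lemma normal_single [simp]: "normal {#g#} \<longleftrightarrow> g \<in> G"
proof -
  have "\<not> step p q" if "p \<subseteq># {#g#}" for p q
    using size_mset_mono[OF that] step_size[of p q] by auto
  then show ?thesis by (auto simp: normal_def)
qed

lemma normal_iff_pairs:
  "normal m \<longleftrightarrow> set_mset m \<subseteq> G \<and> (\<forall>g h. {#g, h#} \<subseteq># m \<longrightarrow> \<not> bad g h)"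
proof -
  have pair: "\<exists>g h. p = {#g, h#}" if "step p q" for p q
  proof -
    have "size p = Suc 1" using step_size[OF that] by simp
    then obtain g p' where p: "p = add_mset g p'" by (blast dest: size_eq_Suc_imp_eq_union)
    then have "size p' = 1" using \<open>size p = Suc 1\<close> by simp
    then show ?thesis using p size_1_singleton_mset by blast
  qed
  show ?thesis
  proof
    assume "normal m"
    then show "set_mset m \<subseteq> G \<and> (\<forall>g h. {#g, h#} \<subseteq># m \<longrightarrow> \<not> bad g h)"
      by (auto simp: normal_def bad_def)
  next
    assume r: "set_mset m \<subseteq> G \<and> (\<forall>g h. {#g, h#} \<subseteq># m \<longrightarrow> \<not> bad g h)"
    have "\<not> step p q" if "p \<subseteq># m" for p q
    proof
      assume s: "step p q"
      obtain g h where "p = {#g, h#}" using pair[OF s] by blast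
      then show False using r s that by (auto simp: bad_def)
    qed
    then show "normal m" using r by (simp add: normal_def)
  qed
qed

lemma bad_commute: "bad g h \<longleftrightarrow> bad h g"
  by (simp add: bad_def add_mset_commute)

lemma normal_add_iff:
  "normal (add_mset g m) \<longleftrightarrow> normal m \<and> g \<in> G \<and> (\<forall>h\<in>#m. \<not> bad h g)"
proof
  assume n: "normal (add_mset g m)"
  have "{#h, g#} \<subseteq># add_mset g m" if "h \<in># m" for h
    using that by (simp add: add_mset_commute[of h g])
  then show "normal m \<and> g \<in> G \<and> (\<forall>h\<in>#m. \<not> bad h g)"
    using n normal_subset[OF n, of m] by (auto simp: normal_iff_pairs)
next
  assume r: "normal m \<and> g \<in> G \<and> (\<forall>h\<in>#m. \<not> bad h g)"
  have "\<not> bad a b" if ab: "{#a, b#} \<subseteq># add_mset g m" for a b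
  proof (cases "{#a, b#} \<subseteq># m")
    case True
    then show ?thesis using r by (auto simp: normal_iff_pairs)
  next
    case False
    have "a = g \<or> b = g"
      proof (rule ccontr)
      assume "\<not> (a = g \<or> b = g)"
      then have "count {#a, b#} x \<le> count m x" for x
        using mset_subset_eq_count[OF ab, of x] by (cases "x = g") auto
      then have "{#a, b#} \<subseteq># m" by (rule mset_subset_eqI)
      then show False using False by simp
    qed
    then show ?thesis
    proof
      assume "a = g"
      then have "b \<in># m" using ab by simp
      then show ?thesis using r \<open>a = g\<close> bad_commute by blast
    next
      assume "b = g"
      then have "a \<in># m" using ab by (simp add: add_mset_commute[of a g])
      then show ?thesis using r \<open>b = g\<close> bad_commute by blast
    qed
  qed
  then show "normal (add_mset g m)" using r by (auto simp: normal_iff_pairs)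
qed

end

section \<open>Algebras with a basis of normal monomials\<close>

text \<open>
  Steps preserve the product in the algebra, and \<open>cf\<close> reads off coefficients along the normal
  monomials.  Together this says that the normal monomials are a basis of the algebra that the
  generators span: rewriting shows that they span, \<open>cf\<close> that they are independent.
\<close>

locale quadratic_toric_algebra = quadratic_rewriting G step weight
  for G :: "'g set" and step weight +
  fixes val :: "'g \<Rightarrow> 'a::comm_ring_1"
    and cst :: "'k::field \<Rightarrow> 'a"
    and cf :: "'a \<Rightarrow> 'g multiset \<Rightarrow> 'k"
  assumes cst_add: "cst (c + d) = cst c + cst d"
    and cst_mult: "cst (c * d) = cst c * cst d"
    and cst_one [simp]: "cst 1 = 1"
    and step_val: "step p q \<Longrightarrow> prod_mset (image_mset val p) = prod_mset (image_mset val q)"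
    and cf_add: "cf (a + b) m = cf a m + cf b m"
    and cf_scale: "cf (cst c * a) m = c * cf a m"
    and cf_val: "normal m \<Longrightarrow> normal n \<Longrightarrow>
      cf (prod_mset (image_mset val m)) n = (if m = n then 1 else 0)"
begin

definition ev :: "'g multiset \<Rightarrow> 'a" where
  "ev m = prod_mset (image_mset val m)"

lemma ev_simps [simp]: "ev {#} = 1" "ev (add_mset g m) = val g * ev m" "ev (m + n) = ev m * ev n"
  by (simp_all add: ev_def)

lemma cf_ev: "normal m \<Longrightarrow> normal n \<Longrightarrow> cf (ev m) n = (if m = n then 1 else 0)"
  by (simp add: ev_def cf_val)

lemma ev_rewr: "rewr\<^sup>*\<^sup>* m n \<Longrightarrow> ev n = ev m"
proof (induction rule: rtranclp_induct)
  case (step y z)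
  then show ?case using step_val by (auto simp: rewr_def ev_def)
qed simp

sublocale vs: vector_space "\<lambda>c x. cst c * x"
  by unfold_locales (simp_all add: algebra_simps cst_add cst_mult)

text \<open>
  The predicate carries whatever is known of the monomials that occur: their degree, a bound on
  their weight, or variables that they avoid.  A statement about leading terms is then membership
  in such a span.
\<close>

definition NS :: "('g multiset \<Rightarrow> bool) \<Rightarrow> 'a set" where
  "NS P = vs.span (ev ` {m. normal m \<and> P m})"

lemma NS_ev: "normal m \<Longrightarrow> P m \<Longrightarrow> ev m \<in> NS P"
  by (auto simp: NS_def intro: vs.span_base)

lemma NS_0 [simp]: "0 \<in> NS P"
  by (simp add: NS_def vs.span_zero)

lemma NS_add: "a \<in> NS P \<Longrightarrow> b \<in> NS P \<Longrightarrow> a + b \<in> NS P"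
  by (simp add: NS_def vs.span_add)

lemma NS_uminus: "a \<in> NS P \<Longrightarrow> - a \<in> NS P"
  by (simp add: NS_def vs.span_neg)

lemma NS_diff: "a \<in> NS P \<Longrightarrow> b \<in> NS P \<Longrightarrow> a - b \<in> NS P"
  by (simp add: NS_def vs.span_diff)

lemma NS_scale: "a \<in> NS P \<Longrightarrow> cst c * a \<in> NS P"
  by (simp add: NS_def vs.span_scale)

lemma NS_sum: "(\<And>i. i \<in> I \<Longrightarrow> f i \<in> NS P) \<Longrightarrow> sum f I \<in> NS P"
  by (simp add: NS_def vs.span_sum)

lemma NS_mono: "a \<in> NS P \<Longrightarrow> (\<And>m. normal m \<Longrightarrow> P m \<Longrightarrow> Q m) \<Longrightarrow> a \<in> NS Q"
  unfolding NS_def using vs.span_mono[of "ev ` {m. normal m \<and> P m}" "ev ` {m. normal m \<and> Q m}"]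
  by blast

lemma NS_induct [consumes 1, case_names zero add]:
  assumes "a \<in> NS P" "R 0"
    "\<And>c m b. normal m \<Longrightarrow> P m \<Longrightarrow> R b \<Longrightarrow> b \<in> NS P \<Longrightarrow> R (cst c * ev m + b)"
  shows "R a"
proof -
  have "a \<in> vs.span (ev ` {m. normal m \<and> P m})" using assms(1) by (simp add: NS_def)
  then have "R a \<and> a \<in> NS P"
  proof (induction rule: vs.span_induct_alt)
    case base
    then show ?case using assms(2) by simp
  next
    case (step c x y)
    then show ?case using assms(3) by (auto intro!: NS_add NS_scale NS_ev)
  qed
  then show ?thesis ..
qed

text \<open>
  A monomial that is not normal drops in weight when it is rewritten; this strictness is what
  makes multiplication by a generator lower leading terms.
\<close>

lemma NS_ev_any:
  assumes "set_mset m \<subseteq> G"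
    and "\<And>n. normal n \<Longrightarrow> size n = size m \<Longrightarrow> wt n \<le> wt m \<Longrightarrow> n = m \<or> wt n < wt m \<Longrightarrow> P n"
  shows "ev m \<in> NS P"
proof -
  obtain n where n: "normal n" "rewr\<^sup>*\<^sup>* m n" using normal_form_exists[OF assms(1)] by blast
  then show ?thesis
    using rewr_star_props[OF n(2) assms(1)] assms(2)[of n] ev_rewr[OF n(2)] NS_ev[of n P] by simp
qed

lemma NS_mult:
  assumes "a \<in> NS P" "b \<in> NS Q"
    and "\<And>m n k. normal m \<Longrightarrow> normal n \<Longrightarrow> P m \<Longrightarrow> Q n \<Longrightarrow> normal k \<Longrightarrow> size k = size m + size n
      \<Longrightarrow> wt k \<le> wt m + wt n \<Longrightarrow> R k"
  shows "a * b \<in> NS R"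
  using assms(1)
proof (induction rule: NS_induct)
  case (add c m x)
  have "ev m * b \<in> NS R" using assms(2)
  proof (induction rule: NS_induct)
    case (add d n y)
    have "ev (m + n) \<in> NS R"
      by (rule NS_ev_any) (use add assms(3) \<open>normal m\<close> \<open>P m\<close> in \<open>auto simp: normal_def\<close>)
    then have "cst d * ev (m + n) + ev m * y \<in> NS R" using add by (intro NS_add NS_scale)
    then show ?case by (simp add: algebra_simps)
  qed simp
  then have "cst c * (ev m * b) + x * b \<in> NS R" using add by (intro NS_add NS_scale)
  then show ?case by (simp add: algebra_simps)
qed simp

lemma cf_0 [simp]: "cf 0 m = 0"
  using cf_scale[of 0 0 m] by simp

lemma cf_minus: "cf (a - b) m = cf a m - cf b m"
  using cf_add[of "a - b" b m] by simp

lemma cf_sum: "cf (sum f I) m = (\<Sum>i\<in>I. cf (f i) m)"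
  by (induction I rule: infinite_finite_induct) (auto simp: cf_add)

lemma cf_NS_0:
  assumes "a \<in> NS P" "normal n" "\<not> P n"
  shows "cf a n = 0"
  using assms(1)
proof (induction rule: NS_induct)
  case (add c m b)
  then show ?case using assms by (auto simp: cf_add cf_scale cf_ev)
qed simp

lemma NS_expand:
  assumes "a \<in> NS P"
  shows "\<exists>F. finite F \<and> (\<forall>m\<in>F. normal m \<and> P m) \<and> a = (\<Sum>m\<in>F. cst (cf a m) * ev m)
     \<and> (\<forall>m. normal m \<longrightarrow> cf a m \<noteq> 0 \<longrightarrow> m \<in> F)"
proof -
  have "\<exists>F f. finite F \<and> (\<forall>m\<in>F. normal m \<and> P m) \<and> a = (\<Sum>m\<in>F. cst (f m) * ev m)"
    using assms
  proof (induction rule: NS_induct)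
    case zero
    then show ?case by (intro exI[of _ "{}"]) simp
  next
    case (add c m b)
    then obtain F f where F: "finite F" "\<forall>m\<in>F. normal m \<and> P m" "b = (\<Sum>m\<in>F. cst (f m) * ev m)" by blast
    define f' where "f' n = (if n \<in> F then f n else 0)" for n
    have cst0: "cst 0 = 0" using cst_add[of 0 0] by simp
    have "b = (\<Sum>n\<in>insert m F. cst (f' n) * ev n)"
      unfolding F(3) by (rule sum.mono_neutral_cong_left) (use F(1) in \<open>auto simp: f'_def cst0\<close>)
    moreover have "cst c * ev m = (\<Sum>n\<in>insert m F. cst (if n = m then c else 0) * ev n)"
      using F(1) by (subst sum.remove[of _ m]) (auto simp: cst0 intro!: sum.neutral[symmetric])
    ultimately have "cst c * ev m + b = (\<Sum>n\<in>insert m F. cst ((if n = m then c else 0) + f' n) * ev n)"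
      by (simp add: cst_add algebra_simps sum.distrib)
    then show ?case using F add
      by (intro exI[of _ "insert m F"] exI[of _ "\<lambda>n. (if n = m then c else 0) + f' n"]) auto
  qed
  then obtain F f where F: "finite F" "\<forall>m\<in>F. normal m \<and> P m" "a = (\<Sum>m\<in>F. cst (f m) * ev m)" by blast
  have cf: "cf a n = (if n \<in> F then f n else 0)" if "normal n" for n
  proof -
    have "cf a n = (\<Sum>m\<in>F. if m = n then f m else 0)"
      unfolding F(3) cf_sum by (rule sum.cong) (use F that in \<open>auto simp: cf_scale cf_ev\<close>)
    then show ?thesis using F(1) by simp
  qed
  have "a = (\<Sum>m\<in>F. cst (cf a m) * ev m)"
    by (subst F(3), rule sum.cong) (use F(2) cf in auto)
  then show ?thesis using F cf by (intro exI[of _ F]) (auto split: if_splits)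
qed

lemma NS_eq_0: "a \<in> NS P \<Longrightarrow> (\<And>m. normal m \<Longrightarrow> cf a m = 0) \<Longrightarrow> a = 0"
  using NS_expand[of a P] cst_add[of 0 0] by (auto intro!: sum.neutral)

lemma NS_finite_support: "a \<in> NS P \<Longrightarrow> finite {m. normal m \<and> cf a m \<noteq> 0}"
  using NS_expand[of a P] by (auto intro: finite_subset)

abbreviation AA :: "'a set" where "AA \<equiv> NS (\<lambda>_. True)"

lemma NS_AA: "a \<in> NS P \<Longrightarrow> a \<in> AA"
  by (rule NS_mono) simp_all

lemma AA_mult: "a \<in> AA \<Longrightarrow> b \<in> AA \<Longrightarrow> a * b \<in> AA"
  by (rule NS_mult) simp_all

definition avoids :: "'g set \<Rightarrow> 'g multiset \<Rightarrow> bool" where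
  "avoids V m \<longleftrightarrow> set_mset m \<inter> V = {}"

text \<open>
  The invariant of the construction of the resolution.  Here \<open>Z\<close> is the kernel, inside the free
  module with basis \<open>e\<^sub>0, \<dots>, e\<^bsub>r-1\<^esub>\<close>, of the last map constructed so far; it is a predicate that
  looks only at the first \<open>r\<close> entries.  Monomials \<open>m e\<^sub>s\<close> are ordered by the number
  \<open>\<beta> * wt m + om s\<close>.  The generators in \<open>V s\<close> are those \<open>g\<close> for which \<open>g e\<^sub>s\<close> leads an element
  of \<open>Z\<close>; by the last condition such an element exists with a linear tail \<open>c\<close>.  The condition
  before it says that monomials avoiding these generators are independent modulo \<open>Z\<close>, so the
  relations \<open>g e\<^sub>s - c\<close> behave like a Groebner basis of \<open>Z\<close>.
\<close>

definition kernel_state ::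
  "nat \<Rightarrow> (nat \<Rightarrow> 'g set) \<Rightarrow> (nat \<Rightarrow> nat) \<Rightarrow> nat \<Rightarrow> ((nat \<Rightarrow> 'a) \<Rightarrow> bool) \<Rightarrow> bool" where
  "kernel_state r V om \<beta> Z \<longleftrightarrow> 0 < \<beta> \<and> (\<forall>s<r. V s \<subseteq> G) \<and>
     Z (\<lambda>_. 0) \<and>
     (\<forall>f f'. (\<forall>s<r. f s = f' s) \<longrightarrow> Z f \<longrightarrow> Z f') \<and>
     (\<forall>f f'. Z f \<longrightarrow> Z f' \<longrightarrow> Z (\<lambda>s. f s + f' s)) \<and>
     (\<forall>a f. a \<in> AA \<longrightarrow> Z f \<longrightarrow> Z (\<lambda>s. a * f s)) \<and>
     (\<forall>f. (\<forall>s<r. f s \<in> NS (avoids (V s))) \<longrightarrow> Z f \<longrightarrow> (\<forall>s<r. f s = 0)) \<and>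
     (\<forall>s<r. \<forall>g\<in>V s. \<exists>c. (\<forall>t<r. c t \<in> NS (\<lambda>m. size m = 1 \<and> \<beta> * wt m + om t < \<beta> * weight g + om s)) \<and>
        Z (\<lambda>t. (if t = s then val g else 0) - c t))"

end

section \<open>Syzygies\<close>

text \<open>
  One step of the resolution, after Schreyer: the relations \<open>g e\<^sub>s - c\<close> generate \<open>Z\<close>, and dividing
  their multiples by the relations themselves yields a generating set of the same shape for the
  syzygies between them.
\<close>

locale syzygy_step = quadratic_toric_algebra G step weight val cst cf
  for G :: "'g set" and step weight and val :: "'g \<Rightarrow> 'a::comm_ring_1"
    and cst :: "'k::field \<Rightarrow> 'a" and cf +
  fixes r :: nat and V :: "nat \<Rightarrow> 'g set" and om :: "nat \<Rightarrow> nat" and \<beta> :: nat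
    and Z :: "(nat \<Rightarrow> 'a) \<Rightarrow> bool" and c :: "nat \<Rightarrow> 'g \<Rightarrow> nat \<Rightarrow> 'a"
    and pos :: "'g \<Rightarrow> nat" and N :: nat
  assumes state: "kernel_state r V om \<beta> Z"
    and c_NS: "s < r \<Longrightarrow> g \<in> V s \<Longrightarrow> t < r \<Longrightarrow>
      c s g t \<in> NS (\<lambda>m. size m = 1 \<and> \<beta> * wt m + om t < \<beta> * weight g + om s)"
    and c_Z: "s < r \<Longrightarrow> g \<in> V s \<Longrightarrow> Z (\<lambda>t. (if t = s then val g else 0) - c s g t)"
    and pos_inj: "inj_on pos G"
    and pos_less: "g \<in> G \<Longrightarrow> pos g < N"
begin

definition Pr :: "(nat \<times> 'g) set" where "Pr = Sigma {..<r} V"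

definition \<sigma> :: "nat \<times> 'g \<Rightarrow> nat \<Rightarrow> 'a" where
  "\<sigma> x t = (if t = fst x then val (snd x) else 0) - c (fst x) (snd x) t"

text \<open>
  The syzygies are indexed by a relation \<open>(s, g)\<close> and a generator \<open>g'\<close> such that the monomial
  \<open>g' g e\<^sub>s\<close> is reached in a second way: \<open>g'\<close> comes before \<open>g\<close> in \<open>V s\<close> and so belongs to a
  relation of its own, or the product of \<open>g'\<close> and \<open>g\<close> is not normal.
\<close>

definition V' :: "nat \<times> 'g \<Rightarrow> 'g set" where
  "V' x = {g \<in> V (fst x). pos g < pos (snd x)} \<union> {g \<in> G. bad g (snd x)}"

text \<open>
  The order of \<open>\<mu> g e\<^sub>s\<close>, the leading monomial of \<open>\<mu>\<close> times the relation \<open>(s, g)\<close>.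
\<close>

definition key :: "nat \<times> 'g \<Rightarrow> 'g multiset \<Rightarrow> nat" where
  "key x \<mu> = \<beta> * wt \<mu> + \<beta> * weight (snd x) + om (fst x)"

definition unit :: "nat \<Rightarrow> 'a \<Rightarrow> nat \<Rightarrow> 'a" where
  "unit s a t = (if t = s then a else 0)"

text \<open>
  Division with remainder \<open>\<rho>\<close> by the relations.  The quotients avoid \<open>V'\<close>, which makes the
  division unique, and \<open>Q\<close> bounds them.
\<close>

definition division :: "(nat \<times> 'g \<Rightarrow> 'g multiset \<Rightarrow> bool) \<Rightarrow> (nat \<Rightarrow> 'a) \<Rightarrow> (nat \<times> 'g \<Rightarrow> 'a) \<Rightarrow> (nat \<Rightarrow> 'a) \<Rightarrow> bool"
  where "division Q u a \<rho> \<longleftrightarrow> (\<forall>t<r. \<rho> t \<in> NS (avoids (V t))) \<and>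
     (\<forall>x\<in>Pr. a x \<in> NS (\<lambda>\<mu>. avoids (V' x) \<mu> \<and> Q x \<mu>)) \<and>
     (\<forall>t<r. u t = \<rho> t + (\<Sum>x\<in>Pr. a x * \<sigma> x t))"

definition has_division :: "(nat \<times> 'g \<Rightarrow> 'g multiset \<Rightarrow> bool) \<Rightarrow> (nat \<Rightarrow> 'a) \<Rightarrow> bool" where
  "has_division Q u \<longleftrightarrow> (\<exists>a \<rho>. division Q u a \<rho>)"

lemmas state_conj = state[unfolded kernel_state_def]
lemmas beta_pos = state_conj[THEN conjunct1]
lemmas Z_0 = state_conj[THEN conjunct2, THEN conjunct2, THEN conjunct1]
lemmas VG = state_conj[THEN conjunct2, THEN conjunct1, rule_format]
lemmas Z_cong = state_conj[THEN conjunct2, THEN conjunct2, THEN conjunct2, THEN conjunct1, rule_format]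
lemmas Z_add = state_conj[THEN conjunct2, THEN conjunct2, THEN conjunct2, THEN conjunct2, THEN conjunct1,
    rule_format]
lemmas Z_mult = state_conj[THEN conjunct2, THEN conjunct2, THEN conjunct2, THEN conjunct2, THEN conjunct2,
    THEN conjunct1, rule_format]
lemmas Z_avoids = state_conj[THEN conjunct2, THEN conjunct2, THEN conjunct2, THEN conjunct2, THEN conjunct2,
    THEN conjunct2, THEN conjunct1, rule_format]

lemma finite_Pr: "finite Pr"
  unfolding Pr_def using VG finite_G by (auto intro: finite_subset)

lemma Pr_iff: "(s, g) \<in> Pr \<longleftrightarrow> s < r \<and> g \<in> V s"
  by (auto simp: Pr_def)

lemma Pr_G: "x \<in> Pr \<Longrightarrow> snd x \<in> G"
  using VG by (fastforce simp: Pr_def)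

lemma AA_val: "g \<in> G \<Longrightarrow> val g \<in> AA"
  using NS_ev[of "{#g#}"] by simp

lemma Z_\<sigma>: "x \<in> Pr \<Longrightarrow> Z (\<sigma> x)"
  using c_Z[of "fst x" "snd x"] by (auto simp: Pr_def \<sigma>_def[abs_def])

lemma Z_combination:
  assumes "\<And>x. x \<in> F \<Longrightarrow> a x \<in> AA" "F \<subseteq> Pr"
  shows "Z (\<lambda>t. \<Sum>x\<in>F. a x * \<sigma> x t)"
  using finite_subset[OF assms(2) finite_Pr] assms
proof (induction F rule: finite_induct)
  case (insert x F)
  have "Z (\<lambda>t. a x * \<sigma> x t + (\<Sum>x\<in>F. a x * \<sigma> x t))"
    using insert Z_add[OF Z_mult[OF _ Z_\<sigma>], of "a x" x] by simp
  then show ?case using insert by simp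
qed (simp add: Z_0)

lemma division_cong: "has_division Q u \<Longrightarrow> (\<And>t. t < r \<Longrightarrow> u t = v t) \<Longrightarrow> has_division Q v"
  unfolding has_division_def division_def by (elim exE conjE, rule exI, rule exI) auto

lemma division_mono:
  assumes "has_division Q u" "\<And>x \<mu>. x \<in> Pr \<Longrightarrow> Q x \<mu> \<Longrightarrow> Q' x \<mu>"
  shows "has_division Q' u"
proof -
  obtain a \<rho> where "division Q u a \<rho>" using assms(1) by (auto simp: has_division_def)
  note d = this[unfolded division_def, THEN conjunct1] this[unfolded division_def, THEN conjunct2, THEN conjunct1]
    this[unfolded division_def, THEN conjunct2, THEN conjunct2]
  have "a x \<in> NS (\<lambda>\<mu>. avoids (V' x) \<mu> \<and> Q' x \<mu>)" if "x \<in> Pr" for x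
    using d(2)[rule_format, OF that] by (rule NS_mono) (use assms(2) that in blast)
  then show ?thesis using d unfolding has_division_def division_def by blast
qed

lemma division_0: "has_division Q (\<lambda>_. 0)"
  unfolding has_division_def division_def by (intro exI[of _ "\<lambda>_. 0"]) simp

lemma division_add:
  assumes "has_division Q u" "has_division Q v"
  shows "has_division Q (\<lambda>t. u t + v t)"
proof -
  obtain a \<rho> where "division Q u a \<rho>" using assms(1) by (auto simp: has_division_def)
  note d = this[unfolded division_def, THEN conjunct1] this[unfolded division_def, THEN conjunct2, THEN conjunct1]
    this[unfolded division_def, THEN conjunct2, THEN conjunct2]
  obtain a' \<rho>' where d': "division Q v a' \<rho>'" using assms(2) by (auto simp: has_division_def)
  show ?thesis unfolding has_division_def
    by (intro exI[of _ "\<lambda>x. a x + a' x"] exI[of _ "\<lambda>t. \<rho> t + \<rho>' t"])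
      (use d d' NS_add in \<open>simp add: division_def distrib_right sum.distrib\<close>)
qed

lemma division_scale:
  assumes "has_division Q u"
  shows "has_division Q (\<lambda>t. cst k * u t)"
proof -
  obtain a \<rho> where "division Q u a \<rho>" using assms(1) by (auto simp: has_division_def)
  note d = this[unfolded division_def, THEN conjunct1] this[unfolded division_def, THEN conjunct2, THEN conjunct1]
    this[unfolded division_def, THEN conjunct2, THEN conjunct2]
  show ?thesis unfolding has_division_def
    by (intro exI[of _ "\<lambda>x. cst k * a x"] exI[of _ "\<lambda>t. cst k * \<rho> t"])
      (use d NS_scale in \<open>simp add: division_def distrib_left sum_distrib_left mult.assoc\<close>)
qed

lemma division_sum: "finite I \<Longrightarrow> (\<And>i. i \<in> I \<Longrightarrow> has_division Q (u i)) \<Longrightarrow> has_division Q (\<lambda>t. \<Sum>i\<in>I. u i t)"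
  by (induction I rule: finite_induct) (auto intro: division_add division_0)

lemma division_coordinates:
  assumes "\<And>t. t < r \<Longrightarrow> has_division Q (unit t (u t))"
  shows "has_division Q u"
proof -
  have "has_division Q (\<lambda>t. \<Sum>i<r. unit i (u i) t)" by (rule division_sum) (use assms in auto)
  then show ?thesis by (rule division_cong) (auto simp: unit_def)
qed

lemma division_NS:
  assumes "b \<in> NS P" "\<And>m. normal m \<Longrightarrow> P m \<Longrightarrow> has_division Q (unit s (y * ev m))"
  shows "has_division Q (unit s (y * b))"
  using assms(1)
proof (induction rule: NS_induct)
  case zero
  have "unit s 0 = (\<lambda>_. 0)" by (auto simp: unit_def)
  then show ?case using division_0 by simp
next
  case (add k m b)
  have "has_division Q (\<lambda>t. cst k * unit s (y * ev m) t + unit s (y * b) t)"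
    using add assms(2) by (intro division_add division_scale)
  then show ?case by (rule division_cong) (auto simp: unit_def algebra_simps)
qed

text \<open>
  Multiplication by \<open>\<mu>\<close> keeps the tail of a relation below its leading monomial because rewriting
  never raises the weight.
\<close>

lemma division_tail:
  assumes x: "x \<in> Pr" and \<mu>: "normal \<mu>"
    and IH: "\<And>n t. normal n \<Longrightarrow> t < r \<Longrightarrow> \<beta> * wt n + om t < key x \<mu> \<Longrightarrow>
      has_division (\<lambda>y \<nu>. size \<nu> + 1 = size n \<and> key y \<nu> \<le> \<beta> * wt n + om t) (unit t (ev n))"
  shows "has_division (\<lambda>y \<nu>. size \<nu> = size \<mu> \<and> key y \<nu> < key x \<mu>) (\<lambda>t. ev \<mu> * c (fst x) (snd x) t)"
proof (rule division_coordinates)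
  fix t assume t: "t < r"
  show "has_division (\<lambda>y \<nu>. size \<nu> = size \<mu> \<and> key y \<nu> < key x \<mu>) (unit t (ev \<mu> * c (fst x) (snd x) t))"
  proof (rule division_NS)
    show "c (fst x) (snd x) t \<in> NS (\<lambda>m. size m = 1 \<and> \<beta> * wt m + om t < \<beta> * weight (snd x) + om (fst x))"
      using x t by (intro c_NS) (auto simp: Pr_def)
  next
    fix m assume m: "normal m" "size m = 1 \<and> \<beta> * wt m + om t < \<beta> * weight (snd x) + om (fst x)"
    have G: "set_mset (\<mu> + m) \<subseteq> G" using \<mu> m by (auto simp: normal_def)
    obtain n where n: "normal n" "rewr\<^sup>*\<^sup>* (\<mu> + m) n" using normal_form_exists[OF G] by blast
    have p: "size n = size \<mu> + 1" "wt n \<le> wt \<mu> + wt m" "ev n = ev \<mu> * ev m"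
      using rewr_star_props[OF n(2) G] m ev_rewr[OF n(2)] by auto
    have "\<beta> * wt n \<le> \<beta> * wt \<mu> + \<beta> * wt m" using p(2) by (metis add_mult_distrib2 mult_le_mono2)
    then have lt: "\<beta> * wt n + om t < key x \<mu>" using m by (simp add: key_def)
    show "has_division (\<lambda>y \<nu>. size \<nu> = size \<mu> \<and> key y \<nu> < key x \<mu>) (unit t (ev \<mu> * ev m))"
      using division_mono[OF IH[OF n(1) t lt]] p lt by fastforce
  qed
qed

lemma division_lead:
  assumes "x \<in> Pr" "normal \<mu>" "avoids (V' x) \<mu>" "Q x \<mu>"
  shows "has_division Q (\<lambda>t. ev \<mu> * \<sigma> x t)"
  unfolding has_division_def division_def
proof (intro exI conjI)
  show "\<forall>t<r. (\<lambda>_. 0) t \<in> NS (avoids (V t))" by simp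
  show "\<forall>y\<in>Pr. (\<lambda>y. if y = x then ev \<mu> else 0) y \<in> NS (\<lambda>\<mu>. avoids (V' y) \<mu> \<and> Q y \<mu>)"
    using assms by (auto intro: NS_ev)
  have "(\<Sum>y\<in>Pr. (if y = x then ev \<mu> else 0) * \<sigma> y t) = (\<Sum>y\<in>Pr. if y = x then ev \<mu> * \<sigma> x t else 0)" for t
    by (rule sum.cong) auto
  then show "\<forall>t<r. ev \<mu> * \<sigma> x t = (\<lambda>_. 0) t + (\<Sum>y\<in>Pr. (\<lambda>y. if y = x then ev \<mu> else 0) y * \<sigma> y t)"
    using assms(1) finite_Pr by simp
qed

text \<open>
  The division algorithm.  A monomial \<open>m e\<^sub>s\<close> that does not avoid \<open>V s\<close> is the leading monomial of
  exactly one admissible multiple of a relation: that of the first element \<open>g\<close> of \<open>V s\<close> in \<open>m\<close>.  The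
  cofactor \<open>m - {#g#}\<close> has no earlier element of \<open>V s\<close>, and nothing bad with \<open>g\<close> since \<open>m\<close> is normal.
\<close>

lemma division_monomial:
  assumes "normal m" "s < r"
  shows "has_division (\<lambda>x \<nu>. size \<nu> + 1 = size m \<and> key x \<nu> \<le> \<beta> * wt m + om s) (unit s (ev m))"
  using assms
proof (induction "\<beta> * wt m + om s" arbitrary: m s rule: less_induct)
  case less
  show ?case
  proof (cases "avoids (V s) m")
    case True
    then show ?thesis unfolding has_division_def division_def
      by (intro exI[of _ "\<lambda>_. 0"] exI[of _ "unit s (ev m)"]) (use less.prems in \<open>auto simp: unit_def intro: NS_ev\<close>)
  next
    case False
    then obtain g0 where g0: "g0 \<in> set_mset m \<inter> V s" by (auto simp: avoids_def)
    obtain g where g: "g \<in># m" "g \<in> V s" and gmin: "\<And>g'. g' \<in># m \<Longrightarrow> g' \<in> V s \<Longrightarrow> pos g \<le> pos g'"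
      using ex_has_least_nat[of "\<lambda>g. g \<in> set_mset m \<inter> V s" g0 pos] g0 by auto
    define \<mu> where "\<mu> = m - {#g#}"
    have m: "m = add_mset g \<mu>" using g(1) by (simp add: \<mu>_def)
    have \<mu>: "normal \<mu>" "\<forall>h\<in>#\<mu>. \<not> bad h g" using less.prems(1) by (auto simp: m normal_add_iff)
    have x: "(s, g) \<in> Pr" using g less.prems by (simp add: Pr_iff)
    have k: "key (s, g) \<mu> = \<beta> * wt m + om s" by (simp add: key_def m algebra_simps)
    have "has_division (\<lambda>x \<nu>. size \<nu> + 1 = size m \<and> key x \<nu> \<le> \<beta> * wt m + om s) (\<lambda>t. ev \<mu> * \<sigma> (s, g) t)"
      by (rule division_lead[OF x \<mu>(1)]) (use \<mu>(2) gmin in \<open>fastforce simp: avoids_def V'_def m\<close>, use k m in simp)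
    moreover have "has_division (\<lambda>x \<nu>. size \<nu> + 1 = size m \<and> key x \<nu> \<le> \<beta> * wt m + om s) (\<lambda>t. ev \<mu> * c s g t)"
    proof -
      have "has_division (\<lambda>y \<nu>. size \<nu> = size \<mu> \<and> key y \<nu> < key (s, g) \<mu>) (\<lambda>t. ev \<mu> * c s g t)"
        using division_tail[OF x \<mu>(1)] less.hyps k by simp
      then show ?thesis by (rule division_mono) (use k m in auto)
    qed
    ultimately have "has_division (\<lambda>x \<nu>. size \<nu> + 1 = size m \<and> key x \<nu> \<le> \<beta> * wt m + om s)
        (\<lambda>t. ev \<mu> * \<sigma> (s, g) t + ev \<mu> * c s g t)" by (rule division_add)
    then show ?thesis by (rule division_cong) (auto simp: \<sigma>_def unit_def m algebra_simps)
  qed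
qed

text \<open>
  The remainder of an element of \<open>Z\<close> lies in \<open>Z\<close> and avoids all leading generators, so it is zero.
\<close>

lemma division_kernel:
  assumes "has_division Q u" "Z u"
  shows "\<exists>a. (\<forall>x\<in>Pr. a x \<in> NS (\<lambda>\<mu>. avoids (V' x) \<mu> \<and> Q x \<mu>)) \<and> (\<forall>t<r. u t = (\<Sum>x\<in>Pr. a x * \<sigma> x t))"
proof -
  obtain a \<rho> where "division Q u a \<rho>" using assms(1) by (auto simp: has_division_def)
  note d = this[unfolded division_def, THEN conjunct1] this[unfolded division_def, THEN conjunct2, THEN conjunct1]
    this[unfolded division_def, THEN conjunct2, THEN conjunct2]
  have "- 1 \<in> AA" using NS_uminus[OF NS_ev[of "{#}"]] by simp
  moreover have "Z (\<lambda>t. \<Sum>x\<in>Pr. a x * \<sigma> x t)"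
    by (rule Z_combination) (use d(2) NS_AA in blast)+
  ultimately have "Z (\<lambda>t. u t + (-1) * (\<Sum>x\<in>Pr. a x * \<sigma> x t))"
    by (intro Z_add Z_mult assms(2))
  then have "Z \<rho>" by (rule Z_cong[rotated]) (use d(3) in simp)
  then have "\<rho> t = 0" if "t < r" for t using Z_avoids[of \<rho> t] d(1) that by blast
  then show ?thesis using d by auto
qed

lemma kernel_generated:
  assumes "\<And>t. t < r \<Longrightarrow> u t \<in> AA" "Z u"
  shows "\<exists>a. (\<forall>x\<in>Pr. a x \<in> AA) \<and> (\<forall>t<r. u t = (\<Sum>x\<in>Pr. a x * \<sigma> x t))"
proof -
  have "has_division (\<lambda>_ _. True) u"
  proof (rule division_coordinates)
    fix t assume t: "t < r"
    have "has_division (\<lambda>_ _. True) (unit t (1 * u t))"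
      by (rule division_NS[OF assms(1)[OF t]]) (use division_mono[OF division_monomial] t in simp)
    then show "has_division (\<lambda>_ _. True) (unit t (u t))" by simp
  qed
  from division_kernel[OF this assms(2)] show ?thesis using NS_AA by blast
qed

text \<open>
  Divide \<open>g'\<close> times the relation \<open>x = (s, g)\<close> by the relations.  If \<open>g'\<close> and \<open>g\<close> are bad together, all
  terms drop in weight.  Otherwise \<open>g'\<close> precedes \<open>g\<close> in \<open>V s\<close>, and the leading term is cancelled by
  \<open>g\<close> times the relation \<open>(s, g')\<close>, which has the same key.  Such ties are broken by \<open>pos\<close>; scaling all
  keys by \<open>N > pos\<close> keeps the strict inequalities and makes room for this.
\<close>

lemma syzygy_relation:
  assumes x: "x \<in> Pr" and g': "g' \<in> V' x"
  shows "\<exists>a. (\<forall>y\<in>Pr. a y \<in> NS (\<lambda>\<mu>. size \<mu> = 1 \<and>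
       N * key y \<mu> + pos (snd y) < N * key x {#g'#} + pos (snd x))) \<and>
     (\<forall>t<r. val g' * \<sigma> x t = (\<Sum>y\<in>Pr. a y * \<sigma> y t))"
proof -
  define Q where "Q y \<mu> \<longleftrightarrow> size \<mu> = 1 \<and> N * key y \<mu> + pos (snd y) < N * key x {#g'#} + pos (snd x)" for y \<mu>
  obtain s g where sg: "x = (s, g)" by (cases x)
  have sr: "s < r" "g \<in> V s" "g \<in> G" using x sg Pr_G by (auto simp: Pr_iff)
  have gG: "g' \<in> G" using g' VG sr by (auto simp: V'_def sg)
  have Qless: "Q y \<mu>" if "y \<in> Pr" "size \<mu> = 1" "key y \<mu> < key x {#g'#}" for y \<mu>
  proof -
    have "N * key y \<mu> + N \<le> N * key x {#g'#}" using that(3) by (metis Suc_leI add.commute mult_Suc_right mult_le_mono2)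
    then show ?thesis using pos_less[OF Pr_G[OF that(1)]] that by (simp add: Q_def)
  qed
  have tail: "has_division Q (\<lambda>t. val h * c s' h' t)"
    if "(s', h') \<in> Pr" "h \<in> G" "key (s', h') {#h#} \<le> key x {#g'#}" for s' h' h
  proof -
    have "has_division (\<lambda>y \<nu>. size \<nu> = size {#h#} \<and> key y \<nu> < key (s', h') {#h#}) (\<lambda>t. ev {#h#} * c s' h' t)"
      using division_tail[OF that(1), of "{#h#}"] division_monomial that(2) by simp
    then have "has_division Q (\<lambda>t. ev {#h#} * c s' h' t)"
      by (rule division_mono) (use Qless that(3) in simp)
    then show ?thesis by simp
  qed
  have lead: "has_division Q (unit s (val g' * val g))"
  proof (cases "bad g' g")
    case True
    have G: "set_mset {#g', g#} \<subseteq> G" using gG sr by simp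
    obtain n where n: "normal n" "rewr\<^sup>*\<^sup>* {#g', g#} n" using normal_form_exists[OF G] by blast
    have "n \<noteq> {#g', g#}" using n(1) True by (auto simp: normal_iff_pairs)
    then have p: "size n = 2" "wt n < weight g' + weight g" "ev n = val g' * val g"
      using rewr_star_props[OF n(2) G] ev_rewr[OF n(2)] by auto
    have "\<beta> * wt n < \<beta> * (weight g' + weight g)" using p beta_pos by simp
    then have lt: "\<beta> * wt n + om s < key x {#g'#}" by (simp add: key_def sg algebra_simps)
    show ?thesis using division_mono[OF division_monomial[OF n(1) sr(1)], of Q] p lt Qless by fastforce
  next
    case False
    then have p: "g' \<in> V s" "pos g' < pos g" using g' by (auto simp: V'_def sg)
    have x': "(s, g') \<in> Pr" using p sr by (simp add: Pr_iff)
    have k: "key (s, g') {#g#} = key x {#g'#}" by (simp add: key_def sg algebra_simps)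
    have "has_division Q (\<lambda>t. ev {#g#} * \<sigma> (s, g') t)"
    proof (rule division_lead[OF x'])
      show "avoids (V' (s, g')) {#g#}" using p False bad_commute by (auto simp: avoids_def V'_def)
      show "Q (s, g') {#g#}" using k p by (simp add: Q_def sg)
    qed (use sr in simp)
    moreover have "has_division Q (\<lambda>t. val g * c s g' t)" using tail[OF x' sr(3)] k by simp
    ultimately have "has_division Q (\<lambda>t. ev {#g#} * \<sigma> (s, g') t + val g * c s g' t)" by (rule division_add)
    then show ?thesis by (rule division_cong) (auto simp: \<sigma>_def unit_def algebra_simps)
  qed
  have xP: "(s, g) \<in> Pr" using x sg by simp
  have "has_division Q (\<lambda>t. unit s (val g' * val g) t + cst (- 1) * (val g' * c s g t))"
    using lead tail[OF xP gG] by (intro division_add division_scale) (simp_all add: sg)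
  moreover have "cst (- 1) = - 1" using cst_add[of "-1" 1] cst_add[of 0 0] by (simp add: eq_neg_iff_add_eq_0 add.commute)
  ultimately have "has_division Q (\<lambda>t. val g' * \<sigma> x t)"
    by (auto elim!: division_cong simp: \<sigma>_def sg unit_def algebra_simps)
  moreover have "Z (\<lambda>t. val g' * \<sigma> x t)" using Z_mult[OF AA_val[OF gG] Z_\<sigma>[OF x]] .
  ultimately obtain a where a: "\<forall>y\<in>Pr. a y \<in> NS (\<lambda>\<mu>. avoids (V' y) \<mu> \<and> Q y \<mu>)"
      "\<forall>t<r. val g' * \<sigma> x t = (\<Sum>y\<in>Pr. a y * \<sigma> y t)"
    using division_kernel by blast
  have "\<forall>y\<in>Pr. a y \<in> NS (Q y)" using a(1) NS_mono by fast
  then show ?thesis using a(2) unfolding Q_def by blast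
qed

text \<open>
  The admissible multiples of relations have pairwise different leading monomials: from
  \<open>\<mu> g e\<^sub>s\<close> one recovers \<open>g\<close> as the first element of \<open>V s\<close> in it.  Hence a monomial of largest key
  cannot cancel.
\<close>

lemma syzygies_independent:
  assumes a: "\<And>x. x \<in> Pr \<Longrightarrow> a x \<in> NS (avoids (V' x))"
    and 0: "\<And>t. t < r \<Longrightarrow> (\<Sum>x\<in>Pr. a x * \<sigma> x t) = 0"
    and "x \<in> Pr"
  shows "a x = 0"
proof -
  define S where "S = Sigma Pr (\<lambda>x. {\<mu>. normal \<mu> \<and> cf (a x) \<mu> \<noteq> 0})"
  have finS: "finite S" unfolding S_def by (rule finite_SigmaI[OF finite_Pr NS_finite_support[OF a]])
  have "S = {}"
  proof (rule ccontr)
    assume "S \<noteq> {}"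
    \<comment> \<open>a monomial of largest key in the combination; its coefficient in coordinate \<open>s\<close> survives\<close>
    define M where "M = Max ((\<lambda>(x, \<mu>). key x \<mu>) ` S)"
    have "M \<in> (\<lambda>(x, \<mu>). key x \<mu>) ` S" unfolding M_def using finS \<open>S \<noteq> {}\<close> by (intro Max_in) auto
    then obtain s g \<mu> where sg: "((s, g), \<mu>) \<in> S" "key (s, g) \<mu> = M" by auto
    have maxM: "key y \<nu> \<le> M" if "(y, \<nu>) \<in> S" for y \<nu>
      unfolding M_def using finS that by (intro Max_ge) (auto intro!: image_eqI[of _ _ "(y, \<nu>)"])
    have x: "(s, g) \<in> Pr" "s < r" "g \<in> V s" and \<mu>: "normal \<mu>" "cf (a (s, g)) \<mu> \<noteq> 0"
      using sg(1) by (auto simp: S_def Pr_iff)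
    have gG: "g \<in> G" using Pr_G[OF x(1)] by simp
    have av: "avoids (V' (s, g)) \<mu>" using cf_NS_0[OF a[OF x(1)] \<mu>(1)] \<mu>(2) by blast
    define m where "m = add_mset g \<mu>"
    have \<mu>G: "set_mset \<mu> \<subseteq> G" using \<mu> by (simp add: normal_def)
    have nm: "normal m" using \<mu> av gG \<mu>G by (fastforce simp: m_def normal_add_iff avoids_def V'_def)
    have mM: "\<beta> * wt m + om s = M" using sg(2) by (simp add: key_def m_def algebra_simps)
    have lead: "cf (a (s, g') * val g') m = (if g' = g then cf (a (s, g)) \<mu> else 0)"
      if g': "g' \<in> V s" for g'
    proof -
      have x': "(s, g') \<in> Pr" using g' x by (simp add: Pr_iff)
      have "cf (b * val g') m = (if g' = g then cf b \<mu> else 0)" if "b \<in> NS (avoids (V' (s, g')))" for b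
        using that
      proof (induction rule: NS_induct)
        case (add k n b)
        have "set_mset n \<subseteq> G" using add by (simp add: normal_def)
        then have nn: "normal (add_mset g' n)"
          using add(1,2) Pr_G[OF x'] by (fastforce simp: normal_add_iff avoids_def V'_def)
        have e: "add_mset g' n = m \<longleftrightarrow> g' = g \<and> n = \<mu>"
        proof
          assume e: "add_mset g' n = m"
          show "g' = g \<and> n = \<mu>"
          proof (cases "g' = g")
            case False
            then have "g \<in># n" "g' \<in># \<mu>" using e by (auto simp: m_def add_eq_conv_ex)
            then have "\<not> pos g < pos g'" "\<not> pos g' < pos g"
              using add(2) av x(3) g' by (auto simp: avoids_def V'_def)
            then show ?thesis using pos_inj gG Pr_G[OF x'] False by (auto simp: inj_on_def)
          qed (use e in \<open>auto simp: m_def\<close>)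
        qed (simp add: m_def)
        have "cf ((cst k * ev n + b) * val g') m = k * cf (ev (add_mset g' n)) m + cf (b * val g') m"
          by (simp add: algebra_simps cf_add flip: cf_scale)
        then show ?case using add.IH e cf_ev[OF nn nm] cf_ev[OF add(1) \<mu>(1)]
          by (auto simp: cf_add cf_scale)
      qed simp
      then show ?thesis using a[OF x'] by auto
    qed
    \<comment> \<open>tails contribute smaller keys only\<close>
    have tail: "cf (a y * c (fst y) (snd y) s) m = 0" if y: "y \<in> Pr" for y
    proof -
      obtain F where F: "finite F" "\<forall>\<nu>\<in>F. normal \<nu> \<and> True" "a y = (\<Sum>\<nu>\<in>F. cst (cf (a y) \<nu>) * ev \<nu>)"
        using NS_expand[OF NS_AA[OF a[OF y]]] by blast
      have "cf (ev \<nu> * c (fst y) (snd y) s) m = 0" if \<nu>: "normal \<nu>" "cf (a y) \<nu> \<noteq> 0" for \<nu>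
      proof -
        have k: "key y \<nu> \<le> M" using \<nu> y by (intro maxM) (auto simp: S_def)
        have "ev \<nu> * c (fst y) (snd y) s \<in> NS (\<lambda>k. \<beta> * wt k + om s < M)"
        proof (rule NS_mult)
          show "ev \<nu> \<in> NS (\<lambda>m. m = \<nu>)" using \<nu> by (intro NS_ev) auto
          show "c (fst y) (snd y) s \<in> NS (\<lambda>m. size m = 1 \<and> \<beta> * wt m + om s < \<beta> * weight (snd y) + om (fst y))"
            using y x by (intro c_NS) (auto simp: Pr_def)
        next
          fix m1 n1 k1
          assume "m1 = \<nu>" and n1: "size n1 = 1 \<and> \<beta> * wt n1 + om s < \<beta> * weight (snd y) + om (fst y)"
            and w: "wt k1 \<le> wt m1 + wt n1"
          have "\<beta> * wt k1 \<le> \<beta> * wt \<nu> + \<beta> * wt n1"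
            using w \<open>m1 = \<nu>\<close> by (metis add_mult_distrib2 mult_le_mono2)
          then show "\<beta> * wt k1 + om s < M" using n1 k by (simp add: key_def)
        qed
        then show ?thesis by (rule cf_NS_0[OF _ nm]) (use mM in simp)
      qed
      then have "cf (a y) \<nu> * cf (ev \<nu> * c (fst y) (snd y) s) m = 0" if "\<nu> \<in> F" for \<nu>
        using F(2) that by (cases "cf (a y) \<nu> = 0") auto
      then have "(\<Sum>\<nu>\<in>F. cf (a y) \<nu> * cf (ev \<nu> * c (fst y) (snd y) s) m) = 0"
        by (simp add: sum.neutral)
      then show ?thesis
        by (subst F(3)) (simp add: sum_distrib_right cf_sum mult.assoc cf_scale)
    qed
    have sums: "a y * \<sigma> y s = (if fst y = s then a y * val (snd y) else 0) - a y * c (fst y) (snd y) s" for y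
      by (auto simp: \<sigma>_def algebra_simps)
    have "0 = cf (\<Sum>y\<in>Pr. a y * \<sigma> y s) m" using 0[OF x(2)] by simp
    also have "\<dots> = (\<Sum>y\<in>Pr. if y = (s, g) then cf (a (s, g)) \<mu> else 0)"
      unfolding cf_sum
    proof (rule sum.cong[OF refl])
      fix y assume y: "y \<in> Pr"
      show "cf (a y * \<sigma> y s) m = (if y = (s, g) then cf (a (s, g)) \<mu> else 0)"
        using lead[of "snd y"] tail[OF y] y by (cases y) (auto simp: sums cf_minus Pr_iff)
    qed
    also have "\<dots> = cf (a (s, g)) \<mu>" using x finite_Pr by simp
    finally show False using \<mu>(2) by simp
  qed
  then have "cf (a x) \<mu> = 0" if "normal \<mu>" for \<mu> using that \<open>x \<in> Pr\<close> by (auto simp: S_def)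
  then show ?thesis using NS_eq_0[OF a[OF \<open>x \<in> Pr\<close>]] by blast
qed

lemma next_state:
  assumes e: "bij_betw e {..<r'} Pr" and "0 < N"
  shows "kernel_state r' (\<lambda>u. V' (e u)) (\<lambda>u. N * key (e u) {#} + pos (snd (e u))) (N * \<beta>)
     (\<lambda>f. \<forall>t<r. (\<Sum>u<r'. f u * \<sigma> (e u) t) = 0)"
proof -
  have re: "(\<Sum>u<r'. h (e u)) = (\<Sum>x\<in>Pr. h x)" for h :: "nat \<times> 'g \<Rightarrow> 'a"
    using sum.reindex_bij_betw[OF e] .
  define e' where "e' = inv_into {..<r'} e"
  have e': "e' x < r'" "e (e' x) = x" if "x \<in> Pr" for x
    using e that inv_into_into[of x e "{..<r'}"] f_inv_into_f[of x e "{..<r'}"]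
    by (auto simp: e'_def bij_betw_def)
  have e'e: "e' (e u) = u" if "u < r'" for u
    using e that by (auto simp: e'_def bij_betw_def inv_into_f_f)
  have eP: "e u \<in> Pr" if "u < r'" for u using e that by (auto simp: bij_betw_def)
  have re': "(\<Sum>u<r'. f u * \<sigma> (e u) t) = (\<Sum>x\<in>Pr. f (e' x) * \<sigma> x t)" for f :: "nat \<Rightarrow> 'a" and t
    unfolding re[of "\<lambda>x. f (e' x) * \<sigma> x t", symmetric] by (rule sum.cong) (simp_all add: e'e)
  show ?thesis unfolding kernel_state_def
  proof (intro conjI allI impI ballI)
    show "0 < N * \<beta>" using beta_pos \<open>0 < N\<close> by simp
  next
    fix u assume "u < r'"
    then have "fst (e u) < r" using eP[of u] by (auto simp: Pr_def)
    then show "V' (e u) \<subseteq> G" using VG by (auto simp: V'_def)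
  next
    fix f f' :: "nat \<Rightarrow> 'a" and t assume "\<forall>s<r'. f s = f' s" "\<forall>t<r. (\<Sum>u<r'. f u * \<sigma> (e u) t) = 0" "t < r"
    then show "(\<Sum>u<r'. f' u * \<sigma> (e u) t) = 0" by simp
  next
    fix a :: 'a and f :: "nat \<Rightarrow> 'a" and t assume "\<forall>t<r. (\<Sum>u<r'. f u * \<sigma> (e u) t) = 0" "t < r"
    then show "(\<Sum>u<r'. a * f u * \<sigma> (e u) t) = 0" by (simp add: mult.assoc flip: sum_distrib_left)
  next
    fix f :: "nat \<Rightarrow> 'a" and u
    assume f: "\<forall>s<r'. f s \<in> NS (avoids (V' (e s)))" and z: "\<forall>t<r. (\<Sum>u<r'. f u * \<sigma> (e u) t) = 0" and u: "u < r'"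
    have "f (e' (e u)) = 0"
    proof (rule syzygies_independent[of "\<lambda>x. f (e' x)"])
      fix x assume x: "x \<in> Pr"
      show "f (e' x) \<in> NS (avoids (V' x))" using f[rule_format, OF e'(1)[OF x]] e'(2)[OF x] by simp
    next
      fix t assume "t < r"
      then show "(\<Sum>x\<in>Pr. f (e' x) * \<sigma> x t) = 0" using z re'[of f t] by simp
    qed (rule eP[OF u])
    then show "f u = 0" using e'e u by simp
  next
    fix u g' assume u: "u < r'" and g': "g' \<in> V' (e u)"
    obtain a where a: "\<forall>y\<in>Pr. a y \<in> NS (\<lambda>\<mu>. size \<mu> = 1 \<and>
         N * key y \<mu> + pos (snd y) < N * key (e u) {#g'#} + pos (snd (e u)))"
       "\<forall>t<r. val g' * \<sigma> (e u) t = (\<Sum>y\<in>Pr. a y * \<sigma> y t)"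
      using syzygy_relation[OF eP[OF u] g'] by blast
    show "\<exists>c. (\<forall>t<r'. c t \<in> NS (\<lambda>m. size m = 1 \<and> N * \<beta> * wt m + (N * key (e t) {#} + pos (snd (e t)))
          < N * \<beta> * weight g' + (N * key (e u) {#} + pos (snd (e u))))) \<and>
        (\<forall>t<r. (\<Sum>v<r'. ((if v = u then val g' else 0) - c v) * \<sigma> (e v) t) = 0)"
    proof (intro exI[of _ "\<lambda>v. a (e v)"] conjI allI impI)
      fix v assume "v < r'"
      then have "a (e v) \<in> NS (\<lambda>\<mu>. size \<mu> = 1 \<and>
         N * key (e v) \<mu> + pos (snd (e v)) < N * key (e u) {#g'#} + pos (snd (e u)))" using a eP by blast
      then show "a (e v) \<in> NS (\<lambda>m. size m = 1 \<and> N * \<beta> * wt m + (N * key (e v) {#} + pos (snd (e v)))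
          < N * \<beta> * weight g' + (N * key (e u) {#} + pos (snd (e u))))"
        by (rule NS_mono) (simp add: key_def algebra_simps)
    next
      fix t assume t: "t < r"
      have "(\<Sum>v<r'. ((if v = u then val g' else 0) - a (e v)) * \<sigma> (e v) t) =
          (\<Sum>v<r'. if v = u then val g' * \<sigma> (e u) t else 0) - (\<Sum>v<r'. a (e v) * \<sigma> (e v) t)"
        by (subst sum_subtractf[symmetric], rule sum.cong) (auto simp: algebra_simps)
      also have "\<dots> = 0" using a(2) t u re[of "\<lambda>y. a y * \<sigma> y t"] by simp
      finally show "(\<Sum>v<r'. ((if v = u then val g' else 0) - a (e v)) * \<sigma> (e v) t) = 0" .
    qed
  qed (simp_all add: distrib_right sum.distrib)
qed

end

section \<open>Subrings as rings with carriers\<close>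

definition subring_set :: "'a::comm_ring_1 set \<Rightarrow> bool" where
  "subring_set S \<longleftrightarrow> 0 \<in> S \<and> 1 \<in> S \<and> (\<forall>x\<in>S. - x \<in> S) \<and>
     (\<forall>x\<in>S. \<forall>y\<in>S. x + y \<in> S \<and> x * y \<in> S)"

lemma ring_on_simps [simp]:
  "carrier (ring_on S) = S" "x \<otimes>\<^bsub>ring_on S\<^esub> y = x * y" "x \<oplus>\<^bsub>ring_on S\<^esub> y = x + y"
  "\<one>\<^bsub>ring_on S\<^esub> = 1" "\<zero>\<^bsub>ring_on S\<^esub> = 0"
  by (simp_all add: ring_on_def)

lemma cring_ring_on:
  assumes "subring_set S"
  shows "cring (ring_on S)"
proof (rule cringI)
  show "abelian_group (ring_on S)"
    by (rule abelian_groupI) (use assms in \<open>auto simp: subring_set_def algebra_simps intro!: bexI[of _ "- _"]\<close>)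
  show "comm_monoid (ring_on S)"
    by (rule comm_monoidI) (use assms in \<open>auto simp: subring_set_def algebra_simps\<close>)
qed (simp add: algebra_simps)

lemma a_inv_ring_on:
  assumes "subring_set S" "x \<in> S"
  shows "\<ominus>\<^bsub>ring_on S\<^esub> x = - x"
proof -
  interpret cring "ring_on S" by (rule cring_ring_on[OF assms(1)])
  have "- x \<in> S" using assms by (simp add: subring_set_def)
  then show ?thesis using assms(2) minus_equality[of "- x" x] by simp
qed

lemma finsum_ring_on:
  assumes "subring_set S" "\<And>i. i \<in> I \<Longrightarrow> f i \<in> S" "finite I"
  shows "finsum (ring_on S) f I = sum f I"
proof -
  interpret cring "ring_on S" by (rule cring_ring_on[OF assms(1)])
  show ?thesis using assms(3,2)
  proof (induction I rule: finite_induct)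
    case (insert i I)
    then show ?case by (subst finsum_insert) auto
  qed simp
qed

lemma additive_subgroup_ring_on:
  assumes "subring_set S" "P \<subseteq> S" "0 \<in> P" "\<And>x y. x \<in> P \<Longrightarrow> y \<in> P \<Longrightarrow> x + y \<in> P" "\<And>x. x \<in> P \<Longrightarrow> - x \<in> P"
  shows "additive_subgroup P (ring_on S)"
proof -
  interpret cring "ring_on S" by (rule cring_ring_on[OF assms(1)])
  show ?thesis
  proof (rule additive_subgroup.intro, rule group.subgroupI)
    show "group (add_monoid (ring_on S))" by (rule a_group)
  next
    fix x assume "x \<in> P"
    then show "inv\<^bsub>add_monoid (ring_on S)\<^esub> x \<in> P"
      using a_inv_ring_on[OF assms(1), of x] assms(2,5) by (auto simp: a_inv_def)
  qed (use assms in auto)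
qed

lemma ideal_ring_on:
  assumes "subring_set S" "P \<subseteq> S" "0 \<in> P" "\<And>x y. x \<in> P \<Longrightarrow> y \<in> P \<Longrightarrow> x + y \<in> P"
    "\<And>a x. a \<in> S \<Longrightarrow> x \<in> P \<Longrightarrow> a * x \<in> P"
  shows "ideal P (ring_on S)"
proof (rule idealI)
  interpret cring "ring_on S" by (rule cring_ring_on[OF assms(1)])
  show "ring (ring_on S)" by (rule ring_axioms)
  have "- x \<in> P" if "x \<in> P" for x
    using assms(1) assms(5)[of "- 1" x] that by (simp add: subring_set_def)
  then show "subgroup P (add_monoid (ring_on S))"
    using additive_subgroup_ring_on[OF assms(1-4)] additive_subgroup.a_subgroup by blast
next
  fix a x assume "a \<in> P" "x \<in> carrier (ring_on S)"
  then show "x \<otimes>\<^bsub>ring_on S\<^esub> a \<in> P" "a \<otimes>\<^bsub>ring_on S\<^esub> x \<in> P"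
    using assms(5)[of x a] by (simp_all add: mult.commute)
qed

context quadratic_toric_algebra
begin

abbreviation graded :: "nat \<Rightarrow> 'a set" where "graded n \<equiv> NS (\<lambda>m. size m = n)"

lemma one_NS: "P {#} \<Longrightarrow> 1 \<in> NS P"
  using NS_ev[of "{#}" P] by simp

lemma subring_AA: "subring_set AA"
  using NS_add NS_uminus AA_mult one_NS by (auto simp: subring_set_def)

lemma graded_mult:
  assumes "a \<in> graded n" "b \<in> graded k"
  shows "a * b \<in> graded (n + k)"
  using assms by (rule NS_mult) simp

section \<open>The linear resolution of the residue field\<close>

lemma next_state_exists:
  assumes st: "kernel_state r V om \<beta> Z"
  shows "\<exists>r' V' om' \<beta>' \<sigma>. kernel_state r' V' om' \<beta>' (\<lambda>f. \<forall>t<r. (\<Sum>u<r'. f u * \<sigma> u t) = 0) \<and>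
     (\<forall>u<r'. \<forall>t<r. \<sigma> u t \<in> graded 1) \<and>
     (\<forall>f. (\<forall>t<r. f t \<in> AA) \<longrightarrow>
        (Z f \<longleftrightarrow> (\<exists>a. (\<forall>u<r'. a u \<in> AA) \<and> (\<forall>t<r. f t = (\<Sum>u<r'. a u * \<sigma> u t)))))"
proof -
  obtain pos and k :: nat where pos: "pos ` G = {i. i < k}" "inj_on pos G"
    using finite_imp_inj_to_nat_seg[OF finite_G] by blast
  let ?C = "\<lambda>s g c. (\<forall>t<r. c t \<in> NS (\<lambda>m. size m = 1 \<and> \<beta> * wt m + om t < \<beta> * weight g + om s)) \<and>
        Z (\<lambda>t. (if t = s then val g else 0) - c t)"
  have ex_c: "\<exists>c. ?C s g c" if "s < r" "g \<in> V s" for s g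
    using st[unfolded kernel_state_def, THEN conjunct2, THEN conjunct2, THEN conjunct2, THEN conjunct2,
      THEN conjunct2, THEN conjunct2, THEN conjunct2, rule_format, OF that] .
  define c where "c s g = (SOME c. ?C s g c)" for s g
  have c: "?C s g (c s g)" if "s < r" "g \<in> V s" for s g
    unfolding c_def by (rule someI_ex[OF ex_c[OF that]])
  interpret syzygy_step G step weight val cst cf r V om \<beta> Z c pos "Suc k"
  proof
    show "kernel_state r V om \<beta> Z" by (rule st)
    show "inj_on pos G" by (rule pos)
    show "pos g < Suc k" if "g \<in> G" for g using pos(1) that by (auto intro: less_SucI)
  qed (use c in simp_all)
  obtain e where e: "bij_betw e {..<card Pr} Pr"
    using ex_bij_betw_nat_finite[OF finite_Pr] by (auto simp: atLeast0LessThan)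
  have eP: "e u \<in> Pr" if "u < card Pr" for u using e that by (auto simp: bij_betw_def)
  have deg: "\<sigma> (e u) t \<in> graded 1" if "u < card Pr" "t < r" for u t
  proof -
    have "fst (e u) < r" "snd (e u) \<in> V (fst (e u))" using eP[OF that(1)] by (auto simp: Pr_def)
    then have "c (fst (e u)) (snd (e u)) t \<in> graded 1" by (intro NS_mono[OF c_NS] that(2)) auto
    moreover have "val (snd (e u)) \<in> graded 1"
      using NS_ev[of "{#snd (e u)#}" "\<lambda>m. size m = 1"] Pr_G[OF eP[OF that(1)]] by simp
    ultimately show ?thesis unfolding \<sigma>_def by (auto intro: NS_diff NS_uminus)
  qed
  have image: "Z f \<longleftrightarrow> (\<exists>a. (\<forall>u<card Pr. a u \<in> AA) \<and> (\<forall>t<r. f t = (\<Sum>u<card Pr. a u * \<sigma> (e u) t)))"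
    if f: "\<forall>t<r. f t \<in> AA" for f
  proof
    assume "Z f"
    then obtain a where a: "\<forall>x\<in>Pr. a x \<in> AA" "\<forall>t<r. f t = (\<Sum>x\<in>Pr. a x * \<sigma> x t)"
      using kernel_generated f by blast
    show "\<exists>a. (\<forall>u<card Pr. a u \<in> AA) \<and> (\<forall>t<r. f t = (\<Sum>u<card Pr. a u * \<sigma> (e u) t))"
      by (intro exI[of _ "a \<circ> e"])
        (use a eP sum.reindex_bij_betw[OF e, of "\<lambda>x. a x * \<sigma> x _"] in auto)
  next
    assume "\<exists>a. (\<forall>u<card Pr. a u \<in> AA) \<and> (\<forall>t<r. f t = (\<Sum>u<card Pr. a u * \<sigma> (e u) t))"
    then obtain a where a: "\<forall>u<card Pr. a u \<in> AA" "\<forall>t<r. f t = (\<Sum>u<card Pr. a u * \<sigma> (e u) t)" by blast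
    define a' where "a' x = a (inv_into {..<card Pr} e x)" for x
    have a': "a' (e u) = a u" if "u < card Pr" for u
      using e that by (auto simp: a'_def bij_betw_def inv_into_f_f)
    have "Z (\<lambda>t. \<Sum>x\<in>Pr. a' x * \<sigma> x t)"
    proof (rule Z_combination)
      fix x assume "x \<in> Pr"
      then obtain u where "u < card Pr" "x = e u" using e by (auto simp: bij_betw_def)
      then show "a' x \<in> AA" using a a' by simp
    qed simp
    then show "Z f"
    proof (rule Z_cong[rotated])
      fix t assume "t < r"
      have "(\<Sum>x\<in>Pr. a' x * \<sigma> x t) = (\<Sum>u<card Pr. a' (e u) * \<sigma> (e u) t)"
        using sum.reindex_bij_betw[OF e, of "\<lambda>x. a' x * \<sigma> x t"] by simp
      also have "\<dots> = f t" using a(2) \<open>t < r\<close> a' by simp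
      finally show "(\<Sum>x\<in>Pr. a' x * \<sigma> x t) = f t" .
    qed
  qed
  show ?thesis
  proof (rule exI[of _ "card Pr"], rule exI[of _ "\<lambda>u. V' (e u)"],
      rule exI[of _ "\<lambda>u. Suc k * key (e u) {#} + pos (snd (e u))"], rule exI[of _ "Suc k * \<beta>"],
      rule exI[of _ "\<lambda>u. \<sigma> (e u)"], intro conjI)
    show "kernel_state (card Pr) (\<lambda>u. V' (e u)) (\<lambda>u. Suc k * key (e u) {#} + pos (snd (e u))) (Suc k * \<beta>)
      (\<lambda>f. \<forall>t<r. (\<Sum>u<card Pr. f u * \<sigma> (e u) t) = 0)"
      by (rule next_state[OF e]) simp
  qed (use deg image in simp_all)
qed

text \<open>
  The resolution starts from the surjection of the algebra onto its residue field.  Its kernel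
  has all nonconstant monomials as leading monomials, which is the case \<open>V = G\<close>, and the relations
  are the generators themselves, without tails.
\<close>

lemma initial_state: "kernel_state 1 (\<lambda>_. G) (\<lambda>_. 0) 1 (\<lambda>f. f 0 \<in> NS (\<lambda>m. 0 < size m))"
  unfolding kernel_state_def
proof (intro conjI allI impI ballI)
  fix a f assume "a \<in> AA" "f 0 \<in> NS (\<lambda>m. 0 < size m)"
  then show "a * f 0 \<in> NS (\<lambda>m. 0 < size m)" by (rule NS_mult) simp
next
  fix f :: "nat \<Rightarrow> 'a" and s :: nat assume f: "\<forall>s<1. f s \<in> NS (avoids G)" "f 0 \<in> NS (\<lambda>m. 0 < size m)" and "s < (1::nat)"
  have "f 0 = 0"
  proof (rule NS_eq_0[OF f(2)])
    fix m assume m: "normal m"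
    show "cf (f 0) m = 0"
    proof (cases "m = {#}")
      case True
      then show ?thesis using cf_NS_0[OF f(2) m] by simp
    next
      case False
      moreover have "set_mset m \<inter> G = set_mset m" using m by (auto simp: normal_def)
      ultimately have "\<not> avoids G m" by (simp add: avoids_def)
      then show ?thesis using cf_NS_0[OF f(1)[rule_format, of 0] m] by simp
    qed
  qed
  then show "f s = 0" using \<open>s < 1\<close> by simp
next
  fix s g assume "s < (1::nat)" "g \<in> G"
  then show "\<exists>c. (\<forall>t<1. c t \<in> NS (\<lambda>m. size m = 1 \<and> 1 * wt m + 0 < 1 * weight g + 0)) \<and>
    (if 0 = s then val g else 0) - c 0 \<in> NS (\<lambda>m. 0 < size m)"
    using NS_ev[of "{#g#}" "\<lambda>m. 0 < size m"] by (intro exI[of _ "\<lambda>_. 0"]) simp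
qed (auto intro: NS_add)

text \<open>
  The ranks \<open>b\<close> and the matrices \<open>\<sigma>\<close> of the resolution.  Exactness is expressed by the kernels
  carried along in the invariant: each is the image of the next matrix.
\<close>

lemma resolution_exists:
  "\<exists>(b :: nat \<Rightarrow> nat) \<sigma>. b 0 = 1 \<and> (\<forall>i. \<forall>u<b (Suc i). \<forall>t<b i. \<sigma> i u t \<in> graded 1) \<and>
     (\<forall>f :: nat \<Rightarrow> 'a. f 0 \<in> AA \<longrightarrow>
        (f 0 \<in> NS (\<lambda>m. 0 < size m) \<longleftrightarrow> (\<exists>a. (\<forall>u<b 1. a u \<in> AA) \<and> f 0 = (\<Sum>u<b 1. a u * \<sigma> 0 u 0)))) \<and>
     (\<forall>i f. (\<forall>t<b (Suc i). f t \<in> AA) \<longrightarrow>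
        ((\<forall>t<b i. (\<Sum>u<b (Suc i). f u * \<sigma> i u t) = 0) \<longleftrightarrow>
         (\<exists>a. (\<forall>u<b (Suc (Suc i)). a u \<in> AA) \<and>
            (\<forall>t<b (Suc i). f t = (\<Sum>u<b (Suc (Suc i)). a u * \<sigma> (Suc i) u t)))))"
proof -
  define kst where "kst x \<longleftrightarrow> (case x of (r, V, om, \<beta>, Z) \<Rightarrow> kernel_state r V om \<beta> Z)" for x
  define rank where "rank x = fst x"
    for x :: "nat \<times> (nat \<Rightarrow> 'g set) \<times> (nat \<Rightarrow> nat) \<times> nat \<times> ((nat \<Rightarrow> 'a) \<Rightarrow> bool)"
  define ker where "ker x = snd (snd (snd (snd x)))"
    for x :: "nat \<times> (nat \<Rightarrow> 'g set) \<times> (nat \<Rightarrow> nat) \<times> nat \<times> ((nat \<Rightarrow> 'a) \<Rightarrow> bool)"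
  define init :: "nat \<times> (nat \<Rightarrow> 'g set) \<times> (nat \<Rightarrow> nat) \<times> nat \<times> ((nat \<Rightarrow> 'a) \<Rightarrow> bool)"
    where "init = (1, \<lambda>_. G, \<lambda>_. 0, 1, \<lambda>f. f 0 \<in> NS (\<lambda>m. 0 < size m))"
  define R where "R r r' Z Z' \<sigma> \<longleftrightarrow> Z' = (\<lambda>f. \<forall>t<r. (\<Sum>u<r'. f u * \<sigma> u t) = 0) \<and>
       (\<forall>u<r'. \<forall>t<r. \<sigma> u t \<in> graded 1) \<and>
       (\<forall>f. (\<forall>t<r. f t \<in> AA) \<longrightarrow>
        (Z f \<longleftrightarrow> (\<exists>a. (\<forall>u<r'. a u \<in> AA) \<and> (\<forall>t<r. f t = (\<Sum>u<r'. a u * \<sigma> u t)))))"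
    for r r' :: nat and Z Z' :: "(nat \<Rightarrow> 'a) \<Rightarrow> bool" and \<sigma>
  have "\<exists>F. \<forall>n. (kst (F n) \<and> (n = 0 \<longrightarrow> F n = init)) \<and>
      (\<exists>\<sigma>. R (rank (F n)) (rank (F (Suc n))) (ker (F n)) (ker (F (Suc n))) \<sigma>)"
  proof (rule dependent_nat_choice)
    show "\<exists>x. kst x \<and> (0 = (0::nat) \<longrightarrow> x = init)"
      using initial_state by (simp add: kst_def init_def)
  next
    fix x and n :: nat assume x: "kst x \<and> (n = 0 \<longrightarrow> x = init)"
    obtain r V om \<beta> Z where xe: "x = (r, V, om, \<beta>, Z)" by (cases x)
    obtain r' V' om' \<beta>' \<sigma> where *: "kernel_state r' V' om' \<beta>' (\<lambda>f. \<forall>t<r. (\<Sum>u<r'. f u * \<sigma> u t) = 0)"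
       "\<forall>u<r'. \<forall>t<r. \<sigma> u t \<in> graded 1"
       "\<forall>f. (\<forall>t<r. f t \<in> AA) \<longrightarrow>
        (Z f \<longleftrightarrow> (\<exists>a. (\<forall>u<r'. a u \<in> AA) \<and> (\<forall>t<r. f t = (\<Sum>u<r'. a u * \<sigma> u t))))"
      using next_state_exists[of r V om \<beta> Z] x xe by (auto simp: kst_def)
    define y where "y = (r', V', om', \<beta>', \<lambda>f. \<forall>t<r. (\<Sum>u<r'. f u * \<sigma> u t) = 0)"
    have "kst y" using *(1) by (simp add: y_def kst_def)
    moreover have "R (rank x) (rank y) (ker x) (ker y) \<sigma>"
      unfolding R_def by (intro conjI) (use * in \<open>simp_all add: y_def xe rank_def ker_def\<close>)
    ultimately show "\<exists>y. (kst y \<and> (Suc n = 0 \<longrightarrow> y = init)) \<and>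
        (\<exists>\<sigma>. R (rank x) (rank y) (ker x) (ker y) \<sigma>)" by blast
  qed
  then obtain F where F': "\<forall>n. (kst (F n) \<and> (n = 0 \<longrightarrow> F n = init)) \<and>
      (\<exists>\<sigma>. R (rank (F n)) (rank (F (Suc n))) (ker (F n)) (ker (F (Suc n))) \<sigma>)" ..
  then have F: "F 0 = init"
    "\<forall>n. \<exists>\<sigma>. R (rank (F n)) (rank (F (Suc n))) (ker (F n)) (ker (F (Suc n))) \<sigma>" by simp_all
  define b where "b n = rank (F n)" for n
  define Z where "Z n = ker (F n)" for n
  have b0: "b 0 = 1" "Z 0 = (\<lambda>f. f 0 \<in> NS (\<lambda>m. 0 < size m))"
    by (simp_all add: b_def Z_def F(1) init_def rank_def ker_def)
  obtain \<sigma> where \<sigma>: "\<forall>n. R (b n) (b (Suc n)) (Z n) (Z (Suc n)) (\<sigma> n)"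
    using choice[OF F(2)] unfolding b_def Z_def ..
  note s = \<sigma>[rule_format, unfolded R_def, THEN conjunct1] \<sigma>[rule_format, unfolded R_def, THEN conjunct2, THEN conjunct1]
    \<sigma>[rule_format, unfolded R_def, THEN conjunct2, THEN conjunct2, rule_format]
  show ?thesis
  proof (intro exI[of _ b] exI[of _ \<sigma>] conjI allI impI)
    fix f :: "nat \<Rightarrow> 'a" assume "f 0 \<in> AA"
    then show "f 0 \<in> NS (\<lambda>m. 0 < size m) \<longleftrightarrow> (\<exists>a. (\<forall>u<b 1. a u \<in> AA) \<and> f 0 = (\<Sum>u<b 1. a u * \<sigma> 0 u 0))"
      using s(3)[of 0 f] by (simp add: b0)
  next
    fix i and f :: "nat \<Rightarrow> 'a" assume "\<forall>t<b (Suc i). f t \<in> AA"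
    then show "(\<forall>t<b i. (\<Sum>u<b (Suc i). f u * \<sigma> i u t) = 0) \<longleftrightarrow>
         (\<exists>a. (\<forall>u<b (Suc (Suc i)). a u \<in> AA) \<and>
            (\<forall>t<b (Suc i). f t = (\<Sum>u<b (Suc (Suc i)). a u * \<sigma> (Suc i) u t)))"
      using s(3)[of "Suc i" f] by (simp only: s(1) HOL.simp_thms)
  qed (use b0 s(2) in simp_all)
qed

lemma decomposition_exists:
  assumes "a \<in> AA"
  shows "\<exists>f. (\<forall>n. f n \<in> graded n) \<and> (\<exists>N. (\<forall>n>N. f n = 0) \<and> a = (\<Sum>n\<le>N. f n))"
  using assms
proof (induction rule: NS_induct)
  case zero
  show ?case by (intro exI[of _ "\<lambda>_. 0"]) simp
next
  case (add c m b)
  then obtain f N where f: "\<forall>n. f n \<in> graded n" "\<forall>n>N. f n = 0" "b = (\<Sum>n\<le>N. f n)" by blast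
  define f' where "f' n = (if n = size m then cst c * ev m else 0) + f n" for n
  define N' where "N' = max N (size m)"
  have "b = (\<Sum>n\<le>N'. f n)"
    unfolding f(3) by (rule sum.mono_neutral_left) (use f(2) in \<open>auto simp: N'_def\<close>)
  then have "cst c * ev m + b = (\<Sum>n\<le>N'. f' n)" by (simp add: f'_def sum.distrib N'_def)
  moreover have "\<forall>n. f' n \<in> graded n"
    unfolding f'_def using f(1) add by (auto intro!: NS_add NS_scale NS_ev)
  moreover have "\<forall>n>N'. f' n = 0" using f(2) by (simp add: f'_def N'_def)
  ultimately show ?case by blast
qed

lemma decomposition_cf:
  assumes "\<forall>n. f n \<in> graded n" "\<forall>n>N. f n = 0" "a = (\<Sum>n\<le>N. f n)" "normal m"
  shows "cf (f n) m = (if size m = n then cf a m else 0)"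
proof -
  have z: "cf (f k) m = 0" if "size m \<noteq> k" for k
    using cf_NS_0[OF assms(1)[rule_format, of k] assms(4)] that by simp
  have "cf a m = (\<Sum>k\<le>N. if k = size m then cf (f k) m else 0)"
    unfolding assms(3) cf_sum by (rule sum.cong) (use z in auto)
  then have "cf a m = (if size m \<le> N then cf (f (size m)) m else 0)" by simp
  then have "cf a m = cf (f (size m)) m" using assms(2) by (auto split: if_splits)
  then show ?thesis using z by auto
qed

lemma cst_0 [simp]: "cst 0 = 0"
  using cst_add[of 0 0] by simp

lemma cst_eq_0: "cst c = 0 \<longleftrightarrow> c = 0"
proof
  assume "cst c = 0"
  then show "c = 0" using cf_scale[of c "ev {#}" "{#}"] cf_ev[of "{#}" "{#}"] by simp
qed simp

text \<open>
  The only normal monomial of degree zero is the empty one.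
\<close>

lemma graded_0: "graded 0 = range cst"
proof
  show "graded 0 \<subseteq> range cst"
  proof
    fix a assume "a \<in> graded 0"
    then show "a \<in> range cst"
    proof (induction rule: NS_induct)
      case zero
      show ?case using cst_0 by (metis rangeI)
    next
      case (add c m b)
      then show ?case by (auto simp flip: cst_add)
    qed
  qed
  show "range cst \<subseteq> graded 0" using NS_scale[OF one_NS, of "\<lambda>m. size m = 0"] by auto
qed

lemma standard_graded_AA: "standard_graded (range cst) (ring_on AA) graded"
proof -
  interpret A: cring "ring_on AA" by (rule cring_ring_on[OF subring_AA])
  have Kc: "range cst \<subseteq> AA" using graded_0 NS_AA by blast
  have cst_uminus: "- cst c = cst (- c)" for c using cst_add[of c "- c"] by (simp add: minus_unique)
  show ?thesis unfolding standard_graded_def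
  proof (intro conjI allI ballI)
    show "cring (ring_on AA)" by (rule A.cring_axioms)
    show "subfield (range cst) (ring_on AA)"
    proof (rule A.subfieldI)
      show "subcring (range cst) (ring_on AA)"
      proof (rule A.subcringI, rule A.subringI)
        show "\<one>\<^bsub>ring_on AA\<^esub> \<in> range cst" using cst_one by (metis rangeI ring_on_simps(4))
      next
        fix h assume "h \<in> range cst"
        then show "\<ominus>\<^bsub>ring_on AA\<^esub> h \<in> range cst"
          using a_inv_ring_on[OF subring_AA, of h] Kc by (auto simp: cst_uminus)
      qed (use Kc in \<open>auto simp flip: cst_mult cst_add simp: mult.commute\<close>)
      show "Units (ring_on AA\<lparr>carrier := range cst\<rparr>) = range cst - {\<zero>\<^bsub>ring_on AA\<^esub>}"
      proof safe
        fix c assume "cst c \<notin> Units (ring_on AA\<lparr>carrier := range cst\<rparr>)"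
        then have "\<not> cst (inverse c) * cst c = 1"
          by (auto simp: Units_def ring_on_def mult.commute)
        then show "cst c = \<zero>\<^bsub>ring_on AA\<^esub>" by (cases "c = 0") (auto simp flip: cst_mult)
      next
        assume "\<zero>\<^bsub>ring_on AA\<^esub> \<in> Units (ring_on AA\<lparr>carrier := range cst\<rparr>)"
        then have "(0::'a) = 1" by (auto simp: Units_def ring_on_def)
        then show False using cst_eq_0[of 1] by simp
      qed (auto simp: Units_def)
    qed
    show "graded 0 = range cst" by (rule graded_0)
    show "additive_subgroup (graded n) (ring_on AA)" for n
      by (rule additive_subgroup_ring_on[OF subring_AA]) (use NS_add NS_uminus NS_AA in auto)
    show "x \<otimes>\<^bsub>ring_on AA\<^esub> y \<in> graded (n + k)" if "x \<in> graded n" "y \<in> graded k" for n k x y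
      using graded_mult that by simp
    show "\<exists>!f. (\<forall>n. f n \<in> graded n) \<and> (\<exists>N. (\<forall>n>N. f n = \<zero>\<^bsub>ring_on AA\<^esub>) \<and>
        a = (\<Oplus>\<^bsub>ring_on AA\<^esub> n \<in> {..N}. f n))" if a: "a \<in> carrier (ring_on AA)" for a
    proof -
      have fin: "(\<Oplus>\<^bsub>ring_on AA\<^esub> n \<in> {..N}. f n) = (\<Sum>n\<le>N. f n)" if "\<forall>n. f n \<in> graded n" for f N
        by (rule finsum_ring_on[OF subring_AA]) (use that NS_AA in auto)
      obtain f where f: "\<forall>n. f n \<in> graded n" "\<exists>N. (\<forall>n>N. f n = 0) \<and> a = (\<Sum>n\<le>N. f n)"
        using decomposition_exists[of a] a by auto
      show ?thesis
      proof (rule ex1I[of _ f])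
        show "(\<forall>n. f n \<in> graded n) \<and> (\<exists>N. (\<forall>n>N. f n = \<zero>\<^bsub>ring_on AA\<^esub>) \<and>
          a = (\<Oplus>\<^bsub>ring_on AA\<^esub> n \<in> {..N}. f n))" using f fin[of f] by simp
      next
        fix h assume "(\<forall>n. h n \<in> graded n) \<and> (\<exists>N. (\<forall>n>N. h n = \<zero>\<^bsub>ring_on AA\<^esub>) \<and>
          a = (\<Oplus>\<^bsub>ring_on AA\<^esub> n \<in> {..N}. h n))"
        then have h: "\<forall>n. h n \<in> graded n" "\<exists>N. (\<forall>n>N. h n = 0) \<and> a = (\<Sum>n\<le>N. h n)"
          using fin[of h] by auto
        have "h n - f n = 0" for n
        proof (rule NS_eq_0[of _ "\<lambda>_. True"])
          show "h n - f n \<in> AA" using NS_AA[OF h(1)[rule_format]] NS_AA[OF f(1)[rule_format]] by (rule NS_diff)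
          fix m assume "normal m"
          then show "cf (h n - f n) m = 0"
            using decomposition_cf[OF h(1)] decomposition_cf[OF f(1)] h(2) f(2) by (auto simp: cf_minus)
        qed
        then show "h = f" by (auto simp: fun_eq_iff)
      qed
    qed
    show "\<exists>S. finite S \<and> S \<subseteq> graded 1 \<and> carrier (ring_on AA) = generate_ring (ring_on AA) (range cst \<union> S)"
    proof (intro exI[of _ "val ` G"] conjI)
      show v: "val ` G \<subseteq> graded 1" using NS_ev[of "{#_#}" "\<lambda>m. size m = 1"] by auto
      have "range cst \<union> val ` G \<subseteq> carrier (ring_on AA)" using v Kc NS_AA by auto
      from A.generate_ring_incl[OF this]
      have 1: "generate_ring (ring_on AA) (range cst \<union> val ` G) \<subseteq> AA" by simp
      have ev: "ev m \<in> generate_ring (ring_on AA) (range cst \<union> val ` G)" if "set_mset m \<subseteq> G" for m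
        using that
      proof (induction m)
        case empty
        show ?case using generate_ring.one[of "ring_on AA"] by simp
      next
        case (add g m)
        then show ?case
          using generate_ring.eng_mult[OF generate_ring.incl, of "val g" _ "ev m" "ring_on AA"] by simp
      qed
      have 2: "a \<in> generate_ring (ring_on AA) (range cst \<union> val ` G)" if "a \<in> AA" for a
        using that
      proof (induction rule: NS_induct)
        case zero
        show ?case using A.zero_in_generate by simp
      next
        case (add c m b)
        have "cst c * ev m \<in> generate_ring (ring_on AA) (range cst \<union> val ` G)"
          using generate_ring.eng_mult[OF generate_ring.incl[of "cst c"] ev[of m]] add by (simp add: normal_def)
        from generate_ring.eng_add[OF this add.IH] show ?case by simp
      qed
      show "carrier (ring_on AA) = generate_ring (ring_on AA) (range cst \<union> val ` G)"
        using 1 2 by auto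
    qed (use finite_G in simp)
  qed
qed

lemma positive_part_AA: "positive_part (ring_on AA) graded = NS (\<lambda>m. 0 < size m)"
proof
  have fin: "(\<Oplus>\<^bsub>ring_on AA\<^esub> n \<in> {1..N}. f n) = (\<Sum>n=1..N. f n)" if "\<forall>n. f n \<in> graded n" for f N
    by (rule finsum_ring_on[OF subring_AA]) (use that NS_AA in auto)
  show "positive_part (ring_on AA) graded \<subseteq> NS (\<lambda>m. 0 < size m)"
  proof
    fix a assume "a \<in> positive_part (ring_on AA) graded"
    then obtain N f where f: "\<forall>n. f n \<in> graded n" "a = (\<Sum>n=1..N. f n)"
      using fin by (auto simp: positive_part_def)
    have "f n \<in> NS (\<lambda>m. 0 < size m)" if "n \<in> {1..N}" for n
      by (rule NS_mono[OF f(1)[rule_format, of n]]) (use that in auto)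
    then show "a \<in> NS (\<lambda>m. 0 < size m)" unfolding f(2) by (rule NS_sum)
  qed
  show "NS (\<lambda>m. 0 < size m) \<subseteq> positive_part (ring_on AA) graded"
  proof
    fix a assume a: "a \<in> NS (\<lambda>m. 0 < size m)"
    obtain f N where f: "\<forall>n. f n \<in> graded n" "\<forall>n>N. f n = 0" "a = (\<Sum>n\<le>N. f n)"
      using decomposition_exists[OF NS_AA[OF a]] by blast
    have "f 0 = 0"
    proof (rule NS_eq_0[OF f(1)[rule_format]])
      fix m assume m: "normal m"
      show "cf (f 0) m = 0"
        using decomposition_cf[OF f m, of 0] cf_NS_0[OF a m] by auto
    qed
    then have "a = (\<Sum>n=1..N. f n)"
      unfolding f(3) by (intro sum.mono_neutral_right) (auto simp: not_less_eq_eq)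
    then show "a \<in> positive_part (ring_on AA) graded"
      using fin[OF f(1)] f(1) unfolding positive_part_def by (intro CollectI exI[of _ N] exI[of _ f]) simp
  qed
qed

text \<open>
  A graded algebra with a basis of normal monomials for quadratic steps is Koszul: the matrices of
  linear forms constructed above are the differentials of a linear resolution of the residue field.
\<close>

theorem koszul_AA: "koszul (range cst) (ring_on AA) graded"
  unfolding koszul_def
proof
  show "standard_graded (range cst) (ring_on AA) graded" by (rule standard_graded_AA)
  let ?A = "ring_on AA"
  let ?M = "residue_module ?A graded"
  define P where "P = NS (\<lambda>m. 0 < size m)"
  have pp: "positive_part ?A graded = P" by (simp add: positive_part_AA P_def)
  interpret A: cring ?A by (rule cring_ring_on[OF subring_AA])
  interpret P: ideal P ?A
  proof (rule ideal_ring_on[OF subring_AA])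
    fix a x assume "a \<in> AA" "x \<in> P"
    then show "a * x \<in> P" unfolding P_def by (rule NS_mult) simp
  qed (use NS_AA NS_add in \<open>auto simp: P_def\<close>)
  have hom: "(+>\<^bsub>?A\<^esub>) P \<in> ring_hom ?A (?A Quot P)" by (rule P.rcos_ring_hom)
  have M: "carrier ?M = carrier (?A Quot P)" "\<zero>\<^bsub>?M\<^esub> = P"
    "X \<oplus>\<^bsub>?M\<^esub> Y = X \<oplus>\<^bsub>?A Quot P\<^esub> Y" "a \<odot>\<^bsub>?M\<^esub> X = (P +>\<^bsub>?A\<^esub> a) \<otimes>\<^bsub>?A Quot P\<^esub> X" for X Y a
    by (simp_all add: residue_module_def pp Let_def FactRing_def)
  have cQ: "carrier (?A Quot P) = (\<lambda>a. P +>\<^bsub>?A\<^esub> a) ` AA" by (auto simp: FactRing_def A_RCOSETS_def')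
  have const: "P +>\<^bsub>?A\<^esub> a = P \<longleftrightarrow> a \<in> P" if "a \<in> AA" for a
    using that P.rcos_const_imp_mem P.a_rcos_const[of a] A.a_rcos_zero by auto
  obtain b :: "nat \<Rightarrow> nat" and \<sigma> where b0: "b 0 = 1"
    and deg_HOL: "\<forall>i. \<forall>u<b (Suc i). \<forall>t<b i. \<sigma> i u t \<in> graded 1"
    and ex0_HOL: "\<forall>f :: nat \<Rightarrow> 'a. f 0 \<in> AA \<longrightarrow>
      (f 0 \<in> P \<longleftrightarrow> (\<exists>a. (\<forall>u<b 1. a u \<in> AA) \<and> f 0 = (\<Sum>u<b 1. a u * \<sigma> 0 u 0)))"
    and ex_HOL: "\<forall>i f. (\<forall>t<b (Suc i). f t \<in> AA) \<longrightarrow>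
        ((\<forall>t<b i. (\<Sum>u<b (Suc i). f u * \<sigma> i u t) = 0) \<longleftrightarrow>
         (\<exists>a. (\<forall>u<b (Suc (Suc i)). a u \<in> AA) \<and>
            (\<forall>t<b (Suc i). f t = (\<Sum>u<b (Suc (Suc i)). a u * \<sigma> (Suc i) u t))))"
    using resolution_exists unfolding P_def[symmetric] by (elim exE conjE)
  note deg = deg_HOL[rule_format] and ex = ex_HOL[THEN spec, THEN spec, THEN mp]
  define \<epsilon> where "\<epsilon> f = P +>\<^bsub>?A\<^esub> f 0" for f :: "nat \<Rightarrow> 'a"
  define d where "d i f = (\<lambda>t\<in>{..<b i}. \<Sum>u<b (Suc i). f u * \<sigma> i u t)" for i f
  have sum_AA: "(\<Sum>u<b (Suc i). f u * \<sigma> i u t) \<in> AA"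
    if "\<forall>u<b (Suc i). f u \<in> AA" "t < b i" for f i t
    using that by (intro NS_sum AA_mult NS_AA[OF deg]) auto
  have d_PiE: "d i f \<in> {..<b i} \<rightarrow>\<^sub>E AA" if "f \<in> {..<b (Suc i)} \<rightarrow>\<^sub>E AA" for f i
  proof -
    have "\<forall>u<b (Suc i). f u \<in> AA" using that by auto
    from sum_AA[OF this] show ?thesis by (auto simp: d_def)
  qed
  have d_hom: "d i \<in> graded_homs ?A (free_module ?A (b (Suc i))) (free_grading ?A graded (0 + Suc i) (b (Suc i)))
      (free_module ?A (b i)) (free_grading ?A graded (0 + i) (b i))" for i
    unfolding graded_homs_def module_homs_def
  proof (intro CollectI conjI ballI allI Pi_I image_subsetI)
    fix f assume "f \<in> carrier (free_module ?A (b (Suc i)))"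
    then show "d i f \<in> carrier (free_module ?A (b i))"
      using d_PiE by (simp add: free_module_def)
  next
    fix f h assume "f \<in> carrier (free_module ?A (b (Suc i)))" "h \<in> carrier (free_module ?A (b (Suc i)))"
    then show "d i (f \<oplus>\<^bsub>free_module ?A (b (Suc i))\<^esub> h) = d i f \<oplus>\<^bsub>free_module ?A (b i)\<^esub> d i h"
      by (auto simp: free_module_def d_def fun_eq_iff restrict_def distrib_right sum.distrib)
  next
    fix a f assume "a \<in> carrier ?A" "f \<in> carrier (free_module ?A (b (Suc i)))"
    then show "d i (a \<odot>\<^bsub>free_module ?A (b (Suc i))\<^esub> f) = a \<odot>\<^bsub>free_module ?A (b i)\<^esub> d i f"
      by (auto simp: free_module_def d_def fun_eq_iff restrict_def sum_distrib_left mult.assoc)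
  next
    fix n f assume f: "f \<in> free_grading ?A graded (0 + Suc i) (b (Suc i)) n"
    have "(\<Sum>u<b (Suc i). f u * \<sigma> i u t) \<in> (if i \<le> n then graded (n - i) else {0})" if t: "t < b i" for t
    proof (cases "Suc i \<le> n")
      case True
      then have "f u * \<sigma> i u t \<in> graded (n - i)" if "u < b (Suc i)" for u
      proof -
        have "f u \<in> graded (n - Suc i)" using f that True by (auto simp: free_grading_def)
        from graded_mult[OF this deg[OF that t]] True show ?thesis by (simp add: Suc_diff_Suc)
      qed
      then show ?thesis using True by (auto intro!: NS_sum)
    next
      case False
      then have "f u = 0" if "u < b (Suc i)" for u using f that by (auto simp: free_grading_def)
      then show ?thesis by simp
    qed
    then show "d i f \<in> free_grading ?A graded (0 + i) (b i) n"
      by (auto simp: free_grading_def d_def)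
  qed
  have eps_hom: "\<epsilon> \<in> graded_homs ?A (free_module ?A (b 0)) (free_grading ?A graded (0 + 0) (b 0))
      ?M (residue_grading ?A graded)"
    unfolding graded_homs_def module_homs_def
  proof (intro CollectI conjI ballI allI Pi_I image_subsetI)
    fix f assume "f \<in> carrier (free_module ?A (b 0))"
    then show "\<epsilon> f \<in> carrier ?M" by (auto simp: free_module_def \<epsilon>_def M cQ b0)
  next
    fix f h assume "f \<in> carrier (free_module ?A (b 0))" "h \<in> carrier (free_module ?A (b 0))"
    then have "f 0 \<in> AA" "h 0 \<in> AA" by (auto simp: free_module_def b0)
    then show "\<epsilon> (f \<oplus>\<^bsub>free_module ?A (b 0)\<^esub> h) = \<epsilon> f \<oplus>\<^bsub>?M\<^esub> \<epsilon> h"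
      using ring_hom_add[OF hom, of "f 0" "h 0"] by (simp add: free_module_def \<epsilon>_def M b0)
  next
    fix a f assume "a \<in> carrier ?A" "f \<in> carrier (free_module ?A (b 0))"
    then have "f 0 \<in> AA" "a \<in> AA" by (auto simp: free_module_def b0)
    then show "\<epsilon> (a \<odot>\<^bsub>free_module ?A (b 0)\<^esub> f) = a \<odot>\<^bsub>?M\<^esub> \<epsilon> f"
      using ring_hom_mult[OF hom, of a "f 0"] by (simp add: free_module_def \<epsilon>_def M b0)
  next
    fix n f assume "f \<in> free_grading ?A graded (0 + 0) (b 0) n"
    then have f: "f 0 \<in> graded n" by (auto simp: free_grading_def b0)
    show "\<epsilon> f \<in> residue_grading ?A graded n"
    proof (cases "n = 0")
      case True
      then show ?thesis using NS_AA[OF f] by (auto simp: residue_grading_def \<epsilon>_def M cQ)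
    next
      case False
      then have "f 0 \<in> P" unfolding P_def using f by (intro NS_mono[OF f]) auto
      then show ?thesis using False const[OF NS_AA[OF f]] by (simp add: residue_grading_def \<epsilon>_def M)
    qed
  qed
  have eps_surj: "\<epsilon> ` carrier (free_module ?A (b 0)) = carrier ?M"
  proof safe
    fix X assume "X \<in> carrier ?M"
    then obtain a where a: "a \<in> AA" "X = P +>\<^bsub>?A\<^esub> a" by (auto simp: M cQ)
    then have "X = \<epsilon> (\<lambda>t\<in>{..<b 0}. a)" by (simp add: \<epsilon>_def b0)
    then show "X \<in> \<epsilon> ` carrier (free_module ?A (b 0))" using a by (auto simp: free_module_def)
  next
    fix f assume "f \<in> carrier (free_module ?A (b 0))"
    then show "\<epsilon> f \<in> carrier ?M" using eps_hom by (auto simp: graded_homs_def module_homs_def)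
  qed
  have d_image: "d i ` carrier (free_module ?A (b (Suc i))) = {f \<in> {..<b i} \<rightarrow>\<^sub>E AA.
      \<exists>a. (\<forall>u<b (Suc i). a u \<in> AA) \<and> (\<forall>t<b i. f t = (\<Sum>u<b (Suc i). a u * \<sigma> i u t))}" for i
  proof (intro equalityI subsetI)
    fix f assume "f \<in> d i ` carrier (free_module ?A (b (Suc i)))"
    then obtain a where a: "a \<in> {..<b (Suc i)} \<rightarrow>\<^sub>E AA" "f = d i a" by (auto simp: free_module_def)
    then have "\<forall>u<b (Suc i). a u \<in> AA" "\<forall>t<b i. f t = (\<Sum>u<b (Suc i). a u * \<sigma> i u t)"
      by (auto simp: d_def)
    then show "f \<in> {f \<in> {..<b i} \<rightarrow>\<^sub>E AA.
      \<exists>a. (\<forall>u<b (Suc i). a u \<in> AA) \<and> (\<forall>t<b i. f t = (\<Sum>u<b (Suc i). a u * \<sigma> i u t))}"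
      using d_PiE[OF a(1)] a(2) by blast
  next
    fix f assume "f \<in> {f \<in> {..<b i} \<rightarrow>\<^sub>E AA.
      \<exists>a. (\<forall>u<b (Suc i). a u \<in> AA) \<and> (\<forall>t<b i. f t = (\<Sum>u<b (Suc i). a u * \<sigma> i u t))}"
    then obtain a where f: "f \<in> {..<b i} \<rightarrow>\<^sub>E AA" and a: "\<forall>u<b (Suc i). a u \<in> AA"
      "\<forall>t<b i. f t = (\<Sum>u<b (Suc i). a u * \<sigma> i u t)" by blast
    have r: "restrict a {..<b (Suc i)} \<in> {..<b (Suc i)} \<rightarrow>\<^sub>E AA"
      by (rule PiE_I) (use a(1) in simp_all)
    have "f = d i (restrict a {..<b (Suc i)})"
      by (rule PiE_ext[OF f d_PiE[OF r]]) (use a in \<open>auto simp: d_def\<close>)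
    then show "f \<in> d i ` carrier (free_module ?A (b (Suc i)))" using r by (simp add: free_module_def)
  qed
  have ex_0: "d 0 ` carrier (free_module ?A (b 1)) = a_kernel (free_module ?A (b 0)) ?M \<epsilon>"
  proof -
    have "\<epsilon> f = \<zero>\<^bsub>?M\<^esub> \<longleftrightarrow> (\<exists>a. (\<forall>u<b 1. a u \<in> AA) \<and> (\<forall>t<b 0. f t = (\<Sum>u<b 1. a u * \<sigma> 0 u t)))"
      if "f \<in> {..<b 0} \<rightarrow>\<^sub>E AA" for f
    proof -
      have f0: "f 0 \<in> AA" using that b0 by auto
      show ?thesis using const[OF f0] ex0_HOL[rule_format, of f] f0 by (simp add: \<epsilon>_def M b0)
    qed
    then show ?thesis using d_image[of 0] unfolding a_kernel_def' by (auto simp: free_module_def)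
  qed
  have ex_Suc: "d (Suc i) ` carrier (free_module ?A (b (Suc (Suc i)))) =
      a_kernel (free_module ?A (b (Suc i))) (free_module ?A (b i)) (d i)" for i
  proof -
    have "d i f = (\<lambda>t\<in>{..<b i}. 0) \<longleftrightarrow> (\<exists>a. (\<forall>u<b (Suc (Suc i)). a u \<in> AA) \<and>
        (\<forall>t<b (Suc i). f t = (\<Sum>u<b (Suc (Suc i)). a u * \<sigma> (Suc i) u t)))"
      if f: "f \<in> {..<b (Suc i)} \<rightarrow>\<^sub>E AA" for f
    proof -
      have "d i f = (\<lambda>t\<in>{..<b i}. 0) \<longleftrightarrow> (\<forall>t<b i. (\<Sum>u<b (Suc i). f u * \<sigma> i u t) = 0)"
        by (auto simp: d_def fun_eq_iff restrict_def)
      then show ?thesis using ex[of i f] f by auto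
    qed
    then have "{f \<in> {..<b (Suc i)} \<rightarrow>\<^sub>E AA. d i f = (\<lambda>t\<in>{..<b i}. 0)} =
        d (Suc i) ` carrier (free_module ?A (b (Suc (Suc i))))" unfolding d_image by blast
    then show ?thesis unfolding a_kernel_def' by (simp add: free_module_def)
  qed
  show "has_linear_resolution ?A graded 0 ?M (residue_grading ?A graded)"
    unfolding has_linear_resolution_def Let_def
    by (intro exI[of _ b] exI[of _ \<epsilon>] exI[of _ d] conjI allI) (fact eps_hom d_hom eps_surj ex_0[unfolded One_nat_def] ex_0 ex_Suc)+
qed

end

section \<open>Factorizations over a Ferrers diagram\<close>

lemma ferrers_finite: "ferrers_diagram D \<Longrightarrow> finite D"
  by (simp add: ferrers_diagram_def)

lemma ferrers_pos: "ferrers_diagram D \<Longrightarrow> (i, j, k) \<in> D \<Longrightarrow> 1 \<le> i \<and> 1 \<le> j \<and> 1 \<le> k"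
  by (fastforce simp: ferrers_diagram_def)

lemma ferrers_down:
  assumes "ferrers_diagram D" "(i, j, k) \<in> D" "1 \<le> i'" "i' \<le> i" "1 \<le> j'" "j' \<le> j" "1 \<le> k'" "k' \<le> k"
  shows "(i', j', k') \<in> D"
proof -
  have "\<forall>(i\<^sub>0, j\<^sub>0, k\<^sub>0) \<in> D. \<forall>i j k. 1 \<le> i \<and> i \<le> i\<^sub>0 \<and> 1 \<le> j \<and> j \<le> j\<^sub>0 \<and> 1 \<le> k \<and> k \<le> k\<^sub>0
        \<longrightarrow> (i, j, k) \<in> D" using assms(1) by (simp add: ferrers_diagram_def)
  from bspec[OF this assms(2)] show ?thesis using assms by simp
qed

lemma ferrers_fst:
  assumes F: "ferrers_diagram D" shows "fst ` D = {1..card (fst ` D)}"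
proof -
  define M where "M = Max (fst ` D)"
  have fin: "finite (fst ` D)" "fst ` D \<noteq> {}" using F by (auto simp: ferrers_diagram_def)
  have "M \<in> fst ` D" unfolding M_def using fin by (rule Max_in)
  then obtain j k where M: "(M, j, k) \<in> D" by auto
  have "fst ` D = {1..M}"
  proof (intro equalityI subsetI)
    fix i assume i: "i \<in> fst ` D"
    then obtain j k where "(i, j, k) \<in> D" by auto
    then show "i \<in> {1..M}" using ferrers_pos[OF F] Max_ge[OF fin(1) i] by (auto simp: M_def)
  next
    fix i assume "i \<in> {1..M}"
    then have "(i, j, k) \<in> D" using ferrers_down[OF F M, of i j k] ferrers_pos[OF F M] by simp
    then show "i \<in> fst ` D" by (metis fst_conv imageI)
  qed
  then show ?thesis by simp
qed

text \<open>
  The form in which the projection property is used: the box spanned by a layer of the diagram lies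
  in every earlier layer.  The property itself gives this for the preceding layer only; the diagram
  is closed downwards in the first coordinate.
\<close>

lemma projection_box:
  assumes F: "ferrers_diagram D" and P: "projection_property D"
    and "(i', j, k0) \<in> D" "(i', j0, k) \<in> D" "1 \<le> i" "i < i'"
  shows "(i, j, k) \<in> D"
proof -
  have pos: "1 \<le> j" "1 \<le> k0" "1 \<le> j0" "1 \<le> k" using assms ferrers_pos[OF F] by blast+
  have a: "(i', j, 1) \<in> D" "(i', 1, k) \<in> D"
    using ferrers_down[OF F assms(3)] ferrers_down[OF F assms(4)] assms(5,6) pos by simp_all
  have fin: "finite {j. (i', j, 1) \<in> D}" "finite {k. (i', 1, k) \<in> D}"
  proof -
    have "{j. (i', j, 1) \<in> D} \<subseteq> (\<lambda>(i, j, k). j) ` D" "{k. (i', 1, k) \<in> D} \<subseteq> (\<lambda>(i, j, k). k) ` D"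
      by force+
    then show "finite {j. (i', j, 1) \<in> D}" "finite {k. (i', 1, k) \<in> D}"
      using ferrers_finite[OF F] finite_surj by blast+
  qed
  have "i' \<in> fst ` D" using a(1) by (metis fst_conv imageI)
  then have "i' \<le> card (fst ` D)" using ferrers_fst[OF F] by (metis atLeastAtMost_iff)
  then have "(i' - 1, Max {j. (i', j, 1) \<in> D}, Max {k. (i', 1, k) \<in> D}) \<in> D"
    using P assms(5,6) by (simp add: projection_property_def)
  then show ?thesis
    by (rule ferrers_down[OF F]) (use assms pos a fin in \<open>auto intro: Max_ge\<close>)
qed

text \<open>
  No two points of \<open>p\<close> can be exchanged: a later layer cannot pass on a larger second or third
  coordinate to an earlier layer, and two points of one layer that form an antichain cannot be
  replaced by a chain, because the required corner is missing from \<open>D\<close>.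
\<close>

definition reduced :: "(nat \<times> nat \<times> nat) set \<Rightarrow> (nat \<times> nat \<times> nat) multiset \<Rightarrow> bool" where
  "reduced D p \<longleftrightarrow> (\<forall>i j k i' j' k'. (i, j, k) \<in># p \<longrightarrow> (i', j', k') \<in># p \<longrightarrow>
     (i < i' \<longrightarrow> j < j' \<longrightarrow> (i, j', k) \<notin> D) \<and>
     (i < i' \<longrightarrow> k < k' \<longrightarrow> (i, j, k') \<notin> D) \<and>
     (i = i' \<longrightarrow> j' < j \<longrightarrow> k < k' \<longrightarrow> (i, j, k') \<notin> D))"

lemma reducedD:
  assumes "reduced D p" "(i, j, k) \<in># p" "(i', j', k') \<in># p"
  shows "i < i' \<Longrightarrow> j < j' \<Longrightarrow> (i, j', k) \<notin> D"
    "i < i' \<Longrightarrow> k < k' \<Longrightarrow> (i, j, k') \<notin> D"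
    "i = i' \<Longrightarrow> j' < j \<Longrightarrow> k < k' \<Longrightarrow> (i, j, k') \<notin> D"
  using assms unfolding reduced_def by blast+

definition snd3 :: "nat \<times> nat \<times> nat \<Rightarrow> nat" where "snd3 d = fst (snd d)"
definition thd3 :: "nat \<times> nat \<times> nat \<Rightarrow> nat" where "thd3 d = snd (snd d)"

lemma coordinate_multisets_D:
  assumes "image_mset \<pi> p = image_mset \<pi> q" "x \<in># q"
  shows "\<exists>y. y \<in># p \<and> \<pi> y = \<pi> x"
proof -
  have "\<pi> x \<in># image_mset \<pi> p" using assms by simp
  then show ?thesis by auto
qed

text \<open>
  Let \<open>p\<close> and \<open>q\<close> be factorizations of the same monomial, and suppose that \<open>q\<close> uses in its first
  layer \<open>i0\<close> a second coordinate \<open>j1\<close> larger than all those of \<open>p\<close>.  In \<open>p\<close> this \<open>j1\<close> sits in a later layer,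
  and since no exchange is possible, \<open>(i0, j1, k)\<close> is missing for every third coordinate \<open>k\<close> that \<open>p\<close> uses in
  layer \<open>i0\<close>.  By \<open>projection_box\<close> such \<open>k\<close> occur in none of the later layers that are used.  So all of them are
  used in layer \<open>i0\<close> of \<open>q\<close> too, and by counting nothing else is; but \<open>q\<close> uses \<open>k1\<close> there, and
  \<open>(i0, j1, k1)\<close> is present.
\<close>

lemma first_layer_second_coordinate:
  assumes F: "ferrers_diagram D" and P: "projection_property D"
    and D: "set_mset p \<subseteq> D" "set_mset q \<subseteq> D" and red: "reduced D p"
    and X: "image_mset fst p = image_mset fst q" and Y: "image_mset snd3 p = image_mset snd3 q"
    and Z: "image_mset thd3 p = image_mset thd3 q"
    and i0: "\<And>d. d \<in># p \<Longrightarrow> i0 \<le> fst d" and q: "(i0, j1, k1) \<in># q"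
    and less: "\<And>j k. (i0, j, k) \<in># p \<Longrightarrow> j < j1"
  shows False
proof -
  obtain i' k' where d': "(i', j1, k') \<in># p"
    using coordinate_multisets_D[OF Y q] by (auto simp: snd3_def)
  then have i': "i0 < i'" using i0[OF d'] less[of j1 k'] by (cases "i' = i0") auto
  \<comment> \<open>the second layer that is used\<close>
  define i1 where "i1 = Min {i \<in> fst ` set_mset p. i0 < i}"
  have ne: "i' \<in> {i \<in> fst ` set_mset p. i0 < i}" using d' i' by force
  have i1: "i1 \<in> {i \<in> fst ` set_mset p. i0 < i}" unfolding i1_def by (rule Min_in) (use ne in auto)
  have i1_le: "i1 \<le> fst d" if "d \<in># p" "i0 < fst d" for d
    unfolding i1_def by (rule Min_le) (use that in auto)
  have i01: "1 \<le> i0" "i0 < i1" "i1 \<le> i'" using ferrers_pos[OF F, of i0 j1 k1] q D i1 i1_le[OF d'] i' by auto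
  have d'D: "(i', j1, k') \<in> D" using d' D by auto
  have j1: "(i1, j1, 1) \<in> D"
    using ferrers_down[OF F d'D, of i1 j1 1] ferrers_pos[OF F d'D] i01 by simp
  have notD: "(i0, j1, k) \<notin> D" if "(i0, j, k) \<in># p" for j k
    using reducedD(1)[OF red that d' i'] less[OF that] by simp
  \<comment> \<open>the third coordinates of the first layer of p are too large for any later layer\<close>
  have only: "i = i0" if p: "(i0, j, k) \<in># p" and qq: "(i, j', k) \<in># q" for i j j' k
  proof (rule ccontr)
    assume "i \<noteq> i0"
    obtain y where y: "y \<in># p" "fst y = i" using coordinate_multisets_D[OF X qq] by auto
    then have "i1 \<le> i" using i0[of y] i1_le[of y] \<open>i \<noteq> i0\<close> by auto
    have iD: "(i, j', k) \<in> D" using qq D by auto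
    have "(i1, j', k) \<in> D" using ferrers_down[OF F iD] ferrers_pos[OF F iD] \<open>i1 \<le> i\<close> i01 by simp
    from projection_box[OF F P j1 this i01(1,2)] show False using notD[OF p] by simp
  qed
  define p0 q0 where "p0 = filter_mset (\<lambda>d. fst d = i0) p" and "q0 = filter_mset (\<lambda>d. fst d = i0) q"
  have cnt: "size (filter_mset (\<lambda>d. \<pi> d = v) r) = count (image_mset \<pi> r) v" for \<pi> :: "_ \<Rightarrow> nat" and r v
    by (induction r) auto
  have size: "size p0 = size q0" unfolding p0_def q0_def cnt X ..
  have "image_mset thd3 p0 \<subseteq># image_mset thd3 q0"
  proof (rule mset_subset_eqI)
    fix k
    show "count (image_mset thd3 p0) k \<le> count (image_mset thd3 q0) k"
    proof (cases "k \<in># image_mset thd3 p0")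
      case True
      then obtain j where j: "(i0, j, k) \<in># p" by (force simp: p0_def thd3_def)
      have "filter_mset (\<lambda>d. thd3 d = k) q = filter_mset (\<lambda>d. thd3 d = k) q0"
        unfolding q0_def filter_filter_mset
        by (rule filter_mset_cong0) (use only[OF j] in \<open>auto simp: thd3_def\<close>)
      then have "count (image_mset thd3 q) k = count (image_mset thd3 q0) k" by (simp flip: cnt)
      moreover have "count (image_mset thd3 p0) k \<le> count (image_mset thd3 p) k"
        unfolding p0_def by (intro mset_subset_eq_count image_mset_subseteq_mono) simp
      ultimately show ?thesis by (simp add: Z)
    next
      case False
      then have "count (image_mset thd3 p0) k = 0" by (simp only: not_in_iff)
      then show ?thesis by simp
    qed
  qed
  then have "image_mset thd3 p0 = image_mset thd3 q0"
    using size by (metis mset_subset_size size_image_mset subset_mset.le_less less_irrefl)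
  moreover have "k1 \<in># image_mset thd3 q0" using q by (force simp: q0_def thd3_def)
  ultimately have "k1 \<in># image_mset thd3 p0" by simp
  then obtain d where "d \<in># p0" "thd3 d = k1" by auto
  then have "(i0, snd3 d, k1) \<in># p" by (cases d) (auto simp: p0_def thd3_def snd3_def)
  then show False using notD q D by auto
qed

text \<open>
  The point of \<open>p\<close> that carries \<open>k1\<close> can be exchanged with \<open>(i0, j1, k)\<close>, since \<open>(i0, j1, k1)\<close> belongs
  to the diagram.
\<close>

lemma first_layer_third_coordinate:
  assumes D: "set_mset q \<subseteq> D" and red: "reduced D p"
    and Z: "image_mset thd3 p = image_mset thd3 q"
    and i0: "\<And>d. d \<in># p \<Longrightarrow> i0 \<le> fst d" and q: "(i0, j1, k1) \<in># q" and p: "(i0, j1, k) \<in># p"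
    and j1: "\<And>j k. (i0, j, k) \<in># p \<Longrightarrow> j \<le> j1"
    and less: "\<And>k. (i0, j1, k) \<in># p \<Longrightarrow> k < k1"
  shows False
proof -
  obtain i' j' where d': "(i', j', k1) \<in># p"
    using coordinate_multisets_D[OF Z q] by (auto simp: thd3_def)
  have "(i0, j1, k1) \<in> D" using q D by auto
  moreover have "i0 \<le> i'" using i0[OF d'] by simp
  moreover have "i' = i0 \<Longrightarrow> j' < j1" using j1[of j' k1] less[of k1] d' by (cases "j' = j1") auto
  ultimately show False using reducedD(2,3)[OF red p d'] less[OF p] by (cases "i' = i0") auto
qed

text \<open>
  Reduced factorizations are greedy: among the points used, the one with the smallest first, then
  largest second, then largest third coordinate depends only on the coordinate multisets.
\<close>

lemma common_point:
  assumes F: "ferrers_diagram D" and P: "projection_property D"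
    and D: "set_mset p \<subseteq> D" "set_mset q \<subseteq> D" and red: "reduced D p" "reduced D q"
    and X: "image_mset fst p = image_mset fst q" and Y: "image_mset snd3 p = image_mset snd3 q"
    and Z: "image_mset thd3 p = image_mset thd3 q" and "p \<noteq> {#}"
  shows "\<exists>d. d \<in># p \<and> d \<in># q"
proof -
  define i0 where "i0 = Min (fst ` set_mset p)"
  have fst_eq: "fst ` set_mset p = fst ` set_mset q" using X by (metis set_image_mset)
  have i0p: "i0 \<le> fst d" if "d \<in># p" for d unfolding i0_def by (rule Min_le) (use that in auto)
  have i0q: "i0 \<le> fst d" if "d \<in># q" for d
    unfolding i0_def fst_eq by (rule Min_le) (use that in auto)
  have "i0 \<in> fst ` set_mset p" unfolding i0_def by (rule Min_in) (use \<open>p \<noteq> {#}\<close> in auto)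
  then have ne: "{j. \<exists>k. (i0, j, k) \<in># p} \<noteq> {}" "{j. \<exists>k. (i0, j, k) \<in># q} \<noteq> {}"
    using fst_eq by force+
  have fin: "finite {j. \<exists>k. (i0, j, k) \<in># r}" "finite {k. (i0, j, k) \<in># r}"
    for j :: nat and r :: "(nat \<times> nat \<times> nat) multiset"
  proof -
    have "{j. \<exists>k. (i0, j, k) \<in># r} \<subseteq> snd3 ` set_mset r" "{k. (i0, j, k) \<in># r} \<subseteq> thd3 ` set_mset r"
      by (force simp: snd3_def thd3_def)+
    then show "finite {j. \<exists>k. (i0, j, k) \<in># r}" "finite {k. (i0, j, k) \<in># r}"
      using finite_surj by blast+
  qed
  define jp jq where "jp = Max {j. \<exists>k. (i0, j, k) \<in># p}" and "jq = Max {j. \<exists>k. (i0, j, k) \<in># q}"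
  have jp: "\<exists>k. (i0, jp, k) \<in># p" "\<And>j k. (i0, j, k) \<in># p \<Longrightarrow> j \<le> jp"
    using Max_in[OF fin(1) ne(1)] Max_ge[OF fin(1), of _ p] by (auto simp: jp_def)
  have jq: "\<exists>k. (i0, jq, k) \<in># q" "\<And>j k. (i0, j, k) \<in># q \<Longrightarrow> j \<le> jq"
    using Max_in[OF fin(1) ne(2)] Max_ge[OF fin(1), of _ q] by (auto simp: jq_def)
  have "jp = jq"
  proof (rule ccontr)
    assume "jp \<noteq> jq"
    then consider "jp < jq" | "jq < jp" by linarith
    then show False
    proof cases
      case 1
      obtain k where "(i0, jq, k) \<in># q" using jq by blast
      from first_layer_second_coordinate[OF F P D red(1) X Y Z i0p this] show False
        using jp(2) 1 by fastforce
    next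
      case 2
      obtain k where "(i0, jp, k) \<in># p" using jp by blast
      from first_layer_second_coordinate[OF F P D(2,1) red(2) X[symmetric] Y[symmetric] Z[symmetric] i0q this]
      show False using jq(2) 2 by fastforce
    qed
  qed
  define kp kq where "kp = Max {k. (i0, jp, k) \<in># p}" and "kq = Max {k. (i0, jp, k) \<in># q}"
  have kp: "(i0, jp, kp) \<in># p" "\<And>k. (i0, jp, k) \<in># p \<Longrightarrow> k \<le> kp"
    using Max_in[OF fin(2), of jp p] Max_ge[OF fin(2), of _ jp p] jp(1) by (auto simp: kp_def)
  have kq: "(i0, jp, kq) \<in># q" "\<And>k. (i0, jp, k) \<in># q \<Longrightarrow> k \<le> kq"
    using Max_in[OF fin(2), of jp q] Max_ge[OF fin(2), of _ jp q] jq(1) \<open>jp = jq\<close> by (auto simp: kq_def)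
  have "kp = kq"
  proof (rule ccontr)
    assume "kp \<noteq> kq"
    then consider "kp < kq" | "kq < kp" by linarith
    then show False
    proof cases
      case 1
      show False
        by (rule first_layer_third_coordinate[OF D(2) red(1) Z i0p kq(1) kp(1) jp(2)])
          (use kp(2) 1 in fastforce)+
    next
      case 2
      show False
        by (rule first_layer_third_coordinate[OF D(1) red(2) Z[symmetric] i0q kp(1) kq(1) jq(2)[folded \<open>jp = jq\<close>]])
          (use kq(2) 2 in fastforce)+
    qed
  qed
  then show ?thesis using kp kq by blast
qed

section \<open>Exchange steps for the Rees algebra\<close>

lemma Max_coordinate:
  fixes S :: "nat set"
  assumes "finite S" "\<And>i. i \<in> S \<Longrightarrow> 1 \<le> i" "\<And>i i'. i \<in> S \<Longrightarrow> 1 \<le> i' \<Longrightarrow> i' \<le> i \<Longrightarrow> i' \<in> S" "S \<noteq> {}"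
  shows "{1..Max S} = S"
proof (intro equalityI subsetI)
  fix i assume "i \<in> {1..Max S}"
  then show "i \<in> S" by (intro assms(3)[OF Max_in[OF assms(1,4)]]) simp_all
next
  fix i assume "i \<in> S"
  then show "i \<in> {1..Max S}" using assms(2)[of i] Max_ge[OF assms(1), of i] by simp
qed

lemma ferrers_vars_iff:
  assumes F: "ferrers_diagram D"
  shows "Xvar i \<in> ferrers_vars D \<longleftrightarrow> (\<exists>j k. (i, j, k) \<in> D)"
    "Yvar j \<in> ferrers_vars D \<longleftrightarrow> (\<exists>i k. (i, j, k) \<in> D)"
    "Zvar k \<in> ferrers_vars D \<longleftrightarrow> (\<exists>i j. (i, j, k) \<in> D)"
proof -
  have fin: "finite {i. \<exists>j k. (i, j, k) \<in> D}" "finite {j. \<exists>i k. (i, j, k) \<in> D}"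
    "finite {k. \<exists>i j. (i, j, k) \<in> D}"
  proof -
    have "{i. \<exists>j k. (i, j, k) \<in> D} \<subseteq> fst ` D" "{j. \<exists>i k. (i, j, k) \<in> D} \<subseteq> snd3 ` D"
      "{k. \<exists>i j. (i, j, k) \<in> D} \<subseteq> thd3 ` D" by (force simp: snd3_def thd3_def)+
    then show "finite {i. \<exists>j k. (i, j, k) \<in> D}" "finite {j. \<exists>i k. (i, j, k) \<in> D}"
      "finite {k. \<exists>i j. (i, j, k) \<in> D}"
      using ferrers_finite[OF F] finite_surj by blast+
  qed
  have ne: "D \<noteq> {}" using F by (simp add: ferrers_diagram_def)
  have pos: "1 \<le> i \<and> 1 \<le> j \<and> 1 \<le> k" if "(i, j, k) \<in> D" for i j k using ferrers_pos[OF F that] .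
  have 1: "{1..Max {i. \<exists>j k. (i, j, k) \<in> D}} = {i. \<exists>j k. (i, j, k) \<in> D}"
  proof (rule Max_coordinate[OF fin(1)])
    fix i i' assume "i \<in> {i. \<exists>j k. (i, j, k) \<in> D}" "1 \<le> i'" "i' \<le> i"
    then obtain j k where "(i, j, k) \<in> D" by blast
    then show "i' \<in> {i. \<exists>j k. (i, j, k) \<in> D}"
      using ferrers_down[OF F, of i j k i' j k] pos[of i j k] \<open>1 \<le> i'\<close> \<open>i' \<le> i\<close> by auto
  qed (use pos ne in auto)
  have 2: "{1..Max {j. \<exists>i k. (i, j, k) \<in> D}} = {j. \<exists>i k. (i, j, k) \<in> D}"
  proof (rule Max_coordinate[OF fin(2)])
    fix j j' assume "j \<in> {j. \<exists>i k. (i, j, k) \<in> D}" "1 \<le> j'" "j' \<le> j"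
    then obtain i k where "(i, j, k) \<in> D" by blast
    then show "j' \<in> {j. \<exists>i k. (i, j, k) \<in> D}"
      using ferrers_down[OF F, of i j k i j' k] pos[of i j k] \<open>1 \<le> j'\<close> \<open>j' \<le> j\<close> by auto
  qed (use pos ne in auto)
  have 3: "{1..Max {k. \<exists>i j. (i, j, k) \<in> D}} = {k. \<exists>i j. (i, j, k) \<in> D}"
  proof (rule Max_coordinate[OF fin(3)])
    fix k k' assume "k \<in> {k. \<exists>i j. (i, j, k) \<in> D}" "1 \<le> k'" "k' \<le> k"
    then obtain i j where "(i, j, k) \<in> D" by blast
    then show "k' \<in> {k. \<exists>i j. (i, j, k) \<in> D}"
      using ferrers_down[OF F, of i j k i j k'] pos[of i j k] \<open>1 \<le> k'\<close> \<open>k' \<le> k\<close> by auto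
  qed (use pos ne in auto)
  have im: "Xvar i \<in> Xvar ` S \<longleftrightarrow> i \<in> S" "Xvar i \<in> Yvar ` S \<longleftrightarrow> False" "Xvar i \<in> Zvar ` S \<longleftrightarrow> False"
    "Yvar i \<in> Xvar ` S \<longleftrightarrow> False" "Yvar i \<in> Yvar ` S \<longleftrightarrow> i \<in> S" "Yvar i \<in> Zvar ` S \<longleftrightarrow> False"
    "Zvar i \<in> Xvar ` S \<longleftrightarrow> False" "Zvar i \<in> Yvar ` S \<longleftrightarrow> False" "Zvar i \<in> Zvar ` S \<longleftrightarrow> i \<in> S" for i S
    by auto
  show "Xvar i \<in> ferrers_vars D \<longleftrightarrow> (\<exists>j k. (i, j, k) \<in> D)"
    "Yvar j \<in> ferrers_vars D \<longleftrightarrow> (\<exists>i k. (i, j, k) \<in> D)"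
    "Zvar k \<in> ferrers_vars D \<longleftrightarrow> (\<exists>i j. (i, j, k) \<in> D)"
    unfolding ferrers_vars_def 1 2 3 by (simp_all only: Un_iff im mem_Collect_eq HOL.simp_thms)
qed

type_synonym rees_gen = "xyz + nat \<times> nat \<times> nat"

definition rees_gens :: "(nat \<times> nat \<times> nat) set \<Rightarrow> rees_gen set" where
  "rees_gens D = Inl ` ferrers_vars D \<union> Inr ` D"

lemma rees_gens_iff [simp]: "Inl v \<in> rees_gens D \<longleftrightarrow> v \<in> ferrers_vars D" "Inr d \<in> rees_gens D \<longleftrightarrow> d \<in> D"
  by (auto simp: rees_gens_def)

text \<open>
  The quadratic relations of the Rees algebra, oriented.  The first three are relations among the
  variables \<open>T\<close>: large second and third coordinates move to earlier layers, and within a layer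
  antichains become chains.  The last three are linear in the \<open>T\<close>: a variable of the polynomial ring
  is exchanged for a larger one, so that the \<open>T\<close>-part of a normal monomial uses the smallest
  coordinates available.
\<close>

inductive ferrers_step :: "(nat \<times> nat \<times> nat) set \<Rightarrow> rees_gen multiset \<Rightarrow> rees_gen multiset \<Rightarrow> bool"
  for D where
  swap_second: "(i, j, k) \<in> D \<Longrightarrow> (i', j', k') \<in> D \<Longrightarrow> i < i' \<Longrightarrow> j < j' \<Longrightarrow> (i, j', k) \<in> D \<Longrightarrow>
    ferrers_step D {#Inr (i, j, k), Inr (i', j', k')#} {#Inr (i, j', k), Inr (i', j, k')#}"
| swap_third: "(i, j, k) \<in> D \<Longrightarrow> (i', j', k') \<in> D \<Longrightarrow> i < i' \<Longrightarrow> k < k' \<Longrightarrow> (i, j, k') \<in> D \<Longrightarrow>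
    ferrers_step D {#Inr (i, j, k), Inr (i', j', k')#} {#Inr (i, j, k'), Inr (i', j', k)#}"
| straighten: "(i, j, k) \<in> D \<Longrightarrow> (i, j', k') \<in> D \<Longrightarrow> j' < j \<Longrightarrow> k < k' \<Longrightarrow> (i, j, k') \<in> D \<Longrightarrow>
    ferrers_step D {#Inr (i, j, k), Inr (i, j', k')#} {#Inr (i, j, k'), Inr (i, j', k)#}"
| move_first: "Xvar a \<in> ferrers_vars D \<Longrightarrow> (i, j, k) \<in> D \<Longrightarrow> a < i \<Longrightarrow>
    ferrers_step D {#Inl (Xvar a), Inr (i, j, k)#} {#Inl (Xvar i), Inr (a, j, k)#}"
| move_second: "Yvar a \<in> ferrers_vars D \<Longrightarrow> (i, j, k) \<in> D \<Longrightarrow> a < j \<Longrightarrow>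
    ferrers_step D {#Inl (Yvar a), Inr (i, j, k)#} {#Inl (Yvar j), Inr (i, a, k)#}"
| move_third: "Zvar a \<in> ferrers_vars D \<Longrightarrow> (i, j, k) \<in> D \<Longrightarrow> a < k \<Longrightarrow>
    ferrers_step D {#Inl (Zvar a), Inr (i, j, k)#} {#Inl (Zvar k), Inr (i, j, a)#}"

definition coordinate_bound :: "(nat \<times> nat \<times> nat) set \<Rightarrow> nat" where
  "coordinate_bound D = Suc (\<Sum>d\<in>D. snd3 d + thd3 d)"

text \<open>
  The first summand decreases when larger coordinates move to earlier layers, or smaller ones
  into \<open>T\<close>.  The second accounts for straightening within a layer; up to a term linear in the second
  coordinate it is \<open>- j * k\<close>.  The coefficient of the first summand is large enough to dominate it.
\<close>

definition ferrers_weight :: "(nat \<times> nat \<times> nat) set \<Rightarrow> rees_gen \<Rightarrow> nat" where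
  "ferrers_weight D g = (case g of Inl v \<Rightarrow> 0 | Inr (i, j, k) \<Rightarrow>
     coordinate_bound D * i * (j + k) + j * (coordinate_bound D - k))"

lemma coordinate_bound:
  assumes "finite D" "(i, j, k) \<in> D"
  shows "j < coordinate_bound D" "k < coordinate_bound D"
  using member_le_sum[of "(i, j, k)" D "\<lambda>d. snd3 d + thd3 d"] assms
  by (simp_all add: coordinate_bound_def snd3_def thd3_def)

locale ferrers_projection =
  fixes D :: "(nat \<times> nat \<times> nat) set"
  assumes F: "ferrers_diagram D" and P: "projection_property D"
begin

lemma vars_pos: "Xvar a \<in> ferrers_vars D \<Longrightarrow> 1 \<le> a" "Yvar a \<in> ferrers_vars D \<Longrightarrow> 1 \<le> a"
    "Zvar a \<in> ferrers_vars D \<Longrightarrow> 1 \<le> a"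
  using ferrers_pos[OF F] by (auto simp: ferrers_vars_iff[OF F])

lemma down1: "(i, j, k) \<in> D \<Longrightarrow> 1 \<le> a \<Longrightarrow> a \<le> i \<Longrightarrow> (a, j, k) \<in> D"
  using ferrers_down[OF F, of i j k a j k] ferrers_pos[OF F, of i j k] by simp

lemma down2: "(i, j, k) \<in> D \<Longrightarrow> 1 \<le> a \<Longrightarrow> a \<le> j \<Longrightarrow> (i, a, k) \<in> D"
  using ferrers_down[OF F, of i j k i a k] ferrers_pos[OF F, of i j k] by simp

lemma down3: "(i, j, k) \<in> D \<Longrightarrow> 1 \<le> a \<Longrightarrow> a \<le> k \<Longrightarrow> (i, j, a) \<in> D"
  using ferrers_down[OF F, of i j k i j a] ferrers_pos[OF F, of i j k] by simp

lemma vars_of_point: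
  "(i, j, k) \<in> D \<Longrightarrow> Xvar i \<in> ferrers_vars D \<and> Yvar j \<in> ferrers_vars D \<and> Zvar k \<in> ferrers_vars D"
  unfolding ferrers_vars_iff[OF F] by blast

lemma step_in_gens:
  assumes "ferrers_step D p q"
  shows "set_mset p \<subseteq> rees_gens D \<and> set_mset q \<subseteq> rees_gens D"
  using assms
proof cases
  case (swap_second i j k i' j' k')
  then show ?thesis using down2[of i' j' k' j] ferrers_pos[OF F, of i j k] by auto
next
  case (swap_third i j k i' j' k')
  then show ?thesis using down3[of i' j' k' k] ferrers_pos[OF F, of i j k] by auto
next
  case (straighten i j k j' k')
  then show ?thesis using down3[of i j' k' k] ferrers_pos[OF F, of i j k] by auto
next
  case (move_first a i j k)
  then show ?thesis using down1[of i j k a] vars_pos vars_of_point[of i j k] by auto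
next
  case (move_second a i j k)
  then show ?thesis using down2[of i j k a] vars_pos vars_of_point[of i j k] by auto
next
  case (move_third a i j k)
  then show ?thesis using down3[of i j k a] vars_pos vars_of_point[of i j k] by auto
qed

lemma int_weight:
  "(i, j, k) \<in> D \<Longrightarrow> int (ferrers_weight D (Inr (i, j, k))) =
     int (coordinate_bound D) * int i * (int j + int k) + int j * (int (coordinate_bound D) - int k)"
  using coordinate_bound(2)[OF ferrers_finite[OF F], of i j k]
  by (simp add: ferrers_weight_def of_nat_diff)

text \<open>
  In each case the difference of the weights factors; the steps below give the positive factors.
\<close>

lemma step_decreases:
  assumes "ferrers_step D p q"
  shows "(\<Sum>g\<in>#q. ferrers_weight D g) < (\<Sum>g\<in>#p. ferrers_weight D g)"
proof -
  have G: "d \<in> D" if "Inr d \<in># p \<or> Inr d \<in># q" for d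
    using step_in_gens[OF assms] that by auto
  define C where "C = int (coordinate_bound D)"
  have W: "int (ferrers_weight D (Inr (i, j, k))) = C * int i * (int j + int k) + int j * (C - int k)"
    if "Inr (i, j, k) \<in># p \<or> Inr (i, j, k) \<in># q" for i j k
    using int_weight[OF G[OF that]] by (simp add: C_def)
  have C: "int j < C" "int k < C" if "Inr (i, j, k) \<in># p \<or> Inr (i, j, k) \<in># q" for i j k
    using coordinate_bound[OF ferrers_finite[OF F] G[OF that]] by (simp_all add: C_def)
  have W0: "ferrers_weight D (Inl v) = 0" for v by (simp add: ferrers_weight_def)
  have pos: "1 \<le> i \<and> 1 \<le> j \<and> 1 \<le> k" if "Inr (i, j, k) \<in># p \<or> Inr (i, j, k) \<in># q" for i j k
    using ferrers_pos[OF F G[OF that]] .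
  have "0 < int (\<Sum>g\<in>#p. ferrers_weight D g) - int (\<Sum>g\<in>#q. ferrers_weight D g)"
    using assms
  proof cases
    case (swap_second i j k i' j' k')
    have "C * 1 \<le> C * (int i' - int i)" using C[of i j k] swap_second by (intro mult_left_mono) auto
    moreover have "int k' < C" using C[of i' j' k'] swap_second(1) by simp
    ultimately have "0 < C * (int i' - int i) + int k - int k'" by linarith
    then have "0 < (int j' - int j) * (C * (int i' - int i) + int k - int k')"
      using swap_second by (intro mult_pos_pos) auto
    then show ?thesis using swap_second by (simp add: W algebra_simps)
  next
    case (swap_third i j k i' j' k')
    have "C * 1 \<le> C * (int i' - int i)" using C[of i j k] swap_third by (intro mult_left_mono) auto
    moreover have "int j' < C" using C[of i' j' k'] swap_third(1) by simp
    ultimately have "0 < C * (int i' - int i) + int j - int j'" by linarith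
    then have "0 < (int k' - int k) * (C * (int i' - int i) + int j - int j')"
      using swap_third by (intro mult_pos_pos) auto
    then show ?thesis using swap_third by (simp add: W algebra_simps)
  next
    case (straighten i j k j' k')
    then have "0 < (int k' - int k) * (int j - int j')" by (intro mult_pos_pos) auto
    then show ?thesis using straighten by (simp add: W algebra_simps)
  next
    case (move_first a i j k)
    have "0 < C * ((int i - int a) * (int j + int k))"
      using C[of i j k] move_first pos[of i j k] by (intro mult_pos_pos) auto
    then show ?thesis using move_first by (simp add: W W0 algebra_simps)
  next
    case (move_second a i j k)
    have "0 \<le> C * int i * (int j - int a)" using C[of i j k] move_second by (intro mult_nonneg_nonneg) auto
    moreover have "0 < (int j - int a) * (C - int k)" using C[of i j k] move_second by (intro mult_pos_pos) auto
    ultimately have "0 < C * int i * (int j - int a) + (int j - int a) * (C - int k)" by linarith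
    then show ?thesis using move_second by (simp add: W W0 algebra_simps)
  next
    case (move_third a i j k)
    have "C * 1 \<le> C * int i" using C[of i j k] move_third pos[of i j k] by (intro mult_left_mono) auto
    moreover have "int j < C" using C[of i j k] move_third(1) by simp
    ultimately have "0 < C * int i - int j" by linarith
    then have "0 < (int k - int a) * (C * int i - int j)" using move_third by (intro mult_pos_pos) auto
    then show ?thesis using move_third by (simp add: W W0 algebra_simps)
  qed
  then show ?thesis by linarith
qed

sublocale quadratic_rewriting "rees_gens D" "ferrers_step D" "ferrers_weight D"
proof
  have "ferrers_vars D = Xvar ` {1..Max {i. \<exists>j k. (i, j, k) \<in> D}} \<union>
     Yvar ` {1..Max {j. \<exists>i k. (i, j, k) \<in> D}} \<union> Zvar ` {1..Max {k. \<exists>i j. (i, j, k) \<in> D}}"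
    by (simp add: ferrers_vars_def)
  then have "finite (ferrers_vars D)" by simp
  then show "finite (rees_gens D)" using ferrers_finite[OF F] by (simp add: rees_gens_def)
next
  fix p q assume "ferrers_step D p q"
  then show "size p = 2 \<and> size q = 2" by cases auto
qed (fact step_in_gens step_decreases)+

end

fun gen_factors :: "rees_gen \<Rightarrow> xyz multiset" where
  "gen_factors (Inl v) = {#v#}"
| "gen_factors (Inr (i, j, k)) = {#Xvar i, Yvar j, Zvar k#}"

definition xyz_mset :: "rees_gen multiset \<Rightarrow> xyz multiset" where
  "xyz_mset m = sum_mset (image_mset gen_factors m)"

definition tdeg :: "rees_gen multiset \<Rightarrow> nat" where
  "tdeg m = (\<Sum>g\<in>#m. case g of Inl _ \<Rightarrow> 0 | Inr _ \<Rightarrow> 1)"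

lemma xyz_mset_simps [simp]: "xyz_mset {#} = {#}" "xyz_mset (add_mset g m) = gen_factors g + xyz_mset m"
  by (simp_all add: xyz_mset_def)

lemma tdeg_simps [simp]: "tdeg {#} = 0" "tdeg (add_mset (Inl v) m) = tdeg m"
    "tdeg (add_mset (Inr d) m) = Suc (tdeg m)"
  by (simp_all add: tdeg_def)

lemma in_xyz_mset_iff: "v \<in># xyz_mset m \<longleftrightarrow> (\<exists>g. g \<in># m \<and> v \<in># gen_factors g)"
  by (induction m) auto

lemma pair_subset:
  assumes "g \<in># m" "h \<in># m" "g \<noteq> h"
  shows "{#g, h#} \<subseteq># m"
proof -
  obtain m' where m: "m = add_mset g m'" using assms(1) by (blast dest: multi_member_split)
  then have "h \<in># m'" using assms by simp
  then show ?thesis using m by simp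
qed

text \<open>
  Every \<open>T\<close> contributes one variable of each of the three kinds, so the number of free variables of
  a kind is determined by the product and the number of \<open>T\<close>s.
\<close>

lemma free_variable_exists:
  fixes W :: "nat \<Rightarrow> xyz"
  assumes W: "\<And>d. size (filter_mset (\<lambda>v. v \<in> range W) (gen_factors (Inr d))) = 1"
    and "xyz_mset p = xyz_mset q" "tdeg p = tdeg q" "Inl (W a) \<in># p"
  shows "\<exists>b. Inl (W b) \<in># q"
proof -
  have c: "size (filter_mset (\<lambda>v. v \<in> range W) (xyz_mset m)) =
      size (filter_mset (\<lambda>g. g \<in> Inl ` range W) m) + tdeg m" for m
  proof (induction m)
    case (add g m)
    show ?case using add W by (cases g) auto
  qed simp
  have "size (filter_mset (\<lambda>g. g \<in> Inl ` range W) q) = size (filter_mset (\<lambda>g. g \<in> Inl ` range W) p)"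
    using c[of p] c[of q] assms(2,3) by simp
  moreover have "Inl (W a) \<in># filter_mset (\<lambda>g. g \<in> Inl ` range W) p" using assms(4) by simp
  then have "filter_mset (\<lambda>g. g \<in> Inl ` range W) p \<noteq> {#}" by force
  ultimately have "filter_mset (\<lambda>g. g \<in> Inl ` range W) q \<noteq> {#}" by (metis size_eq_0_iff_empty)
  then obtain g where "g \<in># filter_mset (\<lambda>g. g \<in> Inl ` range W) q" by (rule multiset_nonemptyE)
  then show ?thesis by auto
qed

context ferrers_projection
begin

lemma normal_gens: "normal m \<Longrightarrow> g \<in># m \<Longrightarrow> g \<in> rees_gens D"
  by (auto simp: normal_def)

lemma normal_no_step:
  assumes "normal m" "g \<in># m" "h \<in># m" "g \<noteq> h" "step = ferrers_step D"
  shows "\<not> step {#g, h#} q"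
  using assms pair_subset[of g m h] by (auto simp: normal_def)

text \<open>
  If a normal monomial has a free variable of some kind, then the largest variable of this kind that
  occurs in it is free: otherwise it sits in a \<open>T\<close>, and a free smaller one can be exchanged for it.
\<close>

lemma top_free_variable:
  fixes W :: "nat \<Rightarrow> xyz" and \<pi> :: "nat \<times> nat \<times> nat \<Rightarrow> nat"
  assumes occ: "\<And>a d. W a \<in># gen_factors (Inr d) \<longleftrightarrow> a = \<pi> d"
    and move: "\<And>a d. W a \<in> ferrers_vars D \<Longrightarrow> d \<in> D \<Longrightarrow> a < \<pi> d \<Longrightarrow>
      \<exists>q. ferrers_step D {#Inl (W a), Inr d#} q"
    and n: "normal m" and W: "W b \<in># xyz_mset m" "\<And>a. W a \<in># xyz_mset m \<Longrightarrow> a \<le> b"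
    and a: "Inl (W a) \<in># m"
  shows "Inl (W b) \<in># m"
proof -
  obtain g where g: "g \<in># m" "W b \<in># gen_factors g" using W(1) by (auto simp: in_xyz_mset_iff)
  show ?thesis
  proof (cases g)
    case (Inl v)
    then show ?thesis using g by simp
  next
    case (Inr d)
    then have b: "b = \<pi> d" using g(2) occ by simp
    have "W a \<in># xyz_mset m" using a by (force simp: in_xyz_mset_iff)
    then have "a \<le> b" by (rule W(2))
    moreover have "W a \<in> ferrers_vars D" "d \<in> D"
      using normal_gens[OF n a] normal_gens[OF n g(1)] Inr by simp_all
    then have "\<not> a < b" using move[of a d] normal_no_step[OF n a g(1)] Inr b by auto
    ultimately show ?thesis using a by (cases "a = b") auto
  qed
qed

lemma common_free_variable:
  fixes W :: "nat \<Rightarrow> xyz" and \<pi> :: "nat \<times> nat \<times> nat \<Rightarrow> nat"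
  assumes occ: "\<And>a d. W a \<in># gen_factors (Inr d) \<longleftrightarrow> a = \<pi> d"
    and W: "\<And>d. size (filter_mset (\<lambda>v. v \<in> range W) (gen_factors (Inr d))) = 1"
    and inj: "inj W"
    and move: "\<And>a d. W a \<in> ferrers_vars D \<Longrightarrow> d \<in> D \<Longrightarrow> a < \<pi> d \<Longrightarrow>
      \<exists>q. ferrers_step D {#Inl (W a), Inr d#} q"
    and n: "normal p" "normal q" and eq: "xyz_mset p = xyz_mset q" "tdeg p = tdeg q"
    and a: "Inl (W a) \<in># p"
  shows "\<exists>g. g \<in># p \<and> g \<in># q"
proof -
  have fin: "finite {a. W a \<in># xyz_mset p}" using finite_vimageI[OF _ inj, of "set_mset (xyz_mset p)"]
    by (simp add: vimage_def)
  define b where "b = Max {a. W a \<in># xyz_mset p}"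
  have "W a \<in># xyz_mset p" using a by (force simp: in_xyz_mset_iff)
  then have b: "W b \<in># xyz_mset p" "\<And>a. W a \<in># xyz_mset p \<Longrightarrow> a \<le> b"
    using Max_in[OF fin] Max_ge[OF fin] by (auto simp: b_def)
  obtain a' where "Inl (W a') \<in># q" using free_variable_exists[OF W eq a] by blast
  then show ?thesis
    using top_free_variable[of W \<pi>, OF occ move n(1) b a] top_free_variable[of W \<pi>, OF occ move n(2) b[unfolded eq(1)]]
    by blast
qed

lemma xyz_mset_coordinates:
  "count (xyz_mset (image_mset Inr p)) (Xvar i) = count (image_mset fst p) i"
  "count (xyz_mset (image_mset Inr p)) (Yvar i) = count (image_mset snd3 p) i"
  "count (xyz_mset (image_mset Inr p)) (Zvar i) = count (image_mset thd3 p) i"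
  by (induction p) (auto simp: snd3_def thd3_def)

lemma normal_reduced:
  assumes n: "normal (image_mset Inr p)"
  shows "reduced D p" "set_mset p \<subseteq> D"
proof -
  show D: "set_mset p \<subseteq> D" using normal_gens[OF n] by force
  have no: "\<not> ferrers_step D {#Inr d, Inr e#} q" if "d \<in># p" "e \<in># p" "d \<noteq> e" for d e q
    by (rule normal_no_step[OF n]) (use that in auto)
  show "reduced D p" unfolding reduced_def
  proof (intro allI impI conjI notI)
    fix i j k i' j' k' assume d: "(i, j, k) \<in># p" and e: "(i', j', k') \<in># p"
    have dD: "(i, j, k) \<in> D" "(i', j', k') \<in> D" using d e D by auto
    { assume "i < i'" "j < j'" "(i, j', k) \<in> D"
      from swap_second[OF dD this] no[OF d e] \<open>i < i'\<close> show False by auto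
    }
    { assume "i < i'" "k < k'" "(i, j, k') \<in> D"
      from swap_third[OF dD this] no[OF d e] \<open>i < i'\<close> show False by auto
    }
    { assume "i = i'" "j' < j" "k < k'" "(i, j, k') \<in> D"
      with straighten[of i j k D j' k'] dD no[OF d e] show False by auto
    }
  qed
qed

lemma common_generator:
  assumes n: "normal p" "normal q" and eq: "xyz_mset p = xyz_mset q" "tdeg p = tdeg q" and "p \<noteq> {#}"
  shows "\<exists>g. g \<in># p \<and> g \<in># q"
proof (cases "\<exists>v. Inl v \<in># p \<or> Inl v \<in># q")
  case True
  have X: "Xvar a \<in># gen_factors (Inr d) \<longleftrightarrow> a = fst d"
      "size (filter_mset (\<lambda>v. v \<in> range Xvar) (gen_factors (Inr d))) = 1"
    and Y: "Yvar a \<in># gen_factors (Inr d) \<longleftrightarrow> a = snd3 d"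
      "size (filter_mset (\<lambda>v. v \<in> range Yvar) (gen_factors (Inr d))) = 1"
    and Z: "Zvar a \<in># gen_factors (Inr d) \<longleftrightarrow> a = thd3 d"
      "size (filter_mset (\<lambda>v. v \<in> range Zvar) (gen_factors (Inr d))) = 1" for a d
    by (cases d; auto simp: snd3_def thd3_def)+
  have inj: "inj Xvar" "inj Yvar" "inj Zvar" by (auto simp: inj_def)
  have mX: "\<exists>q. ferrers_step D {#Inl (Xvar a), Inr d#} q" if "Xvar a \<in> ferrers_vars D" "d \<in> D" "a < fst d" for a d
    using move_first[of a D] that by (cases d) auto
  have mY: "\<exists>q. ferrers_step D {#Inl (Yvar a), Inr d#} q" if "Yvar a \<in> ferrers_vars D" "d \<in> D" "a < snd3 d" for a d
    using move_second[of a D] that by (cases d) (auto simp: snd3_def)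
  have mZ: "\<exists>q. ferrers_step D {#Inl (Zvar a), Inr d#} q" if "Zvar a \<in> ferrers_vars D" "d \<in> D" "a < thd3 d" for a d
    using move_third[of a D] that by (cases d) (auto simp: thd3_def)
  have *: "\<exists>g. g \<in># p \<and> g \<in># q" if "Inl v \<in># p" "normal p" "normal q" "xyz_mset p = xyz_mset q" "tdeg p = tdeg q" for v p q
    using that(1) common_free_variable[OF X inj(1) mX that(2-5)] common_free_variable[OF Y inj(2) mY that(2-5)]
      common_free_variable[OF Z inj(3) mZ that(2-5)] by (cases v) blast+
  show ?thesis using True *[OF _ n eq] *[OF _ n(2,1) eq[symmetric]] by blast
next
  case False
  have Inr_projr: "image_mset Inr (image_mset projr m) = m" if "\<nexists>v. Inl v \<in># m" for m :: "rees_gen multiset"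
    using that
  proof (induction m)
    case (add g m)
    then show ?case by (cases g) auto
  qed simp
  define p' q' where "p' = image_mset projr p" and "q' = image_mset projr q"
  have p': "p = image_mset Inr p'" and q': "q = image_mset Inr q'"
    unfolding p'_def q'_def using Inr_projr False by simp_all
  have "\<exists>d. d \<in># p' \<and> d \<in># q'"
  proof (rule common_point[OF F P])
    show "set_mset p' \<subseteq> D" "set_mset q' \<subseteq> D" "reduced D p'" "reduced D q'"
      using normal_reduced n p' q' by simp_all
    show "image_mset fst p' = image_mset fst q'" "image_mset snd3 p' = image_mset snd3 q'"
      "image_mset thd3 p' = image_mset thd3 q'"
      using eq(1) unfolding p' q' by (metis multiset_eqI xyz_mset_coordinates)+
    show "p' \<noteq> {#}" using \<open>p \<noteq> {#}\<close> p' by auto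
  qed
  then show ?thesis unfolding p' q' by auto
qed

text \<open>
  Normal monomials with the same product share a generator: a largest free variable if there are
  free variables, and the greedy point otherwise.  It can be cancelled.
\<close>

theorem normal_unique:
  assumes "normal p" "normal q" "xyz_mset p = xyz_mset q" "tdeg p = tdeg q"
  shows "p = q"
  using assms
proof (induction p arbitrary: q rule: measure_induct_rule[of size])
  case (less p)
  have ne: "xyz_mset (add_mset g m) \<noteq> {#}" for g m by (cases g) auto
  show ?case
  proof (cases "p = {#}")
    case True
    then have "q = {#}" using less.prems(3) ne by (metis xyz_mset_simps(1) multiset_cases)
    then show ?thesis using True by simp
  next
    case False
    obtain g where g: "g \<in># p" "g \<in># q" using common_generator[OF less.prems False] by blast
    obtain p' q' where pq: "p = add_mset g p'" "q = add_mset g q'" using g by (meson multi_member_split)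
    have "p' = q'"
    proof (rule less.IH)
      show "size p' < size p" using pq by simp
      show "normal p'" "normal q'" using less.prems pq by (auto simp: normal_add_iff)
      show "xyz_mset p' = xyz_mset q'" using less.prems(3) pq by simp
      show "tdeg p' = tdeg q'" using less.prems(4) pq by (cases g) auto
    qed
    then show ?thesis using pq by simp
  qed
qed

end

section \<open>Polynomial rings\<close>

definition expo :: "'v multiset \<Rightarrow> 'v \<Rightarrow>\<^sub>0 nat" where
  "expo M = (\<Sum>v\<in>#M. Poly_Mapping.single v 1)"

lemma expo_simps [simp]: "expo {#} = 0" "expo (add_mset v M) = Poly_Mapping.single v 1 + expo M"
    "expo (M + N) = expo M + expo N"
  by (simp_all add: expo_def)

lemma lookup_expo: "Poly_Mapping.lookup (expo M) v = count M v"
  by (induction M) (auto simp: lookup_add lookup_single when_def)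

lemma keys_expo: "Poly_Mapping.keys (expo M) = set_mset M"
  by (auto simp: in_keys_iff lookup_expo not_in_iff)

lemma expo_inject: "expo M = expo N \<longleftrightarrow> M = N"
  by (metis lookup_expo multiset_eqI)

lemma expo_surj: "\<exists>M. expo M = m"
proof
  have "finite {x. 0 < Poly_Mapping.lookup m x}" using finite_lookup[of m] by simp
  then show "expo (Abs_multiset (Poly_Mapping.lookup m)) = m"
    by (intro poly_mapping_eqI) (simp add: lookup_expo)
qed

lemma mdeg_expo: "mdeg (expo M) = size M"
  by (simp add: mdeg_def keys_expo lookup_expo size_multiset_overloaded_eq)

lemma mpoly_expand:
  fixes p :: "('v, 'c::comm_ring_1) mpoly"
  shows "p = (\<Sum>m\<in>Poly_Mapping.keys p. Poly_Mapping.single m (Poly_Mapping.lookup p m))"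
proof (rule poly_mapping_eqI)
  fix k
  show "Poly_Mapping.lookup p k = Poly_Mapping.lookup
      (\<Sum>m\<in>Poly_Mapping.keys p. Poly_Mapping.single m (Poly_Mapping.lookup p m)) k"
    by (simp add: lookup_sum lookup_single when_def in_keys_iff)
qed

lemma polysI: "(\<And>m. Poly_Mapping.lookup p m \<noteq> 0 \<Longrightarrow> Poly_Mapping.keys m \<subseteq> V \<and> Poly_Mapping.lookup p m \<in> C)
    \<Longrightarrow> p \<in> polys V C"
  by (simp add: polys_def in_keys_iff)

lemma single_expo_polys: "set_mset M \<subseteq> V \<Longrightarrow> c \<in> C \<Longrightarrow> Poly_Mapping.single (expo M) c \<in> polys V C"
  by (simp add: polys_def keys_expo)

lemma polys_0 [simp]: "0 \<in> polys V C"
  by (simp add: polys_def)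

lemma polys_induct [consumes 1, case_names zero add]:
  fixes p :: "('v, 'c::comm_ring_1) mpoly"
  assumes "p \<in> polys V C" "R 0"
    "\<And>M c q. set_mset M \<subseteq> V \<Longrightarrow> c \<in> C \<Longrightarrow> R q \<Longrightarrow> R (Poly_Mapping.single (expo M) c + q)"
  shows "R p"
proof -
  have "R (\<Sum>m\<in>K. Poly_Mapping.single m (Poly_Mapping.lookup p m))" if "K \<subseteq> Poly_Mapping.keys p" for K
    using finite_subset[OF that finite_keys] that
  proof (induction K rule: finite_induct)
    case (insert m K)
    obtain M where M: "m = expo M" using expo_surj[of m] by blast
    then have "set_mset M \<subseteq> V" "Poly_Mapping.lookup p m \<in> C"
      using insert.prems assms(1) keys_expo[of M] by (auto simp: polys_def)
    then show ?case using insert assms(3) M by simp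
  qed (simp add: assms(2))
  from this[OF subset_refl] show ?thesis by (simp flip: mpoly_expand)
qed

lemma polys_add:
  fixes p q :: "('v, 'c::comm_ring_1) mpoly"
  assumes "\<And>a b. a \<in> C \<Longrightarrow> b \<in> C \<Longrightarrow> a + b \<in> C" "p \<in> polys V C" "q \<in> polys V C"
  shows "p + q \<in> polys V C"
proof (rule polysI)
  fix m assume "Poly_Mapping.lookup (p + q) m \<noteq> 0"
  then show "Poly_Mapping.keys m \<subseteq> V \<and> Poly_Mapping.lookup (p + q) m \<in> C"
    using assms by (cases "m \<in> Poly_Mapping.keys p"; cases "m \<in> Poly_Mapping.keys q")
      (auto simp: polys_def lookup_add in_keys_iff)
qed

lemma single_expo_mult:
  fixes c d :: "'c::comm_ring_1"
  shows "Poly_Mapping.single (expo M) c * Poly_Mapping.single (expo N) d =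
    Poly_Mapping.single (expo (M + N)) (c * d)"
  by (simp add: mult_single)

lemma polys_mult:
  fixes p q :: "('v, 'c::comm_ring_1) mpoly"
  assumes C: "\<And>a b. a \<in> C \<Longrightarrow> b \<in> C \<Longrightarrow> a + b \<in> C" "\<And>a b. a \<in> C \<Longrightarrow> b \<in> C \<Longrightarrow> a * b \<in> C"
    and "p \<in> polys V C" "q \<in> polys V C"
  shows "p * q \<in> polys V C"
  using assms(3)
proof (induction rule: polys_induct)
  case (add M c p)
  have "Poly_Mapping.single (expo M) c * q \<in> polys V C"
    using assms(4)
  proof (induction rule: polys_induct)
    case (add N d q)
    have "Poly_Mapping.single (expo (M + N)) (c * d) \<in> polys V C"
      using add(1,2) \<open>set_mset M \<subseteq> V\<close> \<open>c \<in> C\<close> C(2) by (intro single_expo_polys) auto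
    then show ?case using polys_add[OF C(1) _ add.IH]
      unfolding distrib_left single_expo_mult by blast
  qed simp
  then show ?case using polys_add[OF C(1) _ add.IH] unfolding distrib_right by blast
qed simp

lemma polys_uminus:
  fixes p :: "('v, 'c::comm_ring_1) mpoly"
  assumes "\<And>a. a \<in> C \<Longrightarrow> - a \<in> C" "p \<in> polys V C"
  shows "- p \<in> polys V C"
  using assms by (intro polysI) (auto simp: polys_def in_keys_iff)

lemma subring_polys:
  fixes C :: "'c::comm_ring_1 set"
  assumes "subring_set C"
  shows "subring_set (polys V C)"
proof -
  have "Poly_Mapping.single (expo {#}) 1 \<in> polys V C"
    by (rule single_expo_polys) (use assms in \<open>auto simp: subring_set_def\<close>)
  then have "1 \<in> polys V C" by simp
  then show ?thesis using assms polys_add[of C] polys_mult[of C] polys_uminus[of C]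
    unfolding subring_set_def by (metis polys_0)
qed

lemma pvar_eq: "pvar v = Poly_Mapping.single (expo {#v#}) 1"
  by (simp add: pvar_def)

lemma pconst_eq: "pconst c = Poly_Mapping.single (expo {#}) c"
  by (simp add: pconst_def)

lemma pvar_polys: "v \<in> V \<Longrightarrow> 1 \<in> C \<Longrightarrow> pvar v \<in> polys V C"
  unfolding pvar_eq by (rule single_expo_polys) auto

lemma pconst_polys: "c \<in> C \<Longrightarrow> pconst c \<in> polys V C"
  unfolding pconst_eq by (rule single_expo_polys) auto

lemma prod_pvar: "(\<Prod>v\<in>#M. pvar v) = (Poly_Mapping.single (expo M) 1 :: ('v, 'c::comm_ring_1) mpoly)"
proof (induction M)
  case (add v M)
  then show ?case unfolding pvar_eq by (simp add: mult_single)
qed simp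

lemma lookup_pconst_mult:
  "Poly_Mapping.lookup (pconst c * p) m = (c::'c::comm_ring_1) * Poly_Mapping.lookup p m"
  unfolding pconst_def mult_map_scale_conv_mult[symmetric] by (simp add: Poly_Mapping.map.rep_eq when_def)

lemma peval_0 [simp]: "peval h g 0 = 0"
  by (simp add: peval_def)

lemma peval_add:
  assumes "h 0 = 0" "\<And>a b. h (a + b) = h a + h b"
  shows "peval h g (p + q) = peval h g p + peval h g q"
  unfolding peval_def by (rule setsum_keys_plus_distrib) (simp_all add: assms distrib_right)

lemma peval_single:
  assumes "h 0 = 0"
  shows "peval h g (Poly_Mapping.single (expo M) c) = h c * (\<Prod>v\<in>#M. g v)"
  by (simp add: peval_def assms keys_expo lookup_expo image_prod_mset_multiplicity)

locale peval_hom =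
  fixes h :: "'c::comm_ring_1 \<Rightarrow> 'b::comm_ring_1" and g :: "'v \<Rightarrow> 'b"
  assumes h_add: "h (a + b) = h a + h b" and h_mult: "h (a * b) = h a * h b" and h_1: "h 1 = 1"
begin

lemma h_0: "h 0 = 0"
  using h_add[of 0 0] by simp

lemma ev_add: "peval h g (p + q) = peval h g p + peval h g q"
  by (rule peval_add[OF h_0 h_add])

lemma ev_uminus: "peval h g (- p) = - peval h g p"
  using ev_add[of p "- p"] by (simp add: minus_unique)

lemma ev_diff: "peval h g (p - q) = peval h g p - peval h g q"
  using ev_add[of p "- q"] by (simp add: ev_uminus)

lemma ev_single: "peval h g (Poly_Mapping.single (expo M) c) = h c * (\<Prod>v\<in>#M. g v)"
  by (rule peval_single[of h, OF h_0])

lemma ev_var: "peval h g (pvar v) = g v"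
  unfolding pvar_eq ev_single by (simp add: h_1)

lemma ev_const: "peval h g (pconst c) = h c"
  unfolding pconst_eq ev_single by simp

lemma ev_mult: "peval h g (p * q) = peval h g p * peval h g q"
proof -
  have p: "p \<in> polys UNIV UNIV" and q: "q \<in> polys UNIV UNIV" by (simp_all add: polys_def)
  show ?thesis using p
  proof (induction rule: polys_induct)
    case (add M c p)
    have "peval h g (Poly_Mapping.single (expo M) c * q) =
        peval h g (Poly_Mapping.single (expo M) c) * peval h g q"
      using q
    proof (induction rule: polys_induct)
      case (add N d q)
      have "peval h g (Poly_Mapping.single (expo M) c * Poly_Mapping.single (expo N) d) =
        peval h g (Poly_Mapping.single (expo M) c) * peval h g (Poly_Mapping.single (expo N) d)"
        unfolding single_expo_mult ev_single by (simp add: h_mult algebra_simps)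
      then show ?case using add.IH by (simp add: distrib_left ev_add)
    qed simp
    then show ?case using add.IH by (simp add: distrib_right ev_add)
  qed simp
qed

end

section \<open>The Rees algebra\<close>

definition rees_val :: "rees_gen \<Rightarrow> (xyz, 'k::field) mpoly poly" where
  "rees_val g = (case g of Inl v \<Rightarrow> [:pvar v:] | Inr d \<Rightarrow> Polynomial.monom (ferrers_gen d) 1)"

definition rees_cst :: "'k::field \<Rightarrow> (xyz, 'k) mpoly poly" where
  "rees_cst c = [:pconst c:]"

text \<open>
  Coefficients along normal monomials are ordinary coefficients: a normal monomial is determined
  by its \<open>t\<close>-degree and the exponents of the variables in it.
\<close>

definition rees_cf :: "(xyz, 'k::field) mpoly poly \<Rightarrow> rees_gen multiset \<Rightarrow> 'k" where
  "rees_cf a m = Poly_Mapping.lookup (Polynomial.coeff a (tdeg m)) (expo (xyz_mset m))"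

lemma ferrers_gen_eq: "(ferrers_gen d :: (xyz, 'k::field) mpoly) = Poly_Mapping.single (expo (gen_factors (Inr d))) 1"
proof (cases d)
  case (fields i j k)
  have "(ferrers_gen d :: (xyz, 'k) mpoly) = (\<Prod>v\<in>#gen_factors (Inr d). pvar v)"
    by (simp add: fields ferrers_gen_def mult.assoc)
  then show ?thesis by (simp only: prod_pvar)
qed

lemma prod_rees_val:
  "(\<Prod>g\<in>#m. rees_val g :: (xyz, 'k::field) mpoly poly) =
    Polynomial.monom (Poly_Mapping.single (expo (xyz_mset m)) 1) (tdeg m)"
proof (induction m)
  case empty
  show ?case by (simp flip: single_one add: monom_0 one_pCons)
next
  case (add g m)
  have g: "(rees_val g :: (xyz, 'k) mpoly poly) =
      Polynomial.monom (Poly_Mapping.single (expo (gen_factors g)) 1) (tdeg {#g#})"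
  proof (cases g)
    case (Inl v)
    then show ?thesis by (simp add: rees_val_def pvar_def monom_0)
  next
    case (Inr d)
    then show ?thesis by (simp add: rees_val_def ferrers_gen_eq)
  qed
  have t: "tdeg (add_mset g m) = tdeg {#g#} + tdeg m" by (simp add: tdeg_def)
  show ?case using add unfolding t by (simp add: g mult_monom mult_single)
qed

context ferrers_projection
begin

lemma step_xyz_mset:
  assumes "ferrers_step D p q"
  shows "xyz_mset p = xyz_mset q \<and> tdeg p = tdeg q"
  using assms by cases (auto simp: add_mset_commute)

sublocale toric: quadratic_toric_algebra "rees_gens D" "ferrers_step D" "ferrers_weight D"
  "rees_val :: rees_gen \<Rightarrow> (xyz, 'k::field) mpoly poly" rees_cst rees_cf
proof
  fix p q assume "ferrers_step D p q"
  from step_xyz_mset[OF this]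
  show "(\<Prod>g\<in>#p. rees_val g :: (xyz, 'k) mpoly poly) = (\<Prod>g\<in>#q. rees_val g)"
    by (simp add: prod_rees_val)
next
  fix m n assume n: "normal m" "normal n"
  have "xyz_mset m = xyz_mset n \<and> tdeg m = tdeg n \<longleftrightarrow> m = n" using normal_unique[OF n] by blast
  then show "rees_cf (\<Prod>g\<in>#m. rees_val g :: (xyz, 'k) mpoly poly) n = (if m = n then 1 else 0)"
    by (auto simp: prod_rees_val rees_cf_def lookup_single when_def expo_inject)
qed (simp_all add: rees_cst_def rees_cf_def pconst_def single_add mult_single lookup_add one_pCons
      lookup_pconst_mult[unfolded pconst_def] mult.commute flip: single_one)

end

lemma (in peval_hom) ev_sum: "peval h g (sum f A) = (\<Sum>a\<in>A. peval h g (f a))"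
  by (induction A rule: infinite_finite_induct) (simp_all add: ev_add)

lemma subring_UNIV: "subring_set UNIV"
  by (simp add: subring_set_def)

lemma subring_sum: "subring_set C \<Longrightarrow> (\<And>i. i \<in> A \<Longrightarrow> f i \<in> C) \<Longrightarrow> sum f A \<in> C"
  by (induction A rule: infinite_finite_induct) (auto simp: subring_set_def)

lemma subring_poly_coeffs:
  assumes "subring_set C"
  shows "subring_set {p. \<forall>n. Polynomial.coeff p n \<in> C}"
proof -
  have "Polynomial.coeff (p * q) n \<in> C"
    if "\<forall>n. Polynomial.coeff p n \<in> C" "\<forall>n. Polynomial.coeff q n \<in> C" for p q n
    unfolding coeff_mult by (rule subring_sum[OF assms]) (use that assms in \<open>auto simp: subring_set_def\<close>)
  then show ?thesis using assms unfolding subring_set_def by (auto simp: one_pCons coeff_pCons split: nat.split)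
qed

lemma xyz_mset_add [simp]: "xyz_mset (m + n) = xyz_mset m + xyz_mset n"
  by (simp add: xyz_mset_def)

lemma tdeg_add [simp]: "tdeg (m + n) = tdeg m + tdeg n"
  by (simp add: tdeg_def)

lemma xyz_mset_Inl [simp]: "xyz_mset (image_mset Inl M) = M" and tdeg_Inl [simp]: "tdeg (image_mset Inl M) = 0"
    and tdeg_Inr [simp]: "tdeg (image_mset Inr N) = size N"
  by (induction M; simp)+ (induction N; simp)

lemma gens_split: "\<exists>M N. (m :: rees_gen multiset) = image_mset Inl M + image_mset Inr N"
proof (induction m)
  case empty
  show ?case by (intro exI[of _ "{#}"]) simp
next
  case (add g m)
  then obtain M N where m: "m = image_mset Inl M + image_mset Inr N" by blast
  show ?case
  proof (cases g)
    case (Inl v)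
    then show ?thesis unfolding m by (intro exI[of _ "add_mset v M"] exI[of _ N]) simp
  next
    case (Inr d)
    then show ?thesis unfolding m by (intro exI[of _ M] exI[of _ "add_mset d N"]) simp
  qed
qed

text \<open>The monomial \<open>c x\<^sup>M T\<^sup>N\<close> of \<open>R[T]\<close>.\<close>

definition tmono :: "'k::field \<Rightarrow> xyz multiset \<Rightarrow> (nat \<times> nat \<times> nat) multiset \<Rightarrow>
    (nat \<times> nat \<times> nat, (xyz, 'k) mpoly) mpoly" where
  "tmono c M N = Poly_Mapping.single (expo N) (Poly_Mapping.single (expo M) c)"

interpretation rees: peval_hom "\<lambda>r :: (xyz, 'k::field) mpoly. [:r:]" "\<lambda>d. Polynomial.monom (ferrers_gen d) 1"
  by unfold_locales (simp_all add: one_pCons)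

lemma rees_map_add: "rees_map ferrers_gen (p + q) = rees_map ferrers_gen p + rees_map ferrers_gen q"
  and rees_map_diff: "rees_map ferrers_gen (p - q) = rees_map ferrers_gen p - rees_map ferrers_gen q"
  and rees_map_mult: "rees_map ferrers_gen (p * q) = rees_map ferrers_gen p * rees_map ferrers_gen q"
  and rees_map_sum: "rees_map ferrers_gen (sum f A) = (\<Sum>a\<in>A. rees_map ferrers_gen (f a))"
  and rees_map_0: "rees_map ferrers_gen 0 = 0"
  for p q :: "(nat \<times> nat \<times> nat, (xyz, 'k::field) mpoly) mpoly"
  by (simp_all only: rees_map_def rees.ev_add rees.ev_diff rees.ev_mult rees.ev_sum peval_0)

lemma tmono_mult: "tmono c M N * tmono d M' N' = tmono (c * d) (M + M') (N + N')"
  by (simp add: tmono_def mult_single)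

lemma const_monomial:
  "[:Poly_Mapping.single (expo M) c:] = rees_cst c * (\<Prod>g\<in>#image_mset Inl M. rees_val g :: (xyz, 'k::field) mpoly poly)"
  unfolding prod_rees_val by (simp add: rees_cst_def monom_0 pconst_def mult_single)

lemma rees_map_tmono:
  "rees_map ferrers_gen (tmono c M N) =
    rees_cst c * (\<Prod>g\<in>#image_mset Inl M + image_mset Inr N. rees_val g :: (xyz, 'k::field) mpoly poly)"
proof -
  have "(\<Prod>d\<in>#N. Polynomial.monom (ferrers_gen d :: (xyz, 'k) mpoly) 1) = (\<Prod>g\<in>#image_mset Inr N. rees_val g)"
    by (simp add: multiset.map_comp comp_def rees_val_def)
  then show ?thesis
    unfolding rees_map_def tmono_def rees.ev_single const_monomial by (simp add: mult.assoc)
qed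

lemma single_sum: "Poly_Mapping.single m (sum f A) = (\<Sum>a\<in>A. Poly_Mapping.single m (f a))"
  by (induction A rule: infinite_finite_induct) (simp_all add: single_add)

lemma tmono_expand:
  fixes p :: "(nat \<times> nat \<times> nat, (xyz, 'k::field) mpoly) mpoly"
  shows "p = (\<Sum>m\<in>Poly_Mapping.keys p. \<Sum>m'\<in>Poly_Mapping.keys (Poly_Mapping.lookup p m).
    Poly_Mapping.single m (Poly_Mapping.single m' (Poly_Mapping.lookup (Poly_Mapping.lookup p m) m')))"
  by (subst mpoly_expand, rule sum.cong[OF refl], subst (2) mpoly_expand) (simp only: single_sum)

context ferrers_projection
begin

abbreviation V :: "xyz set" where "V \<equiv> ferrers_vars D"

lemma subring_base: "subring_set (base_ring V)"
  unfolding base_ring_def by (rule subring_polys[OF subring_UNIV])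

lemma gen_factors_V: "d \<in> D \<Longrightarrow> set_mset (gen_factors (Inr d)) \<subseteq> V"
  using vars_of_point by (cases d) auto

lemma ferrers_gen_base: "d \<in> D \<Longrightarrow> ferrers_gen d \<in> base_ring V"
  unfolding ferrers_gen_eq base_ring_def using gen_factors_V by (intro single_expo_polys) auto

lemma gens_subset_iff: "set_mset (image_mset Inl M + image_mset Inr N) \<subseteq> rees_gens D \<longleftrightarrow>
    set_mset M \<subseteq> V \<and> set_mset N \<subseteq> D"
  by (auto simp: rees_gens_def)

lemma tmono_polys: "set_mset M \<subseteq> V \<Longrightarrow> set_mset N \<subseteq> D \<Longrightarrow> tmono c M N \<in> polys D (base_ring V)"
  unfolding tmono_def base_ring_def by (intro single_expo_polys) auto

lemma polys_tmono_induct [consumes 1, case_names zero add]: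
  assumes p: "p \<in> polys D (base_ring V)" and 0: "Q 0"
    and step: "\<And>c M N q. set_mset M \<subseteq> V \<Longrightarrow> set_mset N \<subseteq> D \<Longrightarrow> Q q \<Longrightarrow> Q (tmono c M N + q)"
  shows "Q p"
  using p
proof (induction rule: polys_induct)
  case (add N r q)
  have "r \<in> polys V UNIV" using add(2) by (simp add: base_ring_def)
  then show ?case
  proof (induction rule: polys_induct)
    case (add M c r)
    have "Q (tmono c M N + (Poly_Mapping.single (expo N) r + q))"
      using step add \<open>set_mset N \<subseteq> D\<close> by blast
    then show ?case by (simp add: tmono_def single_add add.assoc)
  qed (use add in simp)
qed (rule 0)

lemma ideal_gen: "ideal (gen_ideal V D ferrers_gen) (ring_on (base_ring V))"
proof -
  interpret R: cring "ring_on (base_ring V)" by (rule cring_ring_on[OF subring_base])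
  show ?thesis unfolding gen_ideal_def
    by (rule R.genideal_ideal) (use ferrers_gen_base in auto)
qed

lemma gen_ideal_sub: "gen_ideal V D ferrers_gen \<subseteq> base_ring V"
  using ideal.Icarr[OF ideal_gen] by auto

lemma gen_in_ideal:
  assumes "d \<in> D"
  shows "(ferrers_gen d :: (xyz, 'k::field) mpoly) \<in> gen_ideal V D ferrers_gen"
proof -
  interpret R: cring "ring_on (base_ring V :: (xyz, 'k) mpoly set)" by (rule cring_ring_on[OF subring_base])
  have "(ferrers_gen :: _ \<Rightarrow> (xyz, 'k) mpoly) ` D \<subseteq> carrier (ring_on (base_ring V))"
    using ferrers_gen_base by auto
  from R.genideal_self[OF this] show ?thesis unfolding gen_ideal_def using assms by blast
qed

lemma gen_ideal_mult: "a \<in> base_ring V \<Longrightarrow> x \<in> gen_ideal V D ferrers_gen \<Longrightarrow> a * x \<in> gen_ideal V D ferrers_gen"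
  using ideal.I_l_closed[OF ideal_gen, of x a] by simp

lemma gen_ideal_add: "x \<in> gen_ideal V D ferrers_gen \<Longrightarrow> y \<in> gen_ideal V D ferrers_gen \<Longrightarrow>
    x + y \<in> gen_ideal V D ferrers_gen"
  using additive_subgroup.a_closed[OF ideal.axioms(1)[OF ideal_gen], of x y] by simp

lemma const_toric: "r \<in> base_ring V \<Longrightarrow> [:r:] \<in> (toric.NS (\<lambda>_. True) :: (xyz, 'k::field) mpoly poly set)"
  unfolding base_ring_def
proof (induction rule: polys_induct)
  case (add M c q)
  have "toric.ev (image_mset Inl M) \<in> (toric.NS (\<lambda>_. True) :: (xyz, 'k) mpoly poly set)"
    by (rule toric.NS_ev_any) (use add(1) in \<open>auto simp: rees_gens_def\<close>)
  then have "rees_cst c * toric.ev (image_mset Inl M) + [:q:] \<in> toric.NS (\<lambda>_. True)"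
    using add.IH by (intro toric.NS_add toric.NS_scale)
  moreover have "[:Poly_Mapping.single (expo M) c + q:] = [:Poly_Mapping.single (expo M) c:] + [:q:]" by simp
  ultimately show ?case by (simp only: const_monomial toric.ev_def)
qed simp

lemma ideal_toric:
  assumes "x \<in> gen_ideal V D (ferrers_gen :: _ \<Rightarrow> (xyz, 'k::field) mpoly)"
  shows "Polynomial.monom x 1 \<in> (toric.NS (\<lambda>_. True) :: (xyz, 'k) mpoly poly set)"
proof -
  interpret R: cring "ring_on (base_ring V :: (xyz, 'k) mpoly set)" by (rule cring_ring_on[OF subring_base])
  let ?K = "{x \<in> base_ring V :: (xyz, 'k) mpoly set. Polynomial.monom x 1 \<in> (toric.NS (\<lambda>_. True) :: (xyz, 'k) mpoly poly set)}"
  have "ideal ?K (ring_on (base_ring V))"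
  proof (rule ideal_ring_on[OF subring_base])
    fix x y assume "x \<in> ?K" "y \<in> ?K"
    then show "x + y \<in> ?K" using subring_base toric.NS_add
      by (auto simp: subring_set_def simp flip: add_monom)
  next
    fix a x :: "(xyz, 'k) mpoly" assume a: "a \<in> base_ring V" and x: "x \<in> ?K"
    have "[:a:] * Polynomial.monom x 1 \<in> toric.NS (\<lambda>_. True)"
      using toric.AA_mult[OF const_toric[OF a]] x by blast
    then show "a * x \<in> ?K" using a x subring_base by (auto simp: subring_set_def smult_monom)
  qed (use subring_base in \<open>auto simp: subring_set_def\<close>)
  moreover have "ferrers_gen ` D \<subseteq> ?K"
  proof safe
    fix d assume d: "d \<in> D"
    show "ferrers_gen d \<in> base_ring V" by (rule ferrers_gen_base[OF d])
    show "Polynomial.monom (ferrers_gen d) 1 \<in> (toric.NS (\<lambda>_. True) :: (xyz, 'k) mpoly poly set)"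
      using toric.AA_mult[OF _ toric.NS_ev[of "{#Inr d#}"], of 1] d toric.one_NS[of "\<lambda>_. True"]
      by (simp add: rees_val_def)
  qed
  ultimately have "gen_ideal V D ferrers_gen \<subseteq> ?K" unfolding gen_ideal_def by (rule R.genideal_minimal)
  then show ?thesis using assms by blast
qed

lemma rees_algebra_eq:
  "rees_algebra V D (ferrers_gen :: _ \<Rightarrow> (xyz, 'k::field) mpoly) = ring_on (toric.NS (\<lambda>_. True))"
proof -
  let ?S = "{p. \<forall>n. Polynomial.coeff p n \<in> base_ring V} :: (xyz, 'k) mpoly poly set"
  let ?U = "univ_poly_ring V :: (xyz, 'k) mpoly poly ring"
  let ?H = "{[:r:] | r. r \<in> base_ring V} \<union> {Polynomial.monom g 1 | g. g \<in> gen_ideal V D ferrers_gen}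
     :: (xyz, 'k) mpoly poly set"
  let ?A = "toric.NS (\<lambda>_. True) :: (xyz, 'k) mpoly poly set"
  have S: "subring_set ?S" by (rule subring_poly_coeffs[OF subring_base])
  have U: "?U = ring_on ?S" by (simp add: univ_poly_ring_def)
  interpret U: cring "ring_on ?S" by (rule cring_ring_on[OF S])
  have 0: "0 \<in> base_ring V" by (simp add: base_ring_def)
  have HS: "?H \<subseteq> carrier (ring_on ?S)"
    using gen_ideal_sub 0 by (auto simp: coeff_pCons split: nat.splits)
  have sub: "a \<in> ?A" if "a \<in> generate_ring ?U ?H" for a
    using that
  proof (induction rule: generate_ring.induct)
    case one
    then show ?case by (simp add: U toric.one_NS)
  next
    case (incl h)
    then show ?case using const_toric ideal_toric by auto
  next
    case (a_inv h)
    have "h \<in> ?S" using U.generate_ring_in_carrier[OF HS, of h] a_inv by (simp add: U)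
    then show ?case using a_inv_ring_on[OF S] a_inv.IH toric.NS_uminus by (simp add: U)
  next
    case (eng_add h1 h2)
    then show ?case using toric.NS_add by (simp add: U)
  next
    case (eng_mult h1 h2)
    then show ?case using toric.AA_mult by (simp add: U)
  qed
  have val: "rees_val g \<in> generate_ring ?U ?H" if "g \<in> rees_gens D" for g
  proof (rule generate_ring.incl, cases g)
    case (Inl v)
    then have "pvar v \<in> base_ring V" using that unfolding base_ring_def by (intro pvar_polys) auto
    then show "rees_val g \<in> ?H" using Inl by (auto simp: rees_val_def)
  next
    case (Inr d)
    then have "(ferrers_gen d :: (xyz, 'k) mpoly) \<in> gen_ideal V D ferrers_gen"
      using that by (intro gen_in_ideal) simp
    then show "rees_val g \<in> ?H" unfolding Inr by (auto simp: rees_val_def)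
  qed
  have ev: "toric.ev m \<in> generate_ring ?U ?H" if "set_mset m \<subseteq> rees_gens D" for m
    using that
  proof (induction m)
    case empty
    show ?case using generate_ring.one[of ?U ?H] by (simp add: U)
  next
    case (add g m)
    then show ?case using generate_ring.eng_mult[OF val, of g "toric.ev m"] by (simp add: U)
  qed
  have cst: "rees_cst c \<in> generate_ring ?U ?H" for c
  proof (rule generate_ring.incl)
    have "pconst c \<in> base_ring V" unfolding base_ring_def by (rule pconst_polys) simp
    then show "rees_cst c \<in> ?H" by (auto simp: rees_cst_def)
  qed
  have sup: "a \<in> generate_ring ?U ?H" if "a \<in> ?A" for a
    using that
  proof (induction rule: toric.NS_induct)
    case zero
    show ?case using U.zero_in_generate[of ?H] by (simp add: U)
  next
    case (add c m b)
    have "rees_cst c * toric.ev m \<in> generate_ring ?U ?H"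
      using generate_ring.eng_mult[OF cst[of c] ev[of m]] add(1) by (simp add: normal_def U)
    from generate_ring.eng_add[OF this add.IH] show ?case by (simp add: U)
  qed
  have "generate_ring ?U ?H = ?A" using sub sup by blast
  then show ?thesis by (simp add: rees_algebra_def)
qed

lemma total_degree_add:
  assumes "p \<in> total_degree_part V D n" "q \<in> total_degree_part V D n"
  shows "p + q \<in> total_degree_part V D n"
proof -
  have "p + q \<in> polys D (base_ring V)"
    by (rule polys_add) (use assms subring_base in \<open>auto simp: total_degree_part_def subring_set_def\<close>)
  moreover have "mdeg m + mdeg m' = n" if "m' \<in> Poly_Mapping.keys (Poly_Mapping.lookup (p + q) m)" for m m'
  proof -
    have "m' \<in> Poly_Mapping.keys (Poly_Mapping.lookup p m) \<or> m' \<in> Poly_Mapping.keys (Poly_Mapping.lookup q m)"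
      using that keys_add by (force simp: lookup_add)
    then have "m \<in> Poly_Mapping.keys p \<and> m' \<in> Poly_Mapping.keys (Poly_Mapping.lookup p m) \<or>
        m \<in> Poly_Mapping.keys q \<and> m' \<in> Poly_Mapping.keys (Poly_Mapping.lookup q m)"
      by (auto simp: in_keys_iff)
    then show ?thesis using assms by (auto simp: total_degree_part_def)
  qed
  ultimately show ?thesis by (simp add: total_degree_part_def)
qed

lemma rees_grading_eq:
  "rees_grading V D (ferrers_gen :: _ \<Rightarrow> (xyz, 'k::field) mpoly) n = toric.graded n"
proof
  show "rees_grading V D (ferrers_gen :: _ \<Rightarrow> (xyz, 'k::field) mpoly) n \<subseteq> toric.graded n"
  proof
    fix a assume "a \<in> rees_grading V D (ferrers_gen :: _ \<Rightarrow> (xyz, 'k::field) mpoly) n"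
    then obtain p where p: "p \<in> total_degree_part V D n" "a = rees_map ferrers_gen p"
      by (auto simp: rees_grading_def)
    have "rees_map ferrers_gen (Poly_Mapping.single m (Poly_Mapping.single m'
        (Poly_Mapping.lookup (Poly_Mapping.lookup p m) m'))) \<in> toric.graded n"
      if m: "m \<in> Poly_Mapping.keys p" "m' \<in> Poly_Mapping.keys (Poly_Mapping.lookup p m)" for m m'
    proof -
      obtain M N where MN: "m' = expo M" "m = expo N" using expo_surj[of m'] expo_surj[of m] by blast
      have "Poly_Mapping.keys m \<subseteq> D \<and> Poly_Mapping.lookup p m \<in> base_ring V"
        using p(1) m(1) by (simp add: total_degree_part_def polys_def)
      then have "Poly_Mapping.lookup p m \<in> base_ring V" "set_mset N \<subseteq> D"
        by (simp_all add: MN keys_expo)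
      then have "Poly_Mapping.keys m' \<subseteq> V" using m(2) by (simp add: base_ring_def polys_def)
      then have "set_mset M \<subseteq> V" by (simp add: MN keys_expo)
      moreover have "size N + size M = n" using p(1) m by (force simp: total_degree_part_def MN mdeg_expo)
      ultimately have "toric.ev (image_mset Inl M + image_mset Inr N) \<in> (toric.graded n :: (xyz, 'k) mpoly poly set)"
        using \<open>set_mset N \<subseteq> D\<close> by (intro toric.NS_ev_any) (simp_all add: gens_subset_iff del: set_mset_union)
      then have "rees_map ferrers_gen (tmono (Poly_Mapping.lookup (Poly_Mapping.lookup p m) m') M N) \<in> toric.graded n"
        unfolding rees_map_tmono toric.ev_def by (rule toric.NS_scale)
      then show ?thesis by (simp add: tmono_def MN)
    qed
    then have "(\<Sum>m\<in>Poly_Mapping.keys p. \<Sum>m'\<in>Poly_Mapping.keys (Poly_Mapping.lookup p m).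
      rees_map ferrers_gen (Poly_Mapping.single m (Poly_Mapping.single m'
        (Poly_Mapping.lookup (Poly_Mapping.lookup p m) m')))) \<in> toric.graded n"
      by (intro toric.NS_sum)
    then show "a \<in> toric.graded n" unfolding p(2) by (subst tmono_expand) (simp only: rees_map_sum)
  qed
  show "toric.graded n \<subseteq> rees_grading V D (ferrers_gen :: _ \<Rightarrow> (xyz, 'k::field) mpoly) n"
  proof
    fix a assume "a \<in> (toric.graded n :: (xyz, 'k) mpoly poly set)"
    then have "\<exists>p \<in> total_degree_part V D n. rees_map ferrers_gen p = a"
    proof (induction rule: toric.NS_induct)
      case zero
      show ?case by (intro bexI[of _ 0]) (auto simp: total_degree_part_def rees_map_0)
    next
      case (add c m b)
      then obtain q where q: "q \<in> total_degree_part V D n" "rees_map ferrers_gen q = b" by blast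
      obtain M N where m: "m = image_mset Inl M + image_mset Inr N" using gens_split by blast
      have MN: "set_mset M \<subseteq> V" "set_mset N \<subseteq> D" using add(1) gens_subset_iff by (auto simp: normal_def m)
      have "tmono c M N \<in> total_degree_part V D n"
        using tmono_polys[OF MN, of c] add(2)
        by (auto simp: total_degree_part_def tmono_def mdeg_expo m split: if_splits)
      then show ?case
        using q total_degree_add by (intro bexI[of _ "tmono c M N + q"])
          (simp_all add: rees_map_add rees_map_tmono toric.ev_def m)
    qed
    then show "a \<in> rees_grading V D (ferrers_gen :: _ \<Rightarrow> (xyz, 'k::field) mpoly) n"
      by (auto simp: rees_grading_def)
  qed
qed

lemma koszul_rees:
  "koszul rees_constants (rees_algebra V D (ferrers_gen :: _ \<Rightarrow> (xyz, 'k::field) mpoly))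
    (rees_grading V D ferrers_gen)"
proof -
  have 1: "(rees_constants :: (xyz, 'k) mpoly poly set) = range rees_cst"
    by (auto simp: rees_constants_def rees_cst_def)
  have 2: "rees_grading V D (ferrers_gen :: _ \<Rightarrow> (xyz, 'k::field) mpoly) = toric.graded"
    using rees_grading_eq by blast
  show ?thesis unfolding 1 2 rees_algebra_eq by (rule toric.koszul_AA)
qed

end

section \<open>Fiber type\<close>

lemma (in peval_hom) ev_prod: "peval h g (prod_mset M) = (\<Prod>p\<in>#M. peval h g p)"
proof (induction M)
  case empty
  show ?case using ev_const[of 1] by (simp add: pconst_def h_1)
qed (simp add: ev_mult)

type_synonym 'k rees_poly = "(nat \<times> nat \<times> nat, (xyz, 'k) mpoly) mpoly"
type_synonym 'k sym_poly = "((xyz, 'k) mpoly, (xyz, 'k) mpoly) mpoly"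

definition to_sym :: "'k::field rees_poly \<Rightarrow> 'k sym_poly" where
  "to_sym = peval pconst (\<lambda>d. pvar (ferrers_gen d))"

definition sym_to_rees :: "'k::field sym_poly \<Rightarrow> (xyz, 'k) mpoly poly" where
  "sym_to_rees = peval (\<lambda>r. [:r:]) (\<lambda>x. Polynomial.monom x 1)"

definition incl_T :: "(nat \<times> nat \<times> nat, 'k::field) mpoly \<Rightarrow> 'k rees_poly" where
  "incl_T = peval (\<lambda>c. pconst (pconst c)) pvar"

interpretation to_sym: peval_hom pconst "\<lambda>d. pvar (ferrers_gen d :: (xyz, 'k::field) mpoly)"
  by unfold_locales (simp_all add: pconst_def single_add mult_single)

interpretation sym_to_rees: peval_hom "\<lambda>r :: (xyz, 'k::field) mpoly. [:r:]" "\<lambda>x. Polynomial.monom x 1"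
  by unfold_locales (simp_all add: one_pCons)

interpretation incl_T: peval_hom "\<lambda>c :: 'k::field. pconst (pconst c) :: 'k rees_poly" pvar
  by unfold_locales (simp_all add: pconst_def single_add mult_single)

interpretation fiber: peval_hom "pconst :: 'k::field \<Rightarrow> (xyz, 'k) mpoly" ferrers_gen
  by unfold_locales (simp_all add: pconst_def single_add mult_single)

lemma subringD:
  assumes "subring_set S"
  shows "0 \<in> S" "1 \<in> S" "x \<in> S \<Longrightarrow> - x \<in> S" "x \<in> S \<Longrightarrow> y \<in> S \<Longrightarrow> x + y \<in> S"
    "x \<in> S \<Longrightarrow> y \<in> S \<Longrightarrow> x * y \<in> S" "x \<in> S \<Longrightarrow> y \<in> S \<Longrightarrow> x - y \<in> S"
proof -
  show *: "0 \<in> S" "1 \<in> S" "x \<in> S \<Longrightarrow> - x \<in> S" "x \<in> S \<Longrightarrow> y \<in> S \<Longrightarrow> x + y \<in> S"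
    "x \<in> S \<Longrightarrow> y \<in> S \<Longrightarrow> x * y \<in> S" for x y using assms by (simp_all add: subring_set_def)
  show "x \<in> S \<Longrightarrow> y \<in> S \<Longrightarrow> x - y \<in> S" using *(4)[of x "- y"] *(3)[of y] by simp
qed

lemma sym_to_rees_hom:
  "sym_to_rees 0 = 0" "sym_to_rees (p + q) = sym_to_rees p + sym_to_rees q"
  "sym_to_rees (p - q) = sym_to_rees p - sym_to_rees q" "sym_to_rees (p * q) = sym_to_rees p * sym_to_rees q"
  "sym_to_rees (pvar x) = Polynomial.monom x 1" "sym_to_rees (pconst r) = [:r:]"
  unfolding sym_to_rees_def by (simp_all only: peval_0 sym_to_rees.ev_add sym_to_rees.ev_diff
      sym_to_rees.ev_mult sym_to_rees.ev_var sym_to_rees.ev_const)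

lemma to_sym_hom:
  "to_sym 0 = 0" "to_sym (p + q) = to_sym p + to_sym q" "to_sym (p - q) = to_sym p - to_sym q"
  "to_sym (p * q) = to_sym p * to_sym q" "to_sym (pvar d) = pvar (ferrers_gen d)" "to_sym (pconst r) = pconst r"
  unfolding to_sym_def by (simp_all only: peval_0 to_sym.ev_add to_sym.ev_diff
      to_sym.ev_mult to_sym.ev_var to_sym.ev_const)

lemma incl_T_hom:
  "incl_T 0 = 0" "incl_T (p + q) = incl_T p + incl_T q" "incl_T (p - q) = incl_T p - incl_T q"
  "incl_T (p * q) = incl_T p * incl_T q" "incl_T (pvar d) = pvar d"
  unfolding incl_T_def by (simp_all only: peval_0 incl_T.ev_add incl_T.ev_diff incl_T.ev_mult incl_T.ev_var)

lemma fiber_map_hom: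
  "fiber_map ferrers_gen 0 = (0 :: (xyz, 'k::field) mpoly)"
  "fiber_map ferrers_gen (p + q) = (fiber_map ferrers_gen p + fiber_map ferrers_gen q :: (xyz, 'k::field) mpoly)"
  "fiber_map ferrers_gen (p - q) = (fiber_map ferrers_gen p - fiber_map ferrers_gen q :: (xyz, 'k::field) mpoly)"
  "fiber_map ferrers_gen (p * q) = (fiber_map ferrers_gen p * fiber_map ferrers_gen q :: (xyz, 'k::field) mpoly)"
  "fiber_map ferrers_gen (pvar d) = (ferrers_gen d :: (xyz, 'k::field) mpoly)"
  unfolding fiber_map_def by (simp_all only: peval_0 fiber.ev_add fiber.ev_diff fiber.ev_mult fiber.ev_var)

text \<open>
  The map \<open>\<psi>\<close> factors through the symmetric algebra of the ideal, since \<open>x \<mapsto> x t\<close> is linear on it.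
\<close>

lemma sym_to_rees_to_sym: "sym_to_rees (to_sym p) = rees_map ferrers_gen p"
proof -
  have "p \<in> polys UNIV UNIV" by (simp add: polys_def)
  then show ?thesis
  proof (induction rule: polys_induct)
    case (add N r q)
    have "sym_to_rees (to_sym (Poly_Mapping.single (expo N) r)) = rees_map ferrers_gen (Poly_Mapping.single (expo N) r)"
      unfolding sym_to_rees_def to_sym_def rees_map_def to_sym.ev_single rees.ev_single
        sym_to_rees.ev_mult sym_to_rees.ev_const sym_to_rees.ev_prod
      by (simp only: multiset.map_comp comp_def sym_to_rees.ev_var)
    then show ?case using add.IH by (simp add: to_sym_hom sym_to_rees_hom rees_map_add)
  qed (simp add: to_sym_hom sym_to_rees_hom rees_map_0)
qed

lemma incl_T_single: "incl_T (Poly_Mapping.single (expo N) c) = tmono c {#} N"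
  unfolding incl_T_def incl_T.ev_single tmono_def prod_pvar by (simp add: pconst_def mult_single)

lemma prod_ferrers_gen:
  "(\<Prod>d\<in>#N. ferrers_gen d :: (xyz, 'k::field) mpoly) = Poly_Mapping.single (expo (xyz_mset (image_mset Inr N))) 1"
  by (induction N) (simp_all add: ferrers_gen_eq mult_single)

lemma size_xyz_mset_Inr: "size (xyz_mset (image_mset Inr N)) = 3 * size N"
proof (induction N)
  case (add d N)
  then show ?case by (cases d) simp
qed simp

text \<open>
  The products of three variables are homogeneous of degree three, so a relation between them
  splits according to the number of factors.  Therefore an element of the kernel of \<open>\<phi>\<close> is still
  mapped to zero when a power of \<open>t\<close> records this number.
\<close>

lemma rees_map_incl_T:
  "Poly_Mapping.lookup (Polynomial.coeff (rees_map ferrers_gen (incl_T q)) n) u =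
    (if mdeg u = 3 * n then Poly_Mapping.lookup (fiber_map ferrers_gen q) u else 0)"
proof -
  have "q \<in> polys UNIV UNIV" by (simp add: polys_def)
  then show ?thesis
  proof (induction rule: polys_induct)
    case zero
    then show ?case by (simp add: incl_T_hom rees_map_0 fiber_map_hom)
  next
    case (add N c q)
    obtain U where u: "u = expo U" using expo_surj[of u] by blast
    have "Poly_Mapping.lookup (Polynomial.coeff (rees_map ferrers_gen (tmono c {#} N)) n) u =
      (if mdeg u = 3 * n then Poly_Mapping.lookup (fiber_map ferrers_gen (Poly_Mapping.single (expo N) c)) u else 0)"
      unfolding rees_map_tmono prod_rees_val fiber_map_def fiber.ev_single prod_ferrers_gen
      by (auto simp: rees_cst_def pconst_def mult_single smult_monom lookup_single when_def u expo_inject mdeg_expo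
          size_xyz_mset_Inr)
    then show ?case using add.IH
      by (simp add: incl_T_hom rees_map_add lookup_add fiber_map_hom incl_T_single)
  qed
qed

context ferrers_projection
begin

abbreviation R :: "(xyz, 'k::field) mpoly set" where "R \<equiv> base_ring V"
abbreviation I :: "(xyz, 'k::field) mpoly set" where "I \<equiv> gen_ideal V D ferrers_gen"
abbreviation RT :: "'k::field rees_poly set" where "RT \<equiv> polys D R"
abbreviation SI :: "'k::field sym_poly set" where "SI \<equiv> sym_ideal R (ideal_module I)"

lemma subring_RT: "subring_set (RT :: 'k::field rees_poly set)"
  by (rule subring_polys[OF subring_base])

lemma subring_SR: "subring_set (polys I R :: 'k::field sym_poly set)"
  by (rule subring_polys[OF subring_base])

lemma subring_prod_mset: "subring_set S \<Longrightarrow> (\<And>x. x \<in># M \<Longrightarrow> x \<in> S) \<Longrightarrow> prod_mset M \<in> S"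
  by (induction M) (auto simp: subring_set_def)

lemma one_R: "1 \<in> R"
  by (rule subringD(2)[OF subring_base])

lemma to_sym_closed: "p \<in> RT \<Longrightarrow> to_sym p \<in> (polys I R :: 'k::field sym_poly set)"
proof (induction rule: polys_induct)
  case (add N r q)
  have "(\<Prod>d\<in>#N. pvar (ferrers_gen d)) \<in> (polys I R :: 'k sym_poly set)"
    by (rule subring_prod_mset[OF subring_SR]) (use add(1) gen_in_ideal one_R in \<open>force intro: pvar_polys\<close>)
  moreover have "pconst r \<in> (polys I R :: 'k sym_poly set)" by (rule pconst_polys[OF add(2)])
  ultimately have "to_sym (Poly_Mapping.single (expo N) r) \<in> (polys I R :: 'k sym_poly set)"
    unfolding to_sym_def to_sym.ev_single by (blast intro: subringD(5)[OF subring_SR])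
  then show ?case unfolding to_sym_hom using add.IH by (rule subringD(4)[OF subring_SR])
qed (simp add: to_sym_hom)

lemma ideal_module_simps [simp]:
  "carrier (ideal_module J) = J" "x \<oplus>\<^bsub>ideal_module J\<^esub> y = x + y" "a \<odot>\<^bsub>ideal_module J\<^esub> x = a * x"
  by (simp_all add: ideal_module_def)

lemma sym_relations_closed: "sym_relations R (ideal_module I) \<subseteq> (polys I R :: 'k::field sym_poly set)"
proof -
  have v: "pvar x \<in> (polys I R :: 'k sym_poly set)" if "x \<in> I" for x by (rule pvar_polys[OF that one_R])
  show ?thesis unfolding sym_relations_def
    by (auto intro!: subringD(5,6)[OF subring_SR] v pconst_polys gen_ideal_add gen_ideal_mult)
qed

lemma ideal_SI: "ideal SI (ring_on (polys I R :: 'k::field sym_poly set))"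
proof -
  interpret S: cring "ring_on (polys I R :: 'k sym_poly set)" by (rule cring_ring_on[OF subring_SR])
  show ?thesis unfolding sym_ideal_def ideal_module_simps
    by (rule S.genideal_ideal) (use sym_relations_closed in simp)
qed

lemma SI_add: "x \<in> SI \<Longrightarrow> y \<in> SI \<Longrightarrow> x + y \<in> (SI :: 'k::field sym_poly set)"
  using additive_subgroup.a_closed[OF ideal.axioms(1)[OF ideal_SI], of x y] by simp

lemma SI_mult: "a \<in> polys I R \<Longrightarrow> x \<in> SI \<Longrightarrow> a * x \<in> (SI :: 'k::field sym_poly set)"
  using ideal.I_l_closed[OF ideal_SI, of x a] by simp

lemma SI_0: "0 \<in> (SI :: 'k::field sym_poly set)"
  using additive_subgroup.zero_closed[OF ideal.axioms(1)[OF ideal_SI]] by simp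

lemma SI_relation: "a \<in> R \<Longrightarrow> x \<in> I \<Longrightarrow> pvar (a * x) - pconst a * pvar x \<in> (SI :: 'k::field sym_poly set)"
proof -
  interpret S: cring "ring_on (polys I R :: 'k sym_poly set)" by (rule cring_ring_on[OF subring_SR])
  assume "a \<in> R" "x \<in> I"
  then have "pvar (a * x) - pconst a * pvar x \<in> (sym_relations R (ideal_module I) :: 'k sym_poly set)"
    by (auto simp: sym_relations_def)
  moreover have "(sym_relations R (ideal_module I) :: 'k sym_poly set) \<subseteq> carrier (ring_on (polys I R))"
    using sym_relations_closed by simp
  ultimately show ?thesis using S.genideal_self unfolding sym_ideal_def ideal_module_simps by blast
qed

definition ker_alpha :: "'k::field rees_poly set" where "ker_alpha = {p \<in> RT. to_sym p \<in> SI}"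
definition ker_psi :: "'k::field rees_poly set" where "ker_psi = {p \<in> RT. rees_map ferrers_gen p = 0}"
definition ker_phi :: "(nat \<times> nat \<times> nat, 'k::field) mpoly set" where
  "ker_phi = {q \<in> polys D UNIV. fiber_map ferrers_gen q = 0}"
definition fiber_ideal :: "'k::field rees_poly set" where
  "fiber_ideal = genideal (ring_on RT) (incl_T ` ker_phi)"

lemma kernel_alpha:
  "a_kernel (ring_on RT) (symmetric_algebra R (ideal_module I)) (sym_map V D ferrers_gen) =
    (ker_alpha :: 'k::field rees_poly set)"
proof -
  interpret S: cring "ring_on (polys I R :: 'k sym_poly set)" by (rule cring_ring_on[OF subring_SR])
  interpret SI: ideal SI "ring_on (polys I R :: 'k sym_poly set)" by (rule ideal_SI)
  have "sym_map V D ferrers_gen p = SI \<longleftrightarrow> to_sym p \<in> SI" if "p \<in> RT" for p :: "'k rees_poly"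
    using to_sym_closed[OF that] SI.rcos_const_imp_mem[of "to_sym p"] SI.a_rcos_const[of "to_sym p"]
    by (auto simp: sym_map_def Let_def to_sym_def)
  then show ?thesis
    by (auto simp: a_kernel_def' ker_alpha_def symmetric_algebra_def FactRing_def)
qed

lemma kernel_psi:
  "a_kernel (ring_on RT) (univ_poly_ring V) (rees_map ferrers_gen) = (ker_psi :: 'k::field rees_poly set)"
  by (simp add: a_kernel_def' ker_psi_def univ_poly_ring_def)

lemma kernel_phi:
  "a_kernel (ring_on (polys D UNIV)) (ring_on R) (fiber_map ferrers_gen) =
    (ker_phi :: (nat \<times> nat \<times> nat, 'k::field) mpoly set)"
  by (simp add: a_kernel_def' ker_phi_def)

lemma RT_closed: "p \<in> RT \<Longrightarrow> q \<in> RT \<Longrightarrow> p + q \<in> (RT :: 'k::field rees_poly set)"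
    "p \<in> RT \<Longrightarrow> q \<in> RT \<Longrightarrow> p * q \<in> (RT :: 'k::field rees_poly set)"
    "p \<in> RT \<Longrightarrow> q \<in> RT \<Longrightarrow> p - q \<in> (RT :: 'k::field rees_poly set)"
  by (rule subringD(4)[OF subring_RT] subringD(5)[OF subring_RT] subringD(6)[OF subring_RT]; assumption)+

lemma incl_T_closed: "q \<in> polys D UNIV \<Longrightarrow> incl_T q \<in> (RT :: 'k::field rees_poly set)"
proof (induction rule: polys_induct)
  case (add N c q)
  have "tmono c {#} N \<in> RT" by (rule tmono_polys) (use add in auto)
  then have "incl_T (Poly_Mapping.single (expo N) c) + incl_T q \<in> RT"
    using add.IH RT_closed(1) by (simp add: incl_T_single)
  then show ?case by (simp add: incl_T_hom)
qed (simp add: incl_T_hom)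

lemma ideal_ker_psi: "ideal ker_psi (ring_on (RT :: 'k::field rees_poly set))"
  by (rule ideal_ring_on[OF subring_RT])
    (auto simp: ker_psi_def rees_map_0 rees_map_add rees_map_mult RT_closed)

lemma ideal_ker_alpha: "ideal ker_alpha (ring_on (RT :: 'k::field rees_poly set))"
proof (rule ideal_ring_on[OF subring_RT])
  fix a x :: "'k rees_poly" assume "a \<in> RT" "x \<in> ker_alpha"
  then show "a * x \<in> ker_alpha" using SI_mult[OF to_sym_closed]
    by (auto simp: ker_alpha_def to_sym_hom RT_closed)
next
  fix x y :: "'k rees_poly" assume "x \<in> ker_alpha" "y \<in> ker_alpha"
  then show "x + y \<in> ker_alpha" using SI_add
    by (auto simp: ker_alpha_def to_sym_hom RT_closed)
qed (auto simp: ker_alpha_def to_sym_hom SI_0)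

lemma incl_ker_phi: "incl_T ` ker_phi \<subseteq> (RT :: 'k::field rees_poly set)"
  using incl_T_closed by (auto simp: ker_phi_def)

lemma ideal_fiber_ideal: "ideal fiber_ideal (ring_on (RT :: 'k::field rees_poly set))"
proof -
  interpret cring "ring_on (RT :: 'k rees_poly set)" by (rule cring_ring_on[OF subring_RT])
  show ?thesis unfolding fiber_ideal_def by (rule genideal_ideal) (use incl_ker_phi in simp)
qed

lemma incl_fiber_ideal: "q \<in> ker_phi \<Longrightarrow> incl_T q \<in> (fiber_ideal :: 'k::field rees_poly set)"
proof -
  interpret cring "ring_on (RT :: 'k rees_poly set)" by (rule cring_ring_on[OF subring_RT])
  have "incl_T ` ker_phi \<subseteq> (fiber_ideal :: 'k rees_poly set)"
    unfolding fiber_ideal_def by (rule genideal_self) (use incl_ker_phi in simp)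
  then show "q \<in> ker_phi \<Longrightarrow> ?thesis" by blast
qed

lemma fiber_ideal_sub: "fiber_ideal \<subseteq> (ker_psi :: 'k::field rees_poly set)"
proof -
  interpret cring "ring_on (RT :: 'k rees_poly set)" by (rule cring_ring_on[OF subring_RT])
  have "rees_map ferrers_gen (incl_T q) = 0" if "fiber_map ferrers_gen q = 0" for q :: "(nat \<times> nat \<times> nat, 'k) mpoly"
    by (intro poly_eqI poly_mapping_eqI) (simp add: rees_map_incl_T that)
  then have "incl_T ` ker_phi \<subseteq> (ker_psi :: 'k rees_poly set)"
    using incl_T_closed by (auto simp: ker_phi_def ker_psi_def)
  then show ?thesis unfolding fiber_ideal_def by (rule genideal_minimal[OF ideal_ker_psi])
qed

lemma ker_alpha_sub: "ker_alpha \<subseteq> (ker_psi :: 'k::field rees_poly set)"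
proof -
  interpret S: cring "ring_on (polys I R :: 'k sym_poly set)" by (rule cring_ring_on[OF subring_SR])
  let ?K = "{p \<in> polys I R. sym_to_rees p = 0} :: 'k sym_poly set"
  have "ideal ?K (ring_on (polys I R))"
    by (rule ideal_ring_on[OF subring_SR])
      (auto simp: sym_to_rees_hom intro: subringD(4,5)[OF subring_SR])
  moreover have "sym_relations R (ideal_module I) \<subseteq> ?K"
  proof
    fix p :: "'k sym_poly" assume p: "p \<in> sym_relations R (ideal_module I)"
    then have "sym_to_rees p = 0"
      by (auto simp: sym_relations_def sym_to_rees_hom smult_monom simp flip: add_monom)
    then show "p \<in> ?K" using p sym_relations_closed by auto
  qed
  ultimately have "SI \<subseteq> ?K" unfolding sym_ideal_def ideal_module_simps by (rule S.genideal_minimal)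
  then show ?thesis by (auto simp: ker_alpha_def ker_psi_def simp flip: sym_to_rees_to_sym)
qed

text \<open>
  The right-hand side of the definition of fiber type.
\<close>

definition J :: "'k::field rees_poly set" where
  "J = {x + y | x y. x \<in> ker_alpha \<and> y \<in> fiber_ideal}"

lemma ideal_closed:
  assumes "ideal P (ring_on (RT :: 'k::field rees_poly set))"
  shows "x \<in> P \<Longrightarrow> y \<in> P \<Longrightarrow> x + y \<in> P" "a \<in> RT \<Longrightarrow> x \<in> P \<Longrightarrow> a * x \<in> P" "0 \<in> P"
  using additive_subgroup.a_closed[OF ideal.axioms(1)[OF assms], of x y] ideal.I_l_closed[OF assms, of x a]
    additive_subgroup.zero_closed[OF ideal.axioms(1)[OF assms]] by simp_all

lemma J_add: "x \<in> J \<Longrightarrow> y \<in> J \<Longrightarrow> x + y \<in> (J :: 'k::field rees_poly set)"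
proof -
  assume "x \<in> J" "y \<in> J"
  then obtain a b a' b' where *: "a \<in> ker_alpha" "b \<in> fiber_ideal" "a' \<in> ker_alpha" "b' \<in> fiber_ideal"
    "x = a + b" "y = a' + b'" by (auto simp: J_def)
  have "x + y = (a + a') + (b + b')" using * by (simp add: algebra_simps)
  then show ?thesis using ideal_closed(1)[OF ideal_ker_alpha, of a a'] ideal_closed(1)[OF ideal_fiber_ideal, of b b'] *
    unfolding J_def by blast
qed

lemma J_mult: "c \<in> RT \<Longrightarrow> x \<in> J \<Longrightarrow> c * x \<in> (J :: 'k::field rees_poly set)"
proof -
  assume c: "c \<in> RT" and "x \<in> J"
  then obtain a b where *: "a \<in> ker_alpha" "b \<in> fiber_ideal" "x = a + b" by (auto simp: J_def)
  have "c * x = c * a + c * b" using * by (simp add: algebra_simps)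
  then show ?thesis using ideal_closed(2)[OF ideal_ker_alpha c, of a] ideal_closed(2)[OF ideal_fiber_ideal c, of b] *
    unfolding J_def by blast
qed

lemma J_alpha: "x \<in> ker_alpha \<Longrightarrow> x \<in> (J :: 'k::field rees_poly set)"
  and J_fiber: "y \<in> fiber_ideal \<Longrightarrow> y \<in> (J :: 'k::field rees_poly set)"
  and J_0: "0 \<in> (J :: 'k::field rees_poly set)"
  unfolding J_def using ideal_closed(3)[OF ideal_ker_alpha] ideal_closed(3)[OF ideal_fiber_ideal]
  by (metis (mono_tags, lifting) add.left_neutral add.right_neutral mem_Collect_eq)+

definition T :: "rees_gen multiset \<Rightarrow> 'k::field rees_poly" where
  "T m = (\<Prod>g\<in>#m. case g of Inl v \<Rightarrow> pconst (pvar v) | Inr d \<Rightarrow> pvar d)"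

lemma T_simps [simp]: "T {#} = 1" "T (add_mset (Inl v) m) = pconst (pvar v) * T m"
    "T (add_mset (Inr d) m) = pvar d * T m" "T (m + n) = T m * T n"
  by (simp_all add: T_def)

lemma tmono_T:
  fixes c :: "'k::field"
  shows "tmono c M N = tmono c {#} {#} * T (image_mset Inl M + image_mset Inr N)"
proof -
  have "T (image_mset Inl M) = tmono (1::'k) M {#}"
  proof (induction M)
    case (add v M)
    then show ?case by (simp add: tmono_def pconst_def pvar_def mult_single)
  qed (simp add: tmono_def)
  moreover have "T (image_mset Inr N) = tmono (1::'k) {#} N"
  proof (induction N)
    case (add d N)
    then show ?case by (simp add: tmono_def pconst_def pvar_def mult_single)
  qed (simp add: tmono_def)
  ultimately show ?thesis by (simp add: tmono_mult)
qed

lemma T_closed: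
  assumes "set_mset m \<subseteq> rees_gens D" shows "T m \<in> (RT :: 'k::field rees_poly set)"
proof -
  obtain M N where m: "m = image_mset Inl M + image_mset Inr N" using gens_split by blast
  have "tmono (1::'k) M N \<in> RT" using assms unfolding m gens_subset_iff by (intro tmono_polys) auto
  moreover have "tmono (1::'k) {#} {#} = 1" by (simp add: tmono_def)
  ultimately show ?thesis unfolding m by (simp only: tmono_T[of 1 M N] mult_1)
qed

lemma rees_map_T: "rees_map ferrers_gen (tmono c {#} {#} * T m) = rees_cst c * (toric.ev m :: (xyz, 'k::field) mpoly poly)"
proof -
  obtain M N where m: "m = image_mset Inl M + image_mset Inr N" using gens_split by blast
  show ?thesis unfolding m toric.ev_def by (simp only: tmono_T[symmetric] rees_map_tmono)
qed

text \<open>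
  Both products represent the same element of the ideal, and the symmetric algebra is linear in it.
\<close>

lemma linear_relation:
  assumes "v \<in> V" "d \<in> D" "v' \<in> V" "d' \<in> D"
    and eq: "pvar v * ferrers_gen d = (pvar v' * ferrers_gen d' :: (xyz, 'k::field) mpoly)"
  shows "T {#Inl v, Inr d#} - T {#Inl v', Inr d'#} \<in> (ker_alpha :: 'k rees_poly set)"
proof -
  have vR: "(pvar v :: (xyz, 'k) mpoly) \<in> R" "(pvar v' :: (xyz, 'k) mpoly) \<in> R"
    using assms by (auto simp: base_ring_def intro: pvar_polys)
  have rel: "pvar (pvar v * ferrers_gen d) - pconst (pvar v) * pvar (ferrers_gen d) \<in> (SI :: 'k sym_poly set)"
    "pvar (pvar v' * ferrers_gen d') - pconst (pvar v') * pvar (ferrers_gen d') \<in> (SI :: 'k sym_poly set)"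
    using SI_relation vR gen_in_ideal assms by blast+
  have "- 1 \<in> (polys I R :: 'k sym_poly set)" by (intro subringD(2,3)[OF subring_SR])
  from SI_add[OF rel(2) SI_mult[OF this rel(1)]]
  have "pconst (pvar v) * pvar (ferrers_gen d) - pconst (pvar v') * pvar (ferrers_gen d') \<in> (SI :: 'k sym_poly set)"
    by (simp add: eq)
  moreover have "T {#Inl v, Inr d#} - T {#Inl v', Inr d'#} \<in> (RT :: 'k rees_poly set)"
    using assms by (intro RT_closed(3) T_closed) auto
  ultimately show ?thesis
    by (simp add: ker_alpha_def to_sym_hom)
qed

lemma fiber_relation:
  assumes "d \<in> D" "e \<in> D" "d' \<in> D" "e' \<in> D"
    and eq: "ferrers_gen d * ferrers_gen e = (ferrers_gen d' * ferrers_gen e' :: (xyz, 'k::field) mpoly)"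
  shows "T {#Inr d, Inr e#} - T {#Inr d', Inr e'#} \<in> (fiber_ideal :: 'k rees_poly set)"
proof -
  let ?q = "pvar d * pvar e - pvar d' * pvar e' :: (nat \<times> nat \<times> nat, 'k) mpoly"
  have S: "subring_set (polys D UNIV :: (nat \<times> nat \<times> nat, 'k) mpoly set)" by (rule subring_polys[OF subring_UNIV])
  have v: "(pvar x :: (_, 'k) mpoly) \<in> polys D UNIV" if "x \<in> D" for x by (rule pvar_polys[OF that]) simp
  have "?q \<in> polys D UNIV"
    by (intro subringD(5,6)[OF S] v assms)
  moreover have "fiber_map ferrers_gen ?q = 0"
    by (simp add: fiber_map_hom eq)
  ultimately have "?q \<in> ker_phi" by (simp add: ker_phi_def)
  from incl_fiber_ideal[OF this] show ?thesis
    by (simp add: incl_T_hom)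
qed

text \<open>
  Steps that exchange two \<open>T\<close>s are relations of the special fiber; steps that move a variable are
  relations of the symmetric algebra.
\<close>

lemma step_J:
  assumes "ferrers_step D p q"
  shows "T p - T q \<in> (J :: 'k::field rees_poly set)"
proof -
  have G: "set_mset p \<subseteq> rees_gens D" "set_mset q \<subseteq> rees_gens D" using step_in_gens[OF assms] by auto
  have gen: "ferrers_gen (i, j, k) = (pvar (Xvar i) * pvar (Yvar j) * pvar (Zvar k) :: (xyz, 'k) mpoly)" for i j k
    by (simp add: ferrers_gen_def)
  show ?thesis using assms
  proof cases
    case (swap_second i j k i' j' k')
    then show ?thesis using G unfolding swap_second(1,2)
      by (intro J_fiber fiber_relation) (simp_all add: gen algebra_simps)
  next
    case (swap_third i j k i' j' k')
    then show ?thesis using G unfolding swap_third(1,2)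
      by (intro J_fiber fiber_relation) (simp_all add: gen algebra_simps)
  next
    case (straighten i j k j' k')
    then show ?thesis using G unfolding straighten(1,2)
      by (intro J_fiber fiber_relation) (simp_all add: gen algebra_simps)
  next
    case (move_first a i j k)
    then show ?thesis using G unfolding move_first(1,2)
      by (intro J_alpha linear_relation) (simp_all add: gen algebra_simps)
  next
    case (move_second a i j k)
    then show ?thesis using G unfolding move_second(1,2)
      by (intro J_alpha linear_relation) (simp_all add: gen algebra_simps)
  next
    case (move_third a i j k)
    then show ?thesis using G unfolding move_third(1,2)
      by (intro J_alpha linear_relation) (simp_all add: gen algebra_simps)
  qed
qed

lemma rewr_J:
  assumes "rewr\<^sup>*\<^sup>* m n" "set_mset m \<subseteq> rees_gens D"
  shows "T m - T n \<in> (J :: 'k::field rees_poly set)"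
  using assms(1)
proof (induction rule: rtranclp_induct)
  case (step y z)
  obtain p q r where s: "ferrers_step D p q" and yz: "y = p + r" "z = q + r"
    using step.hyps(2) by (auto simp: rewr_def)
  have "set_mset y \<subseteq> rees_gens D" using rewr_star_props[OF step.hyps(1) assms(2)] by simp
  then have "T r * (T p - T q) \<in> (J :: 'k rees_poly set)" by (intro J_mult T_closed step_J[OF s]) (simp add: yz)
  then have "T y - T z \<in> (J :: 'k rees_poly set)" by (simp add: yz algebra_simps)
  from J_add[OF step.IH this] show ?case by simp
qed (simp add: J_0)

text \<open>
  Rewriting changes a polynomial only by elements of \<open>J\<close>.
\<close>

lemma reduce_mod_J:
  assumes "p \<in> (RT :: 'k::field rees_poly set)"
  shows "\<exists>F c. finite F \<and> (\<forall>n\<in>F. normal n) \<and> p - (\<Sum>n\<in>F. tmono (c n) {#} {#} * T n) \<in> J"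
  using assms
proof (induction rule: polys_tmono_induct)
  case zero
  show ?case by (intro exI[of _ "{}"]) (simp add: J_0)
next
  case (add k M N p)
  then obtain F c where F: "finite F" "\<forall>n\<in>F. normal n" "p - (\<Sum>n\<in>F. tmono (c n) {#} {#} * T n) \<in> J" by blast
  define m :: "rees_gen multiset" where "m = image_mset Inl M + image_mset Inr N"
  have m: "set_mset m \<subseteq> rees_gens D" unfolding m_def gens_subset_iff using add by simp
  obtain n0 where n0: "normal n0" "rewr\<^sup>*\<^sup>* m n0" using normal_form_exists[OF m] by blast
  have "tmono k {#} {#} * (T m - T n0) \<in> J" by (rule J_mult[OF tmono_polys rewr_J[OF n0(2) m]]) simp_all
  from J_add[OF this F(3)]
  have 1: "tmono k {#} {#} * (T m - T n0) + (p - (\<Sum>n\<in>F. tmono (c n) {#} {#} * T n)) \<in> J" .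
  define c' where "c' n = (if n = n0 then k else 0) + (if n \<in> F then c n else 0)" for n
  have t: "tmono (a + b) {#} {#} = tmono a {#} {#} + tmono b {#} {#}" "tmono 0 {#} {#} = 0" for a b :: 'k
    by (simp_all add: tmono_def single_add)
  have "(\<Sum>n\<in>insert n0 F. tmono (c' n) {#} {#} * T n) =
      (\<Sum>n\<in>insert n0 F. if n = n0 then tmono k {#} {#} * T n else 0) +
      (\<Sum>n\<in>insert n0 F. if n \<in> F then tmono (c n) {#} {#} * T n else 0)"
    unfolding sum.distrib[symmetric] by (rule sum.cong) (auto simp: c'_def t distrib_right)
  also have "\<dots> = tmono k {#} {#} * T n0 + (\<Sum>n\<in>F. tmono (c n) {#} {#} * T n)"
    using F(1) by (intro arg_cong2[of _ _ _ _ "(+)"] sum.mono_neutral_cong_right) auto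
  finally have 2: "tmono k M N + p - (\<Sum>n\<in>insert n0 F. tmono (c' n) {#} {#} * T n) =
      tmono k {#} {#} * (T m - T n0) + (p - (\<Sum>n\<in>F. tmono (c n) {#} {#} * T n))"
    by (simp add: tmono_T[of k M N] m_def algebra_simps)
  show ?case
  proof (intro exI[of _ "insert n0 F"] exI[of _ c'] conjI)
    show "tmono k M N + p - (\<Sum>n\<in>insert n0 F. tmono (c' n) {#} {#} * T n) \<in> J" unfolding 2 by (rule 1)
  qed (use F n0 in simp_all)
qed

text \<open>
  An element of the kernel of \<open>\<psi>\<close> is congruent modulo \<open>J\<close> to a combination of normal monomials, whose
  image is zero; as the images of normal monomials are independent, the combination is zero.
\<close>

lemma J_eq_ker_psi: "J = (ker_psi :: 'k::field rees_poly set)"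
proof
  show sub: "J \<subseteq> (ker_psi :: 'k rees_poly set)"
    using ker_alpha_sub fiber_ideal_sub ideal_closed(1)[OF ideal_ker_psi] by (auto simp: J_def)
  show "ker_psi \<subseteq> (J :: 'k rees_poly set)"
  proof
    fix p :: "'k rees_poly" assume p: "p \<in> ker_psi"
    then obtain F c where F: "finite F" "\<forall>n\<in>F. normal n" "p - (\<Sum>n\<in>F. tmono (c n) {#} {#} * T n) \<in> J"
      using reduce_mod_J[of p] by (auto simp: ker_psi_def)
    have "rees_map ferrers_gen (p - (\<Sum>n\<in>F. tmono (c n) {#} {#} * T n)) = 0"
      using F(3) sub by (auto simp: ker_psi_def)
    then have "(\<Sum>n\<in>F. rees_cst (c n) * toric.ev n :: (xyz, 'k) mpoly poly) = 0"
      using p by (simp add: rees_map_diff rees_map_sum rees_map_T ker_psi_def)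
    then have z: "rees_cf (\<Sum>n\<in>F. rees_cst (c n) * toric.ev n :: (xyz, 'k) mpoly poly) m = 0" for m
      by (simp add: rees_cf_def)
    have "c m = 0" if m: "m \<in> F" for m
    proof -
      have "0 = (\<Sum>n\<in>F. rees_cf (rees_cst (c n) * toric.ev n :: (xyz, 'k) mpoly poly) m)"
        using z[of m] by (simp only: toric.cf_sum)
      also have "\<dots> = (\<Sum>n\<in>F. if n = m then c n else 0)"
        by (rule sum.cong) (use F(2) m in \<open>auto simp: toric.cf_scale toric.cf_ev\<close>)
      finally have "0 = (\<Sum>n\<in>F. if n = m then c n else 0)" .
      then show ?thesis using F(1) m by simp
    qed
    then have "(\<Sum>n\<in>F. tmono (c n) {#} {#} * T n) = (0 :: 'k rees_poly)"
      by (intro sum.neutral) (simp add: tmono_def)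
    then show "p \<in> J" using F(3) by simp
  qed
qed

lemma fiber_type: "fiber_type V D (ferrers_gen :: _ \<Rightarrow> (xyz, 'k::field) mpoly)"
proof -
  have "J = ker_alpha <+>\<^bsub>ring_on RT\<^esub> (fiber_ideal :: 'k rees_poly set)"
    by (auto simp: J_def set_add_def')
  then show ?thesis
    unfolding fiber_type_def Let_def kernel_alpha kernel_psi kernel_phi J_eq_ker_psi[symmetric]
    by (simp only: fiber_ideal_def incl_T_def)
qed

end

theorem theorem6p5:
  fixes D :: "(nat \<times> nat \<times> nat) set"
    and f :: "nat \<times> nat \<times> nat \<Rightarrow> (xyz, 'k::field_char_0) mpoly"
  assumes "ferrers_diagram D"
    and "projection_property D"
    and "f = ferrers_gen"
  shows "koszul rees_constants (rees_algebra (ferrers_vars D) D f) (rees_grading (ferrers_vars D) D f)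
    \<and> fiber_type (ferrers_vars D) D f"
proof -
  interpret ferrers_projection D by unfold_locales (fact assms)+
  show ?thesis unfolding assms(3) using koszul_rees fiber_type by blast
qed

end
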